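(* Let $\mathcal{E}$ be a list-arithmetic pretopos. Then $\mathcal{E}$ has pullback-stable coequalisers.
   Context: A category $\mathcal{E}$ with finite limits has parametrised list objects if for every $X \in \mathcal{E}$ there is an object $L(X)$ with morphisms $r_0^{X}: \mathbf{1} \to L(X)$ and $r_1^{X}: L(X) \times X \to L(X)$ such that for all $b: B \to Y$ and $g: Y \times X \to Y$ there is a unique $u: B \times L(X) \to Y$ with $u\circ(1_B, r_0^X\cdot !_B)=b$ and $u\circ(1_B\times r_1^X)=g\circ(u\times 1_X)\circ\sigma$, where $\sigma: B \times (L(X) \times X) \to (B \times L(X))\times X$ is the associativity isomorphism. A list-arithmetic pretopos is an exact (in the sense of Barr), lextensive category with parametrised list objects; lextensive means having finite limits and being extensive, i.e. having finite coproducts such that the canonical functors $\mathcal{E}/A \times \mathcal{E}/B \to \mathcal{E}/(A+B)$ are equivalences. A category $\mathcal{E}$ with pullbacks has pullback-stable coequalisers if it has coequalisers and for every $f: X \to Y$ the pullback functor $f^{*}: \mathcal{E}/Y \to \mathcal{E}/X$ preserves coequalisers. *)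

theory Defs
  imports Main
begin

section \<open>Categories, functors, natural isomorphisms and equivalences\<close>

record ('o, 'm) cat =
  Ob :: "'o set"
  Ar :: "'m set"
  Dom :: "'m \<Rightarrow> 'o"
  Cod :: "'m \<Rightarrow> 'o"
  Id :: "'o \<Rightarrow> 'm"
  Comp :: "'m \<Rightarrow> 'm \<Rightarrow> 'm"  (infixr \<open>\<cdot>\<index>\<close> 70)

definition hom :: "('o, 'm) cat \<Rightarrow> 'o \<Rightarrow> 'o \<Rightarrow> 'm set" where
  "hom C A B = {f \<in> Ar C. Dom C f = A \<and> Cod C f = B}"

locale category =
  fixes C :: "('o, 'm) cat" (structure)
  assumes Dom_in_Ob: "f \<in> Ar C \<Longrightarrow> Dom C f \<in> Ob C"
    and Cod_in_Ob: "f \<in> Ar C \<Longrightarrow> Cod C f \<in> Ob C"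
    and Id_in_hom: "A \<in> Ob C \<Longrightarrow> Id C A \<in> hom C A A"
    and Comp_in_hom: "\<lbrakk>f \<in> hom C A B; g \<in> hom C B D\<rbrakk> \<Longrightarrow> g \<cdot> f \<in> hom C A D"
    and Comp_Id: "f \<in> Ar C \<Longrightarrow> f \<cdot> Id C (Dom C f) = f"
    and Id_Comp: "f \<in> Ar C \<Longrightarrow> Id C (Cod C f) \<cdot> f = f"
    and Comp_assoc: "\<lbrakk>f \<in> hom C A B; g \<in> hom C B D; h \<in> hom C D F\<rbrakk>
      \<Longrightarrow> (h \<cdot> g) \<cdot> f = h \<cdot> (g \<cdot> f)"

record ('o1, 'm1, 'o2, 'm2) fctr =
  FOb :: "'o1 \<Rightarrow> 'o2"
  FAr :: "'m1 \<Rightarrow> 'm2"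

definition is_functor ::
  "('o1, 'm1) cat \<Rightarrow> ('o2, 'm2) cat \<Rightarrow> ('o1, 'm1, 'o2, 'm2) fctr \<Rightarrow> bool" where
  "is_functor C D F \<longleftrightarrow>
     (\<forall>A\<in>Ob C. FOb F A \<in> Ob D) \<and>
     (\<forall>f\<in>Ar C. FAr F f \<in> hom D (FOb F (Dom C f)) (FOb F (Cod C f))) \<and>
     (\<forall>A\<in>Ob C. FAr F (Id C A) = Id D (FOb F A)) \<and>
     (\<forall>f\<in>Ar C. \<forall>g\<in>Ar C. Dom C g = Cod C f \<longrightarrow>
        FAr F (g \<cdot>\<^bsub>C\<^esub> f) = FAr F g \<cdot>\<^bsub>D\<^esub> FAr F f)"

definition id_functor :: "('o, 'm, 'o, 'm) fctr" where
  "id_functor = \<lparr>FOb = (\<lambda>A. A), FAr = (\<lambda>f. f)\<rparr>"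

definition comp_functor ::
  "('o2, 'm2, 'o3, 'm3) fctr \<Rightarrow> ('o1, 'm1, 'o2, 'm2) fctr \<Rightarrow> ('o1, 'm1, 'o3, 'm3) fctr" where
  "comp_functor G F = \<lparr>FOb = FOb G \<circ> FOb F, FAr = FAr G \<circ> FAr F\<rparr>"

definition is_iso :: "('o, 'm) cat \<Rightarrow> 'm \<Rightarrow> bool" where
  "is_iso C f \<longleftrightarrow> f \<in> Ar C \<and>
     (\<exists>g \<in> hom C (Cod C f) (Dom C f).
        g \<cdot>\<^bsub>C\<^esub> f = Id C (Dom C f) \<and> f \<cdot>\<^bsub>C\<^esub> g = Id C (Cod C f))"

definition is_natural_iso ::
  "('o1, 'm1) cat \<Rightarrow> ('o2, 'm2) cat \<Rightarrow> ('o1, 'm1, 'o2, 'm2) fctr \<Rightarrow> ('o1, 'm1, 'o2, 'm2) fctr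
    \<Rightarrow> ('o1 \<Rightarrow> 'm2) \<Rightarrow> bool" where
  "is_natural_iso C D F G \<eta> \<longleftrightarrow>
     (\<forall>A\<in>Ob C. \<eta> A \<in> hom D (FOb F A) (FOb G A) \<and> is_iso D (\<eta> A)) \<and>
     (\<forall>f\<in>Ar C. FAr G f \<cdot>\<^bsub>D\<^esub> \<eta> (Dom C f) = \<eta> (Cod C f) \<cdot>\<^bsub>D\<^esub> FAr F f)"

definition is_equivalence ::
  "('o1, 'm1) cat \<Rightarrow> ('o2, 'm2) cat \<Rightarrow> ('o1, 'm1, 'o2, 'm2) fctr \<Rightarrow> bool" where
  "is_equivalence C D F \<longleftrightarrow> is_functor C D F \<and>
     (\<exists>G \<eta> \<epsilon>. is_functor D C G \<and>
        is_natural_iso C C id_functor (comp_functor G F) \<eta> \<and>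
        is_natural_iso D D (comp_functor F G) id_functor \<epsilon>)"

definition prod_cat ::
  "('o1, 'm1) cat \<Rightarrow> ('o2, 'm2) cat \<Rightarrow> ('o1 \<times> 'o2, 'm1 \<times> 'm2) cat" where
  "prod_cat C D = \<lparr>
     Ob = Ob C \<times> Ob D,
     Ar = Ar C \<times> Ar D,
     Dom = (\<lambda>(f, g). (Dom C f, Dom D g)),
     Cod = (\<lambda>(f, g). (Cod C f, Cod D g)),
     Id = (\<lambda>(A, B). (Id C A, Id D B)),
     Comp = (\<lambda>(f', g') (f, g). (f' \<cdot>\<^bsub>C\<^esub> f, g' \<cdot>\<^bsub>D\<^esub> g))\<rparr>"

text \<open>The slice \<open>C/Y\<close>: the arrow \<open>(f, h, g)\<close> is the commutative triangle \<open>g \<cdot> h = f\<close>, regarded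
  as an arrow from \<open>f\<close> to \<open>g\<close>.\<close>

definition slice :: "('o, 'm) cat \<Rightarrow> 'o \<Rightarrow> ('m, 'm \<times> 'm \<times> 'm) cat" where
  "slice C Y = \<lparr>
     Ob = {f \<in> Ar C. Cod C f = Y},
     Ar = {(f, h, g). f \<in> Ar C \<and> Cod C f = Y \<and> g \<in> Ar C \<and> Cod C g = Y \<and>
                      h \<in> hom C (Dom C f) (Dom C g) \<and> g \<cdot>\<^bsub>C\<^esub> h = f},
     Dom = (\<lambda>(f, h, g). f),
     Cod = (\<lambda>(f, h, g). g),
     Id = (\<lambda>f. (f, Id C (Dom C f), f)),
     Comp = (\<lambda>(_, h', g') (f, h, _). (f, h' \<cdot>\<^bsub>C\<^esub> h, g'))\<rparr>"

section \<open>Finite limits\<close>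

definition is_cone ::
  "('o1, 'm1) cat \<Rightarrow> ('o, 'm) cat \<Rightarrow> ('o1, 'm1, 'o, 'm) fctr \<Rightarrow> 'o \<Rightarrow> ('o1 \<Rightarrow> 'm) \<Rightarrow> bool" where
  "is_cone J C D L \<pi> \<longleftrightarrow> L \<in> Ob C \<and>
     (\<forall>j\<in>Ob J. \<pi> j \<in> hom C L (FOb D j)) \<and>
     (\<forall>a\<in>Ar J. FAr D a \<cdot>\<^bsub>C\<^esub> \<pi> (Dom J a) = \<pi> (Cod J a))"

definition is_limit ::
  "('o1, 'm1) cat \<Rightarrow> ('o, 'm) cat \<Rightarrow> ('o1, 'm1, 'o, 'm) fctr \<Rightarrow> 'o \<Rightarrow> ('o1 \<Rightarrow> 'm) \<Rightarrow> bool" where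
  "is_limit J C D L \<pi> \<longleftrightarrow> is_cone J C D L \<pi> \<and>
     (\<forall>M \<mu>. is_cone J C D M \<mu> \<longrightarrow>
        (\<exists>!u. u \<in> hom C M L \<and> (\<forall>j\<in>Ob J. \<pi> j \<cdot>\<^bsub>C\<^esub> u = \<mu> j)))"

text \<open>Every finite category is isomorphic to one whose objects and arrows are natural numbers, so
  it suffices to let the shape range over these.\<close>

definition has_finite_limits :: "('o, 'm) cat \<Rightarrow> bool" where
  "has_finite_limits C \<longleftrightarrow>
     (\<forall>(J :: (nat, nat) cat) D.
        category J \<and> finite (Ob J) \<and> finite (Ar J) \<and> is_functor J C D \<longrightarrow>
        (\<exists>L \<pi>. is_limit J C D L \<pi>))"

definition is_terminal :: "('o, 'm) cat \<Rightarrow> 'o \<Rightarrow> bool" where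
  "is_terminal C T \<longleftrightarrow> T \<in> Ob C \<and> (\<forall>A\<in>Ob C. \<exists>!f. f \<in> hom C A T)"

definition is_product :: "('o, 'm) cat \<Rightarrow> 'o \<Rightarrow> 'o \<Rightarrow> 'o \<Rightarrow> 'm \<Rightarrow> 'm \<Rightarrow> bool" where
  "is_product C A B P p q \<longleftrightarrow> P \<in> Ob C \<and> p \<in> hom C P A \<and> q \<in> hom C P B \<and>
     (\<forall>T\<in>Ob C. \<forall>f \<in> hom C T A. \<forall>g \<in> hom C T B.
        \<exists>!u. u \<in> hom C T P \<and> p \<cdot>\<^bsub>C\<^esub> u = f \<and> q \<cdot>\<^bsub>C\<^esub> u = g)"

definition is_pullback :: "('o, 'm) cat \<Rightarrow> 'm \<Rightarrow> 'm \<Rightarrow> 'o \<Rightarrow> 'm \<Rightarrow> 'm \<Rightarrow> bool" where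
  "is_pullback C f g P p q \<longleftrightarrow>
     f \<in> Ar C \<and> g \<in> Ar C \<and> Cod C f = Cod C g \<and>
     P \<in> Ob C \<and> p \<in> hom C P (Dom C f) \<and> q \<in> hom C P (Dom C g) \<and>
     f \<cdot>\<^bsub>C\<^esub> p = g \<cdot>\<^bsub>C\<^esub> q \<and>
     (\<forall>T\<in>Ob C. \<forall>s \<in> hom C T (Dom C f). \<forall>t \<in> hom C T (Dom C g).
        f \<cdot>\<^bsub>C\<^esub> s = g \<cdot>\<^bsub>C\<^esub> t \<longrightarrow>
        (\<exists>!u. u \<in> hom C T P \<and> p \<cdot>\<^bsub>C\<^esub> u = s \<and> q \<cdot>\<^bsub>C\<^esub> u = t))"

definition has_pullbacks :: "('o, 'm) cat \<Rightarrow> bool" where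
  "has_pullbacks C \<longleftrightarrow>
     (\<forall>f\<in>Ar C. \<forall>g\<in>Ar C. Cod C f = Cod C g \<longrightarrow> (\<exists>P p q. is_pullback C f g P p q))"

text \<open>Limits and colimits are chosen by Hilbert's operator. The choices are meaningful only where
  the objects in question exist; all notions built on them are invariant under isomorphism, hence
  do not depend on the choice.\<close>

definition terminal_ob :: "('o, 'm) cat \<Rightarrow> 'o" where
  "terminal_ob C = (SOME T. is_terminal C T)"

definition bang :: "('o, 'm) cat \<Rightarrow> 'o \<Rightarrow> 'm" where
  "bang C A = (THE f. f \<in> hom C A (terminal_ob C))"

definition chosen_product :: "('o, 'm) cat \<Rightarrow> 'o \<Rightarrow> 'o \<Rightarrow> 'o \<times> 'm \<times> 'm" where
  "chosen_product C A B = (SOME (P, p, q). is_product C A B P p q)"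

definition prod_ob :: "('o, 'm) cat \<Rightarrow> 'o \<Rightarrow> 'o \<Rightarrow> 'o" where
  "prod_ob C A B = fst (chosen_product C A B)"

definition proj1 :: "('o, 'm) cat \<Rightarrow> 'o \<Rightarrow> 'o \<Rightarrow> 'm" where
  "proj1 C A B = fst (snd (chosen_product C A B))"

definition proj2 :: "('o, 'm) cat \<Rightarrow> 'o \<Rightarrow> 'o \<Rightarrow> 'm" where
  "proj2 C A B = snd (snd (chosen_product C A B))"

definition pairing :: "('o, 'm) cat \<Rightarrow> 'm \<Rightarrow> 'm \<Rightarrow> 'm" where
  "pairing C f g = (THE u. u \<in> hom C (Dom C f) (prod_ob C (Cod C f) (Cod C g)) \<and>
     proj1 C (Cod C f) (Cod C g) \<cdot>\<^bsub>C\<^esub> u = f \<and> proj2 C (Cod C f) (Cod C g) \<cdot>\<^bsub>C\<^esub> u = g)"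

definition prod_ar :: "('o, 'm) cat \<Rightarrow> 'm \<Rightarrow> 'm \<Rightarrow> 'm" where
  "prod_ar C f g = pairing C
     (f \<cdot>\<^bsub>C\<^esub> proj1 C (Dom C f) (Dom C g))
     (g \<cdot>\<^bsub>C\<^esub> proj2 C (Dom C f) (Dom C g))"

definition assoc :: "('o, 'm) cat \<Rightarrow> 'o \<Rightarrow> 'o \<Rightarrow> 'o \<Rightarrow> 'm" where
  "assoc C A B D = pairing C
     (pairing C (proj1 C A (prod_ob C B D))
                (proj1 C B D \<cdot>\<^bsub>C\<^esub> proj2 C A (prod_ob C B D)))
     (proj2 C B D \<cdot>\<^bsub>C\<^esub> proj2 C A (prod_ob C B D))"

definition chosen_pullback :: "('o, 'm) cat \<Rightarrow> 'm \<Rightarrow> 'm \<Rightarrow> 'o \<times> 'm \<times> 'm" where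
  "chosen_pullback C f g = (SOME (P, p, q). is_pullback C f g P p q)"

definition pb_ob :: "('o, 'm) cat \<Rightarrow> 'm \<Rightarrow> 'm \<Rightarrow> 'o" where
  "pb_ob C f g = fst (chosen_pullback C f g)"

definition pb_proj1 :: "('o, 'm) cat \<Rightarrow> 'm \<Rightarrow> 'm \<Rightarrow> 'm" where
  "pb_proj1 C f g = fst (snd (chosen_pullback C f g))"

definition pb_proj2 :: "('o, 'm) cat \<Rightarrow> 'm \<Rightarrow> 'm \<Rightarrow> 'm" where
  "pb_proj2 C f g = snd (snd (chosen_pullback C f g))"

definition pullback_functor ::
  "('o, 'm) cat \<Rightarrow> 'm \<Rightarrow> ('m, 'm \<times> 'm \<times> 'm, 'm, 'm \<times> 'm \<times> 'm) fctr" where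
  "pullback_functor C f = \<lparr>
     FOb = (\<lambda>g. pb_proj1 C f g),
     FAr = (\<lambda>(g, h, g'). (pb_proj1 C f g,
        THE k. k \<in> hom C (pb_ob C f g) (pb_ob C f g') \<and>
               pb_proj1 C f g' \<cdot>\<^bsub>C\<^esub> k = pb_proj1 C f g \<and>
               pb_proj2 C f g' \<cdot>\<^bsub>C\<^esub> k = h \<cdot>\<^bsub>C\<^esub> pb_proj2 C f g,
        pb_proj1 C f g'))\<rparr>"

section \<open>Coequalisers\<close>

definition is_coequaliser :: "('o, 'm) cat \<Rightarrow> 'm \<Rightarrow> 'm \<Rightarrow> 'm \<Rightarrow> bool" where
  "is_coequaliser C u v q \<longleftrightarrow>
     u \<in> Ar C \<and> v \<in> Ar C \<and> Dom C u = Dom C v \<and> Cod C u = Cod C v \<and>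
     q \<in> Ar C \<and> Dom C q = Cod C u \<and> q \<cdot>\<^bsub>C\<^esub> u = q \<cdot>\<^bsub>C\<^esub> v \<and>
     (\<forall>h\<in>Ar C. Dom C h = Cod C u \<and> h \<cdot>\<^bsub>C\<^esub> u = h \<cdot>\<^bsub>C\<^esub> v \<longrightarrow>
        (\<exists>!k. k \<in> hom C (Cod C q) (Cod C h) \<and> k \<cdot>\<^bsub>C\<^esub> q = h))"

definition has_coequalisers :: "('o, 'm) cat \<Rightarrow> bool" where
  "has_coequalisers C \<longleftrightarrow>
     (\<forall>u\<in>Ar C. \<forall>v\<in>Ar C. Dom C u = Dom C v \<and> Cod C u = Cod C v \<longrightarrow>
        (\<exists>q. is_coequaliser C u v q))"

definition preserves_coequalisers ::
  "('o1, 'm1) cat \<Rightarrow> ('o2, 'm2) cat \<Rightarrow> ('o1, 'm1, 'o2, 'm2) fctr \<Rightarrow> bool" where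
  "preserves_coequalisers C D F \<longleftrightarrow>
     (\<forall>u v q. is_coequaliser C u v q \<longrightarrow> is_coequaliser D (FAr F u) (FAr F v) (FAr F q))"

definition has_pullback_stable_coequalisers :: "('o, 'm) cat \<Rightarrow> bool" where
  "has_pullback_stable_coequalisers C \<longleftrightarrow> has_pullbacks C \<and> has_coequalisers C \<and>
     (\<forall>X\<in>Ob C. \<forall>Y\<in>Ob C. \<forall>f \<in> hom C X Y.
        preserves_coequalisers (slice C Y) (slice C X) (pullback_functor C f))"

section \<open>Barr-exact categories\<close>

definition is_regular_epi :: "('o, 'm) cat \<Rightarrow> 'm \<Rightarrow> bool" where
  "is_regular_epi C e \<longleftrightarrow> (\<exists>u v. is_coequaliser C u v e)"

definition is_kernel_pair :: "('o, 'm) cat \<Rightarrow> 'm \<Rightarrow> 'm \<Rightarrow> 'm \<Rightarrow> bool" where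
  "is_kernel_pair C f r s \<longleftrightarrow> is_pullback C f f (Dom C r) r s"

definition regular_category :: "('o, 'm) cat \<Rightarrow> bool" where
  "regular_category C \<longleftrightarrow> category C \<and> has_finite_limits C \<and>
     (\<forall>f r s. is_kernel_pair C f r s \<longrightarrow> (\<exists>q. is_coequaliser C r s q)) \<and>
     (\<forall>f e P p q. is_pullback C f e P p q \<and> is_regular_epi C e \<longrightarrow> is_regular_epi C p)"

text \<open>Internal equivalence relations in terms of generalised elements, as in Barr's definition:
  \<open>hom(T, R)\<close> maps injectively onto an equivalence relation on \<open>hom(T, X)\<close>, for every \<open>T\<close>.\<close>

definition is_equivalence_relation :: "('o, 'm) cat \<Rightarrow> 'o \<Rightarrow> 'm \<Rightarrow> 'm \<Rightarrow> bool" where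
  "is_equivalence_relation C X r s \<longleftrightarrow>
     r \<in> Ar C \<and> s \<in> Ar C \<and> Dom C r = Dom C s \<and> Cod C r = X \<and> Cod C s = X \<and>
     (\<forall>T\<in>Ob C. inj_on (\<lambda>t. (r \<cdot>\<^bsub>C\<^esub> t, s \<cdot>\<^bsub>C\<^esub> t)) (hom C T (Dom C r)) \<and>
        equiv (hom C T X) ((\<lambda>t. (r \<cdot>\<^bsub>C\<^esub> t, s \<cdot>\<^bsub>C\<^esub> t)) ` hom C T (Dom C r)))"

definition exact_category :: "('o, 'm) cat \<Rightarrow> bool" where
  "exact_category C \<longleftrightarrow> regular_category C \<and>
     (\<forall>X r s. is_equivalence_relation C X r s \<longrightarrow> (\<exists>f. is_kernel_pair C f r s))"

section \<open>Lextensive categories\<close>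

definition has_finite_coproducts :: "('o, 'm) cat \<Rightarrow> bool" where
  "has_finite_coproducts C \<longleftrightarrow>
     (\<forall>(n :: nat) A. (\<forall>i<n. A i \<in> Ob C) \<longrightarrow>
        (\<exists>S\<in>Ob C. \<exists>\<iota>. (\<forall>i<n. \<iota> i \<in> hom C (A i) S) \<and>
           (\<forall>T\<in>Ob C. \<forall>f. (\<forall>i<n. f i \<in> hom C (A i) T) \<longrightarrow>
              (\<exists>!u. u \<in> hom C S T \<and> (\<forall>i<n. u \<cdot>\<^bsub>C\<^esub> \<iota> i = f i)))))"

definition is_coproduct :: "('o, 'm) cat \<Rightarrow> 'o \<Rightarrow> 'o \<Rightarrow> 'o \<Rightarrow> 'm \<Rightarrow> 'm \<Rightarrow> bool" where
  "is_coproduct C A B S i j \<longleftrightarrow> S \<in> Ob C \<and> i \<in> hom C A S \<and> j \<in> hom C B S \<and>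
     (\<forall>T\<in>Ob C. \<forall>f \<in> hom C A T. \<forall>g \<in> hom C B T.
        \<exists>!u. u \<in> hom C S T \<and> u \<cdot>\<^bsub>C\<^esub> i = f \<and> u \<cdot>\<^bsub>C\<^esub> j = g)"

definition chosen_coproduct :: "('o, 'm) cat \<Rightarrow> 'o \<Rightarrow> 'o \<Rightarrow> 'o \<times> 'm \<times> 'm" where
  "chosen_coproduct C A B = (SOME (S, i, j). is_coproduct C A B S i j)"

definition coprod_ob :: "('o, 'm) cat \<Rightarrow> 'o \<Rightarrow> 'o \<Rightarrow> 'o" where
  "coprod_ob C A B = fst (chosen_coproduct C A B)"

definition inj1 :: "('o, 'm) cat \<Rightarrow> 'o \<Rightarrow> 'o \<Rightarrow> 'm" where
  "inj1 C A B = fst (snd (chosen_coproduct C A B))"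

definition inj2 :: "('o, 'm) cat \<Rightarrow> 'o \<Rightarrow> 'o \<Rightarrow> 'm" where
  "inj2 C A B = snd (snd (chosen_coproduct C A B))"

definition coprod_ar :: "('o, 'm) cat \<Rightarrow> 'm \<Rightarrow> 'm \<Rightarrow> 'm" where
  "coprod_ar C f g = (THE u.
     u \<in> hom C (coprod_ob C (Dom C f) (Dom C g)) (coprod_ob C (Cod C f) (Cod C g)) \<and>
     u \<cdot>\<^bsub>C\<^esub> inj1 C (Dom C f) (Dom C g) = inj1 C (Cod C f) (Cod C g) \<cdot>\<^bsub>C\<^esub> f \<and>
     u \<cdot>\<^bsub>C\<^esub> inj2 C (Dom C f) (Dom C g) = inj2 C (Cod C f) (Cod C g) \<cdot>\<^bsub>C\<^esub> g)"

text \<open>The canonical functor from \<open>C/A \<times> C/B\<close> to \<open>C/(A + B)\<close> sends \<open>(f, g)\<close> to \<open>f + g\<close>; the objects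
  \<open>A\<close> and \<open>B\<close> are determined by \<open>f\<close> and \<open>g\<close>.\<close>

definition coprod_functor ::
  "('o, 'm) cat \<Rightarrow> ('m \<times> 'm, ('m \<times> 'm \<times> 'm) \<times> ('m \<times> 'm \<times> 'm), 'm, 'm \<times> 'm \<times> 'm) fctr" where
  "coprod_functor C = \<lparr>
     FOb = (\<lambda>(f, g). coprod_ar C f g),
     FAr = (\<lambda>((f, h, f'), (g, k, g')).
        (coprod_ar C f g, coprod_ar C h k, coprod_ar C f' g'))\<rparr>"

definition extensive_category :: "('o, 'm) cat \<Rightarrow> bool" where
  "extensive_category C \<longleftrightarrow> category C \<and> has_finite_coproducts C \<and>
     (\<forall>A\<in>Ob C. \<forall>B\<in>Ob C.
        is_equivalence (prod_cat (slice C A) (slice C B)) (slice C (coprod_ob C A B))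
          (coprod_functor C))"

definition lextensive_category :: "('o, 'm) cat \<Rightarrow> bool" where
  "lextensive_category C \<longleftrightarrow> has_finite_limits C \<and> extensive_category C"

section \<open>Parametrised list objects and list-arithmetic pretoposes\<close>

definition is_list_object :: "('o, 'm) cat \<Rightarrow> 'o \<Rightarrow> 'o \<Rightarrow> 'm \<Rightarrow> 'm \<Rightarrow> bool" where
  "is_list_object C X L r0 r1 \<longleftrightarrow>
     L \<in> Ob C \<and> r0 \<in> hom C (terminal_ob C) L \<and> r1 \<in> hom C (prod_ob C L X) L \<and>
     (\<forall>B\<in>Ob C. \<forall>Y\<in>Ob C. \<forall>b \<in> hom C B Y. \<forall>g \<in> hom C (prod_ob C Y X) Y.
        \<exists>!u. u \<in> hom C (prod_ob C B L) Y \<and>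
          u \<cdot>\<^bsub>C\<^esub> pairing C (Id C B) (r0 \<cdot>\<^bsub>C\<^esub> bang C B) = b \<and>
          u \<cdot>\<^bsub>C\<^esub> prod_ar C (Id C B) r1 = g \<cdot>\<^bsub>C\<^esub> prod_ar C u (Id C X) \<cdot>\<^bsub>C\<^esub> assoc C B L X)"

definition has_parametrised_list_objects :: "('o, 'm) cat \<Rightarrow> bool" where
  "has_parametrised_list_objects C \<longleftrightarrow> has_finite_limits C \<and>
     (\<forall>X\<in>Ob C. \<exists>L r0 r1. is_list_object C X L r0 r1)"

definition list_arithmetic_pretopos :: "('o, 'm) cat \<Rightarrow> bool" where
  "list_arithmetic_pretopos C \<longleftrightarrow>
     exact_category C \<and> lextensive_category C \<and> has_parametrised_list_objects C"

end

theory Submission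
  imports Defs
begin

text \<open>
  A parallel pair \<open>u, v : A \<rightarrow> X\<close> generates a reflexive symmetric graph on \<open>X\<close> with edges \<open>A + (A + X)\<close>.
  Its paths are the pairs of a vertex and a list of edges on which two lists of vertices agree, so they
  form an equaliser. The image in \<open>X \<times> X\<close> of the pairs of opposite paths is an equivalence relation,
  and exactness provides its quotient \<open>q\<close>: two elements identified by \<open>q\<close> are joined, locally for
  regular epimorphisms, by a path.

  This last property characterises the coequaliser and makes it stable. In the pullback \<open>X'\<close> of \<open>q\<close> along
  an arbitrary \<open>f\<close>, dropping the last edge of a path moves its endpoint inside the fibre, and any \<open>h\<close> that
  coequalises the pulled back pair is invariant under this move. Because list objects are parametrised,
  the move can be iterated along the path itself until no edge is left, whence \<open>h\<close> identifies the
  endpoints of the path. Since the pullback of \<open>q\<close> is a regular epimorphism, \<open>h\<close> factors through it.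
\<close>

text \<open>Exactness provides quotients of equivalence relations only, and the relation generated
  by a pair needs chains of unbounded length; this is what list objects supply. Stability is the
  harder half: regular epimorphisms are pullback-stable in a regular category, but the universal
  property of a coequaliser of a pair that is no kernel pair does not visibly survive pullback.
  Hence the quotient is recognised by a property that speaks of covers and paths and of no test
  object. No path is lifted to \<open>X'\<close> as a whole. A list can serve as a counter for
  iterating an endomorphism, so the backward move is turned into an endomorphism of an object of
  states, each a path with a point over its end. The move has to be total, and here the loops enter:
  the empty path has a loop as its last edge, and no case distinction on the list arises. Everything
  is phrased with generalised elements: an arrow from \<open>T\<close> to \<open>X\<close> is an
  element of \<open>X\<close> at stage \<open>T\<close>, precomposition is substitution, and
  existence may require passing to a cover, that is, precomposing with a regular
  epimorphism.\<close>

declare hom_def [simp]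

section \<open>Finite limits and generalised elements\<close>

context category
begin

lemma Ob_simps [simp]:
  "f \<in> Ar C \<Longrightarrow> Dom C f \<in> Ob C"
  "f \<in> Ar C \<Longrightarrow> Cod C f \<in> Ob C"
  by (fact Dom_in_Ob, fact Cod_in_Ob)

lemma Id_simps [simp]:
  assumes "A \<in> Ob C"
  shows "Id C A \<in> Ar C" "Dom C (Id C A) = A" "Cod C (Id C A) = A"
  using Id_in_hom[OF assms] by auto

lemma Comp_simps [simp]:
  assumes "f \<in> Ar C" "g \<in> Ar C" "Dom C g = Cod C f"
  shows "g \<cdot> f \<in> Ar C" "Dom C (g \<cdot> f) = Dom C f" "Cod C (g \<cdot> f) = Cod C g"
  using Comp_in_hom[of f "Dom C f" "Cod C f" g "Cod C g"] assms by auto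

lemma Comp_Id_simp [simp]: "f \<in> Ar C \<Longrightarrow> Dom C f = A \<Longrightarrow> f \<cdot> Id C A = f"
  using Comp_Id by auto

lemma Id_Comp_simp [simp]: "f \<in> Ar C \<Longrightarrow> Cod C f = A \<Longrightarrow> Id C A \<cdot> f = f"
  using Id_Comp by auto

lemma Comp_assoc_simp [simp]:
  "f \<in> Ar C \<Longrightarrow> g \<in> Ar C \<Longrightarrow> h \<in> Ar C \<Longrightarrow> Dom C g = Cod C f \<Longrightarrow> Dom C h = Cod C g
    \<Longrightarrow> (h \<cdot> g) \<cdot> f = h \<cdot> (g \<cdot> f)"
  using Comp_assoc[of f "Dom C f" "Cod C f" g "Cod C g" h "Cod C h"] by auto

text \<open>The simplifier nests composites to the right, after which an equation between composites
  no longer matches inside a longer chain. This lemma and \<open>Comp_eq\<close> extend an equation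
  by a further arrow directly in that normal form.\<close>

lemma Comp_eq_Comp:
  assumes "f \<cdot> e = g \<cdot> k" "f \<in> Ar C" "e \<in> Ar C" "g \<in> Ar C" "k \<in> Ar C" "Dom C f = Cod C e" "Dom C g = Cod C k"
    "t \<in> Ar C" "Cod C t = Dom C e" "Cod C t = Dom C k"
  shows "f \<cdot> e \<cdot> t = g \<cdot> k \<cdot> t"
  using assms Comp_assoc_simp[of t e f] Comp_assoc_simp[of t k g] by simp

lemma Comp_eq:
  assumes "f \<cdot> e = p" "f \<in> Ar C" "e \<in> Ar C" "Dom C f = Cod C e" "t \<in> Ar C" "Cod C t = Dom C e"
  shows "f \<cdot> e \<cdot> t = p \<cdot> t"
  using assms Comp_assoc_simp[of t e f] by simp

lemma is_coequaliser_D: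
  assumes "is_coequaliser C u v q"
  shows "u \<in> Ar C" "v \<in> Ar C" "Dom C v = Dom C u" "Cod C v = Cod C u" "q \<in> Ar C" "Dom C q = Cod C u"
    "q \<cdot> u = q \<cdot> v"
  using assms by (simp_all add: is_coequaliser_def)

lemma is_coequaliser_factor:
  assumes "is_coequaliser C u v q" "h \<in> hom C (Cod C u) W" "h \<cdot> u = h \<cdot> v"
  shows "\<exists>!k. k \<in> hom C (Cod C q) W \<and> k \<cdot> q = h"
proof -
  have "h \<in> Ar C" "Dom C h = Cod C u" "Cod C h = W" using assms(2) by simp_all
  then show ?thesis using assms(1,3) unfolding is_coequaliser_def by blast
qed

lemma terminal_exists:
  assumes "has_finite_limits C"
  shows "\<exists>T. is_terminal C T"
proof -
  let ?J = "\<lparr>Ob = {}, Ar = {}, Dom = id, Cod = id, Id = id, Comp = \<lambda>g f. f\<rparr> :: (nat, nat) cat"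
  \<comment> \<open>A cone over the empty diagram is merely an object, so the values of the diagram
    are never consulted.\<close>
  let ?D = "undefined :: (nat, nat, 'o, 'm) fctr"
  have "category ?J" by unfold_locales auto
  moreover have "is_functor ?J C ?D" by (simp add: is_functor_def)
  ultimately obtain L \<pi> where "is_limit ?J C ?D L \<pi>"
    using assms unfolding has_finite_limits_def by force
  then have "is_terminal C L"
    by (auto simp: is_limit_def is_cone_def is_terminal_def)
  then show ?thesis ..
qed

text \<open>The cospan: the arrows \<open>0, 1, 2\<close> are the identities, \<open>3\<close> goes from \<open>0\<close> to \<open>2\<close> and \<open>4\<close> from \<open>1\<close> to \<open>2\<close>.\<close>

definition (in -) cospan :: "(nat, nat) cat" where
  "cospan = \<lparr>Ob = {0, 1, 2}, Ar = {0, 1, 2, 3, 4},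
     Dom = (\<lambda>n. if n = 3 then 0 else if n = 4 then 1 else n),
     Cod = (\<lambda>n. if n \<ge> 3 then 2 else n), Id = id,
     Comp = (\<lambda>g f. if g \<ge> 3 then g else f)\<rparr>"

lemma (in -) category_cospan: "category cospan"
  by unfold_locales (auto simp: cospan_def split: if_splits)

lemma pullback_exists:
  assumes lim: "has_finite_limits C" and f: "f \<in> Ar C" and g: "g \<in> Ar C" and "Cod C f = Cod C g"
  shows "\<exists>P p q. is_pullback C f g P p q"
proof -
  let ?D = "\<lparr>FOb = (\<lambda>n. if n = 0 then Dom C f else if n = 1 then Dom C g else Cod C f),
     FAr = (\<lambda>n. if n = 0 then Id C (Dom C f) else if n = 1 then Id C (Dom C g)
       else if n = 2 then Id C (Cod C f) else if n = 3 then f else g)\<rparr> :: (nat, nat, 'o, 'm) fctr"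
  have "is_functor cospan C ?D"
    using assms by (auto simp: is_functor_def cospan_def)
  moreover have "finite (Ob cospan)" "finite (Ar cospan)" by (simp_all add: cospan_def)
  ultimately obtain L \<pi> where L: "is_limit cospan C ?D L \<pi>"
    using lim category_cospan unfolding has_finite_limits_def by blast
  then have c: "is_cone cospan C ?D L \<pi>" by (simp add: is_limit_def)
  then have \<pi>: "L \<in> Ob C" "\<pi> 0 \<in> hom C L (Dom C f)" "\<pi> 1 \<in> hom C L (Dom C g)"
    "f \<cdot> \<pi> 0 = \<pi> 2" "g \<cdot> \<pi> 1 = \<pi> 2"
    by (auto simp: is_cone_def cospan_def)
  have "\<exists>!u. u \<in> hom C T L \<and> \<pi> 0 \<cdot> u = s \<and> \<pi> 1 \<cdot> u = t"
    if T: "T \<in> Ob C" "s \<in> hom C T (Dom C f)" "t \<in> hom C T (Dom C g)" "f \<cdot> s = g \<cdot> t" for T s t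
  proof -
    let ?\<mu> = "\<lambda>n :: nat. if n = 0 then s else if n = 1 then t else f \<cdot> s"
    have "is_cone cospan C ?D T ?\<mu>"
      using that assms by (auto simp: is_cone_def cospan_def)
    then have ex: "\<exists>!u. u \<in> hom C T L \<and> (\<forall>j\<in>Ob cospan. \<pi> j \<cdot> u = ?\<mu> j)"
      using L unfolding is_limit_def by blast
    \<comment> \<open>The leg at the corner \<open>2\<close> is \<open>f \<cdot> \<pi> 0\<close>, so
      the condition there follows from the one at \<open>0\<close>.\<close>
    have "(\<forall>j\<in>Ob cospan. \<pi> j \<cdot> u = ?\<mu> j) \<longleftrightarrow> \<pi> 0 \<cdot> u = s \<and> \<pi> 1 \<cdot> u = t"
      if "u \<in> hom C T L" for u
    proof -
      have "\<pi> 2 \<cdot> u = f \<cdot> (\<pi> 0 \<cdot> u)"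
        using \<pi> that f by (simp flip: \<pi>(4))
      then show ?thesis by (auto simp: cospan_def)
    qed
    with ex show ?thesis by (metis (no_types, lifting))
  qed
  with \<pi>(1-3) have "is_pullback C f g L (\<pi> 0) (\<pi> 1)"
    unfolding is_pullback_def using assms \<pi>(4,5) by (intro conjI ballI impI) metis+
  then show ?thesis by blast
qed

end


locale finlim_category = category C for C :: "('o, 'm) cat" (structure) +
  assumes has_finite_limits: "has_finite_limits C"
begin

section \<open>Chosen terminal object, products and equalisers\<close>

lemma is_terminal_terminal_ob: "is_terminal C (terminal_ob C)"
  unfolding terminal_ob_def using terminal_exists[OF has_finite_limits] by (rule someI_ex)

lemma terminal_ob_in_Ob [simp]: "terminal_ob C \<in> Ob C"
  using is_terminal_terminal_ob by (simp add: is_terminal_def)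

lemma bang_in_hom: "A \<in> Ob C \<Longrightarrow> bang C A \<in> hom C A (terminal_ob C)"
  using is_terminal_terminal_ob unfolding is_terminal_def bang_def by (metis (mono_tags, lifting) theI')

lemma bang_simps [simp]:
  assumes "A \<in> Ob C"
  shows "bang C A \<in> Ar C" "Dom C (bang C A) = A" "Cod C (bang C A) = terminal_ob C"
  using bang_in_hom[OF assms] by auto

lemma terminal_unique:
  "f \<in> Ar C \<Longrightarrow> g \<in> Ar C \<Longrightarrow> Dom C f = Dom C g \<Longrightarrow> Cod C f = terminal_ob C \<Longrightarrow> Cod C g = terminal_ob C
    \<Longrightarrow> f = g"
  using is_terminal_terminal_ob unfolding is_terminal_def hom_def
  by (metis (mono_tags, lifting) Dom_in_Ob mem_Collect_eq)

lemma bang_Comp [simp]: "t \<in> Ar C \<Longrightarrow> Cod C t = A \<Longrightarrow> bang C A \<cdot> t = bang C (Dom C t)"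
  by (rule terminal_unique) auto

lemma is_pullback_D:
  assumes "is_pullback C f g P p q"
  shows "f \<in> Ar C" "g \<in> Ar C" "Cod C g = Cod C f" "P \<in> Ob C" "p \<in> Ar C" "Dom C p = P"
    "Cod C p = Dom C f" "q \<in> Ar C" "Dom C q = P" "Cod C q = Dom C g" "f \<cdot> p = g \<cdot> q"
  using assms by (auto simp: is_pullback_def)

lemma is_pullback_lift:
  assumes "is_pullback C f g P p q" "s \<in> hom C T (Dom C f)" "t \<in> hom C T (Dom C g)" "f \<cdot> s = g \<cdot> t"
  obtains u where "u \<in> hom C T P" "p \<cdot> u = s" "q \<cdot> u = t"
proof -
  have "T \<in> Ob C" using assms by auto
  then show thesis using assms that unfolding is_pullback_def by metis
qed

lemma is_pullback_unique:
  assumes P: "is_pullback C f g P p q" and u: "u \<in> hom C T P" "u' \<in> hom C T P"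
    and eq: "p \<cdot> u = p \<cdot> u'" "q \<cdot> u = q \<cdot> u'"
  shows "u = u'"
proof -
  have T: "T \<in> Ob C" using u by auto
  note D = is_pullback_D[OF P]
  have "f \<cdot> (p \<cdot> u) = g \<cdot> (q \<cdot> u)"
    using D u Comp_assoc_simp[of u p f] Comp_assoc_simp[of u q g] by simp
  moreover have "p \<cdot> u \<in> hom C T (Dom C f)" "q \<cdot> u \<in> hom C T (Dom C g)"
    using D u by auto
  ultimately have "\<exists>!v. v \<in> hom C T P \<and> p \<cdot> v = p \<cdot> u \<and> q \<cdot> v = q \<cdot> u"
    using P T unfolding is_pullback_def by blast
  then show ?thesis using u eq by metis
qed

lemma pullback_obtain:
  assumes "f \<in> Ar C" "g \<in> Ar C" "Cod C f = Cod C g"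
  obtains P p q where "is_pullback C f g P p q"
  using pullback_exists[OF has_finite_limits assms] by blast

lemma product_exists:
  assumes "A \<in> Ob C" "B \<in> Ob C"
  shows "\<exists>P p q. is_product C A B P p q"
proof -
  obtain P p q where P: "is_pullback C (bang C A) (bang C B) P p q"
    using pullback_obtain[of "bang C A" "bang C B"] assms by auto
  have "is_product C A B P p q"
    unfolding is_product_def
  proof (intro conjI ballI)
    fix T f g assume T: "T \<in> Ob C" "f \<in> hom C T A" "g \<in> hom C T B"
    moreover have "bang C A \<cdot> f = bang C B \<cdot> g" using T by simp
    ultimately show "\<exists>!u. u \<in> hom C T P \<and> p \<cdot> u = f \<and> q \<cdot> u = g"
      using P assms unfolding is_pullback_def by simp
  qed (use is_pullback_D[OF P] assms in auto)
  then show ?thesis by blast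
qed

lemma is_product_prod_ob:
  assumes "A \<in> Ob C" "B \<in> Ob C"
  shows "is_product C A B (prod_ob C A B) (proj1 C A B) (proj2 C A B)"
proof -
  have "case chosen_product C A B of (P, p, q) \<Rightarrow> is_product C A B P p q"
    unfolding chosen_product_def
    by (rule someI_ex) (use product_exists[OF assms] in auto)
  then show ?thesis by (simp add: prod_ob_def proj1_def proj2_def split: prod.splits)
qed

lemma prod_ob_in_Ob [simp]: "A \<in> Ob C \<Longrightarrow> B \<in> Ob C \<Longrightarrow> prod_ob C A B \<in> Ob C"
  using is_product_prod_ob by (simp add: is_product_def)

lemma proj_simps [simp]:
  assumes "A \<in> Ob C" "B \<in> Ob C"
  shows "proj1 C A B \<in> Ar C" "Dom C (proj1 C A B) = prod_ob C A B" "Cod C (proj1 C A B) = A"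
    "proj2 C A B \<in> Ar C" "Dom C (proj2 C A B) = prod_ob C A B" "Cod C (proj2 C A B) = B"
  using is_product_prod_ob[OF assms] by (auto simp: is_product_def)

lemma pairing_props:
  assumes "f \<in> Ar C" "g \<in> Ar C" "Dom C g = Dom C f"
  shows "pairing C f g \<in> hom C (Dom C f) (prod_ob C (Cod C f) (Cod C g)) \<and>
    proj1 C (Cod C f) (Cod C g) \<cdot> pairing C f g = f \<and> proj2 C (Cod C f) (Cod C g) \<cdot> pairing C f g = g"
  unfolding pairing_def
  by (rule theI') (use is_product_prod_ob[of "Cod C f" "Cod C g"] assms in \<open>simp add: is_product_def\<close>)

lemma pairing_simps [simp]:
  assumes "f \<in> Ar C" "g \<in> Ar C" "Dom C f = Dom C g"
  shows "pairing C f g \<in> Ar C" "Dom C (pairing C f g) = Dom C g"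
    "Cod C (pairing C f g) = prod_ob C (Cod C f) (Cod C g)"
  using pairing_props[of f g] assms by auto

lemma proj_pairing [simp]:
  assumes "f \<in> Ar C" "g \<in> Ar C" "Dom C f = Dom C g" "Cod C f = A" "Cod C g = B"
  shows "proj1 C A B \<cdot> pairing C f g = f" "proj2 C A B \<cdot> pairing C f g = g"
  using pairing_props[of f g] assms by auto

lemma product_eqI:
  assumes "u \<in> hom C T (prod_ob C A B)" "v \<in> hom C T (prod_ob C A B)" "A \<in> Ob C" "B \<in> Ob C"
    "proj1 C A B \<cdot> u = proj1 C A B \<cdot> v" "proj2 C A B \<cdot> u = proj2 C A B \<cdot> v"
  shows "u = v"
proof -
  have "\<exists>!w. w \<in> hom C T (prod_ob C A B) \<and> proj1 C A B \<cdot> w = proj1 C A B \<cdot> u \<and>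
      proj2 C A B \<cdot> w = proj2 C A B \<cdot> u"
  proof -
    have "T \<in> Ob C" "proj1 C A B \<cdot> u \<in> hom C T A" "proj2 C A B \<cdot> u \<in> hom C T B"
      using assms by auto
    then show ?thesis
      using is_product_prod_ob[of A B] assms unfolding is_product_def by blast
  qed
  then show ?thesis using assms by metis
qed

text \<open>Substitution into a tuple. This rule and its analogues for the list operations drive a
  change of stage inwards, so that terms in generalised elements have a normal form.\<close>

lemma pairing_Comp [simp]:
  assumes "f \<in> Ar C" "g \<in> Ar C" "Dom C f = Dom C g" "t \<in> Ar C" "Cod C t = Dom C g"
  shows "pairing C f g \<cdot> t = pairing C (f \<cdot> t) (g \<cdot> t)"
proof (rule product_eqI[of _ "Dom C t" "Cod C f" "Cod C g"])
  show "proj1 C (Cod C f) (Cod C g) \<cdot> (pairing C f g \<cdot> t) =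
    proj1 C (Cod C f) (Cod C g) \<cdot> pairing C (f \<cdot> t) (g \<cdot> t)"
    using assms Comp_assoc_simp[of t "pairing C f g" "proj1 C (Cod C f) (Cod C g)"] by simp
  show "proj2 C (Cod C f) (Cod C g) \<cdot> (pairing C f g \<cdot> t) =
    proj2 C (Cod C f) (Cod C g) \<cdot> pairing C (f \<cdot> t) (g \<cdot> t)"
    using assms Comp_assoc_simp[of t "pairing C f g" "proj2 C (Cod C f) (Cod C g)"] by simp
qed (use assms in auto)

lemma pairing_proj [simp]:
  assumes "u \<in> Ar C" "Cod C u = prod_ob C A B" "A \<in> Ob C" "B \<in> Ob C"
  shows "pairing C (proj1 C A B \<cdot> u) (proj2 C A B \<cdot> u) = u"
  by (rule product_eqI[of _ "Dom C u" A B]) (use assms in auto)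

lemma pairing_eq_iff:
  assumes "f \<in> hom C T A" "g \<in> hom C T B" "f' \<in> hom C T A" "g' \<in> hom C T B"
  shows "pairing C f g = pairing C f' g' \<longleftrightarrow> f = f' \<and> g = g'"
proof
  assume "pairing C f g = pairing C f' g'"
  then have "proj1 C A B \<cdot> pairing C f g = proj1 C A B \<cdot> pairing C f' g'"
    "proj2 C A B \<cdot> pairing C f g = proj2 C A B \<cdot> pairing C f' g'" by simp_all
  then show "f = f' \<and> g = g'" using assms by auto
qed simp

lemma prod_ar_pairing [simp]:
  assumes "f \<in> Ar C" "g \<in> Ar C" "a \<in> Ar C" "b \<in> Ar C" "Dom C a = Dom C b" "Cod C a = Dom C f" "Cod C b = Dom C g"
  shows "prod_ar C f g \<cdot> pairing C a b = pairing C (f \<cdot> a) (g \<cdot> b)"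
  using assms by (simp add: prod_ar_def)

lemma prod_ar_simps [simp]:
  assumes "f \<in> Ar C" "g \<in> Ar C"
  shows "prod_ar C f g \<in> Ar C" "Dom C (prod_ar C f g) = prod_ob C (Dom C f) (Dom C g)"
    "Cod C (prod_ar C f g) = prod_ob C (Cod C f) (Cod C g)"
  using assms by (simp_all add: prod_ar_def)

lemma assoc_simps [simp]:
  assumes "A \<in> Ob C" "B \<in> Ob C" "D \<in> Ob C"
  shows "assoc C A B D \<in> Ar C" "Dom C (assoc C A B D) = prod_ob C A (prod_ob C B D)"
    "Cod C (assoc C A B D) = prod_ob C (prod_ob C A B) D"
  using assms by (simp_all add: assoc_def)

lemma assoc_pairing [simp]:
  assumes "a \<in> Ar C" "b \<in> Ar C" "d \<in> Ar C" "Dom C a = Dom C d" "Dom C b = Dom C d"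
    "Cod C a = A" "Cod C b = B" "Cod C d = D"
  shows "assoc C A B D \<cdot> pairing C a (pairing C b d) = pairing C (pairing C a b) d"
proof -
  have "A \<in> Ob C" "B \<in> Ob C" "D \<in> Ob C" using assms by auto
  then show ?thesis using assms by (simp add: assoc_def)
qed

text \<open>The equaliser is the pullback of \<open>pairing C f g\<close> along the diagonal of
  \<open>B\<close>.\<close>

lemma equaliser_obtain:
  assumes "f \<in> hom C A B" "g \<in> hom C A B"
  obtains E e where "E \<in> Ob C" "e \<in> hom C E A" "f \<cdot> e = g \<cdot> e"
    "\<And>T t. t \<in> hom C T A \<Longrightarrow> f \<cdot> t = g \<cdot> t \<Longrightarrow> \<exists>u. u \<in> hom C T E \<and> e \<cdot> u = t"
    "\<And>T u v. u \<in> hom C T E \<Longrightarrow> v \<in> hom C T E \<Longrightarrow> e \<cdot> u = e \<cdot> v \<Longrightarrow> u = v"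
proof -
  have AB: "A \<in> Ob C" "B \<in> Ob C" using assms by auto
  define d where "d = pairing C (Id C B) (Id C B)"
  obtain E e k where E: "is_pullback C (pairing C f g) d E e k"
    using pullback_obtain[of "pairing C f g" d] assms AB by (auto simp: d_def)
  note D = is_pullback_D[OF E]
  have De: "e \<in> Ar C" "Dom C e = E" "Cod C e = A" "k \<in> Ar C" "Dom C k = E" "Cod C k = B"
    using D assms AB by (auto simp: d_def)
  have fe: "f \<cdot> e = k" "g \<cdot> e = k"
    using D(11) De assms AB by (auto simp: d_def pairing_eq_iff[of _ E B _ B])
  show thesis
  proof
    show "E \<in> Ob C" "e \<in> hom C E A" "f \<cdot> e = g \<cdot> e" using D De fe by auto
    fix T t assume t: "t \<in> hom C T A" "f \<cdot> t = g \<cdot> t"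
    show "\<exists>u. u \<in> hom C T E \<and> e \<cdot> u = t"
      using is_pullback_lift[OF E, of t T "f \<cdot> t"] t assms AB
      by (auto simp: d_def)
  next
    fix T u v assume u: "u \<in> hom C T E" "v \<in> hom C T E" and eq: "e \<cdot> u = e \<cdot> v"
    have "k \<cdot> u = k \<cdot> v"
      using arg_cong[OF eq, of "\<lambda>x. f \<cdot> x"] u De assms by (simp flip: fe)
    then show "u = v" using is_pullback_unique[OF E u] eq by blast
  qed
qed

end


section \<open>Lists\<close>

locale list_category = finlim_category C for C :: "('o, 'm) cat" (structure) +
  assumes has_lists: "has_parametrised_list_objects C"
begin

section \<open>Recursion and induction on generalised elements of list objects\<close>

definition chosen_list :: "'o \<Rightarrow> 'o \<times> 'm \<times> 'm" where
  "chosen_list X = (SOME (L, r0, r1). is_list_object C X L r0 r1)"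

definition lists :: "'o \<Rightarrow> 'o" where
  "lists X = fst (chosen_list X)"

text \<open>The empty list is a constant and so needs its stage \<open>T\<close> as an argument; the
  other operations read the stage off their arguments.\<close>

definition nil :: "'o \<Rightarrow> 'o \<Rightarrow> 'm" where
  "nil X T = fst (snd (chosen_list X)) \<cdot> bang C T"

definition snoc :: "'o \<Rightarrow> 'm \<Rightarrow> 'm \<Rightarrow> 'm" where
  "snoc X l s = snd (snd (chosen_list X)) \<cdot> pairing C l s"

lemma is_list_object_lists:
  assumes "X \<in> Ob C"
  shows "is_list_object C X (lists X) (fst (snd (chosen_list X))) (snd (snd (chosen_list X)))"
proof -
  have "case chosen_list X of (L, r0, r1) \<Rightarrow> is_list_object C X L r0 r1"
    unfolding chosen_list_def
    by (rule someI_ex) (use has_lists assms in \<open>auto simp: has_parametrised_list_objects_def\<close>)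
  then show ?thesis by (simp add: lists_def split: prod.splits)
qed

lemma lists_in_Ob [simp]: "X \<in> Ob C \<Longrightarrow> lists X \<in> Ob C"
  using is_list_object_lists by (simp add: is_list_object_def)

lemma chosen_list_simps:
  assumes "X \<in> Ob C"
  shows "fst (snd (chosen_list X)) \<in> hom C (terminal_ob C) (lists X)"
    "snd (snd (chosen_list X)) \<in> hom C (prod_ob C (lists X) X) (lists X)"
  using is_list_object_lists[OF assms] unfolding is_list_object_def by blast+

lemma nil_simps [simp]:
  assumes "X \<in> Ob C" "T \<in> Ob C"
  shows "nil X T \<in> Ar C" "Dom C (nil X T) = T" "Cod C (nil X T) = lists X"
    "\<And>t. t \<in> Ar C \<Longrightarrow> Cod C t = T \<Longrightarrow> nil X T \<cdot> t = nil X (Dom C t)"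
  using chosen_list_simps[OF assms(1)] assms(2) by (simp_all add: nil_def)

lemma snoc_simps [simp]:
  assumes "l \<in> Ar C" "s \<in> Ar C" "Dom C l = Dom C s" "Cod C l = lists X" "Cod C s = X"
  shows "snoc X l s \<in> Ar C" "Dom C (snoc X l s) = Dom C s" "Cod C (snoc X l s) = lists X"
    "\<And>t. t \<in> Ar C \<Longrightarrow> Cod C t = Dom C s \<Longrightarrow> snoc X l s \<cdot> t = snoc X (l \<cdot> t) (s \<cdot> t)"
proof -
  have "X \<in> Ob C" using assms by auto
  from chosen_list_simps[OF this] assms show "snoc X l s \<in> Ar C" "Dom C (snoc X l s) = Dom C s"
    "Cod C (snoc X l s) = lists X"
    "\<And>t. t \<in> Ar C \<Longrightarrow> Cod C t = Dom C s \<Longrightarrow> snoc X l s \<cdot> t = snoc X (l \<cdot> t) (s \<cdot> t)"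
    by (simp_all add: snoc_def)
qed

text \<open>The recursion equations of \<open>is_list_object\<close> for generalised elements, free
  of \<open>prod_ar\<close> and \<open>assoc\<close>.\<close>

definition is_lfold :: "'o \<Rightarrow> 'm \<Rightarrow> 'm \<Rightarrow> 'm \<Rightarrow> bool" where
  "is_lfold X b g u \<longleftrightarrow> u \<in> hom C (prod_ob C (Dom C b) (lists X)) (Cod C b) \<and>
     (\<forall>T x. T \<in> Ob C \<longrightarrow> x \<in> hom C T (Dom C b) \<longrightarrow> u \<cdot> pairing C x (nil X T) = b \<cdot> x) \<and>
     (\<forall>T x l s. T \<in> Ob C \<longrightarrow> x \<in> hom C T (Dom C b) \<longrightarrow> l \<in> hom C T (lists X) \<longrightarrow> s \<in> hom C T X \<longrightarrow>
        u \<cdot> pairing C x (snoc X l s) = g \<cdot> pairing C (u \<cdot> pairing C x l) s)"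

text \<open>A Yoneda argument: the equations between arrows are precomposed with elements in one
  direction, and the equations for elements are evaluated at generic elements in the other.\<close>

lemma ex1_lfold:
  assumes X: "X \<in> Ob C" and b: "b \<in> hom C B Y" and g: "g \<in> hom C (prod_ob C Y X) Y"
  shows "\<exists>!u. is_lfold X b g u"
proof -
  let ?L = "lists X" and ?r0 = "fst (snd (chosen_list X))" and ?r1 = "snd (snd (chosen_list X))"
  have Ob: "B \<in> Ob C" "Y \<in> Ob C" using b by auto
  note r = chosen_list_simps[OF X]
  have "u \<cdot> pairing C (Id C B) (?r0 \<cdot> bang C B) = b \<and>
      u \<cdot> prod_ar C (Id C B) ?r1 = g \<cdot> prod_ar C u (Id C X) \<cdot> assoc C B ?L X \<longleftrightarrow> is_lfold X b g u"
    if u: "u \<in> hom C (prod_ob C B ?L) Y" for u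
  proof (intro iffI conjI)
    assume eq: "u \<cdot> pairing C (Id C B) (?r0 \<cdot> bang C B) = b \<and>
      u \<cdot> prod_ar C (Id C B) ?r1 = g \<cdot> prod_ar C u (Id C X) \<cdot> assoc C B ?L X"
    show "is_lfold X b g u"
      unfolding is_lfold_def
    proof (intro conjI allI impI)
      show "u \<in> hom C (prod_ob C (Dom C b) (lists X)) (Cod C b)" using u b by simp
      fix T x assume T: "T \<in> Ob C" "x \<in> hom C T (Dom C b)"
      show "u \<cdot> pairing C x (nil X T) = b \<cdot> x"
        using arg_cong[OF conjunct1[OF eq], of "\<lambda>a. a \<cdot> x"] T r X Ob u b by (simp add: nil_def)
    next
      fix T x l s assume T: "T \<in> Ob C" "x \<in> hom C T (Dom C b)" "l \<in> hom C T ?L" "s \<in> hom C T X"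
      show "u \<cdot> pairing C x (snoc X l s) = g \<cdot> pairing C (u \<cdot> pairing C x l) s"
        using arg_cong[OF conjunct2[OF eq], of "\<lambda>a. a \<cdot> pairing C x (pairing C l s)"] T r X Ob u b g
        by (simp add: snoc_def)
    qed
  next
    assume f: "is_lfold X b g u"
    then show "u \<cdot> pairing C (Id C B) (?r0 \<cdot> bang C B) = b"
      using f[unfolded is_lfold_def, THEN conjunct2, THEN conjunct1, rule_format, of B "Id C B"] b X Ob r
      by (simp add: nil_def)
    \<comment> \<open>The generic parameter, list and letter are the projections of
      \<open>?T\<close>, as that of the base case was the identity of \<open>B\<close>.\<close>
    let ?T = "prod_ob C B (prod_ob C ?L X)"
    let ?x = "proj1 C B (prod_ob C ?L X)" and ?y = "proj2 C B (prod_ob C ?L X)"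
    have p: "?x \<in> hom C ?T B" "?y \<in> hom C ?T (prod_ob C ?L X)" using X Ob by auto
    have a: "proj1 C ?L X \<cdot> ?y \<in> hom C ?T ?L" "proj2 C ?L X \<cdot> ?y \<in> hom C ?T X" using X Ob by auto
    have eq: "u \<cdot> pairing C ?x (?r1 \<cdot> ?y) =
        g \<cdot> pairing C (u \<cdot> pairing C ?x (proj1 C ?L X \<cdot> ?y)) (proj2 C ?L X \<cdot> ?y)"
      using f[unfolded is_lfold_def, THEN conjunct2, THEN conjunct2, rule_format, of ?T ?x
          "proj1 C ?L X \<cdot> ?y" "proj2 C ?L X \<cdot> ?y"] p a b X Ob
      by (simp add: snoc_def)
    show "u \<cdot> prod_ar C (Id C B) ?r1 = g \<cdot> prod_ar C u (Id C X) \<cdot> assoc C B ?L X"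
      using eq X Ob r u by (simp add: prod_ar_def assoc_def)
  qed
  moreover have "is_lfold X b g u \<Longrightarrow> u \<in> hom C (prod_ob C B ?L) Y" for u
    using b unfolding is_lfold_def by simp
  moreover have "\<exists>!u. u \<in> hom C (prod_ob C B ?L) Y \<and>
      u \<cdot> pairing C (Id C B) (?r0 \<cdot> bang C B) = b \<and>
      u \<cdot> prod_ar C (Id C B) ?r1 = g \<cdot> prod_ar C u (Id C X) \<cdot> assoc C B ?L X"
    using is_list_object_lists[OF X] Ob b g unfolding is_list_object_def by blast
  ultimately show ?thesis by (smt (verit))
qed

definition lrec :: "'o \<Rightarrow> 'm \<Rightarrow> 'm \<Rightarrow> 'm \<Rightarrow> 'm \<Rightarrow> 'm" where
  "lrec X b g x l = (THE u. is_lfold X b g u) \<cdot> pairing C x l"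

lemma lrec_simps:
  assumes X: "X \<in> Ob C" and b: "b \<in> hom C B Y" and g: "g \<in> hom C (prod_ob C Y X) Y"
    and x: "x \<in> hom C T B"
  shows "l \<in> hom C T (lists X) \<Longrightarrow> lrec X b g x l \<in> hom C T Y"
    "l \<in> hom C T (lists X) \<Longrightarrow> t \<in> Ar C \<Longrightarrow> Cod C t = T \<Longrightarrow>
      lrec X b g x l \<cdot> t = lrec X b g (x \<cdot> t) (l \<cdot> t)"
    "lrec X b g x (nil X T) = b \<cdot> x"
    "l \<in> hom C T (lists X) \<Longrightarrow> s \<in> hom C T X \<Longrightarrow>
      lrec X b g x (snoc X l s) = g \<cdot> pairing C (lrec X b g x l) s"
proof -
  let ?u = "THE u. is_lfold X b g u"
  have u: "is_lfold X b g ?u" by (rule theI'[OF ex1_lfold[OF X b g]])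
  then have h: "?u \<in> hom C (prod_ob C B (lists X)) Y" using b by (simp add: is_lfold_def)
  have T: "T \<in> Ob C" using x by auto
  show "l \<in> hom C T (lists X) \<Longrightarrow> lrec X b g x l \<in> hom C T Y"
    using h x by (simp add: lrec_def)
  show "l \<in> hom C T (lists X) \<Longrightarrow> t \<in> Ar C \<Longrightarrow> Cod C t = T \<Longrightarrow>
      lrec X b g x l \<cdot> t = lrec X b g (x \<cdot> t) (l \<cdot> t)"
    using h x by (simp add: lrec_def)
  show "l \<in> hom C T (lists X) \<Longrightarrow> s \<in> hom C T X \<Longrightarrow>
      lrec X b g x (snoc X l s) = g \<cdot> pairing C (lrec X b g x l) s"
    using u x b T unfolding is_lfold_def lrec_def by simp
  show "lrec X b g x (nil X T) = b \<cdot> x"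
    using u x b T unfolding is_lfold_def lrec_def by simp
qed

text \<open>By Yoneda these are the arrows from the product of \<open>A\<close> and \<open>B\<close>
  to \<open>Y\<close>. Keeping them as functions on elements allows an induction to be stated with
  terms.\<close>

definition natural_op :: "'o \<Rightarrow> 'o \<Rightarrow> 'o \<Rightarrow> ('m \<Rightarrow> 'm \<Rightarrow> 'm) \<Rightarrow> bool" where
  "natural_op A B Y F \<longleftrightarrow> (\<forall>T a b. a \<in> hom C T A \<longrightarrow> b \<in> hom C T B \<longrightarrow>
     F a b \<in> hom C T Y \<and> (\<forall>t. t \<in> Ar C \<longrightarrow> Cod C t = T \<longrightarrow> F a b \<cdot> t = F (a \<cdot> t) (b \<cdot> t)))"

text \<open>Induction for equations between generalised elements: the equaliser of both sides contains the
  empty list and is closed under \<open>snoc\<close>, so folding into it splits its inclusion.\<close>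

lemma list_induct:
  assumes X: "X \<in> Ob C" and B: "B \<in> Ob C"
    and F: "natural_op B (lists X) Y F" and G: "natural_op B (lists X) Y G"
    and base: "\<And>T x. T \<in> Ob C \<Longrightarrow> x \<in> hom C T B \<Longrightarrow> F x (nil X T) = G x (nil X T)"
    and step: "\<And>T x l s. T \<in> Ob C \<Longrightarrow> x \<in> hom C T B \<Longrightarrow> l \<in> hom C T (lists X) \<Longrightarrow> s \<in> hom C T X \<Longrightarrow>
      F x l = G x l \<Longrightarrow> F x (snoc X l s) = G x (snoc X l s)"
    and x: "x \<in> hom C T B" and l: "l \<in> hom C T (lists X)"
  shows "F x l = G x l"
proof -
  let ?L = "lists X"
  let ?P = "prod_ob C B ?L"
  let ?p = "proj1 C B ?L" and ?q = "proj2 C B ?L"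
  have pq: "?p \<in> hom C ?P B" "?q \<in> hom C ?P ?L" "?P \<in> Ob C" using X B by simp_all
  \<comment> \<open>The arrows represented by \<open>F\<close> and \<open>G\<close>: their values at
    the generic pair.\<close>
  define f where "f = F ?p ?q"
  define g where "g = G ?p ?q"
  have fg: "f \<in> hom C ?P Y" "g \<in> hom C ?P Y"
    unfolding f_def g_def using F[unfolded natural_op_def] G[unfolded natural_op_def] pq by blast+
  have nat: "f \<cdot> t = F (?p \<cdot> t) (?q \<cdot> t)" "g \<cdot> t = G (?p \<cdot> t) (?q \<cdot> t)"
    if "t \<in> Ar C" "Cod C t = ?P" for t
    unfolding f_def g_def using F[unfolded natural_op_def] G[unfolded natural_op_def] pq that by blast+
  from fg obtain E e where E: "E \<in> Ob C" "e \<in> hom C E ?P" "f \<cdot> e = g \<cdot> e"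
    and lift: "\<And>T t. t \<in> hom C T ?P \<Longrightarrow> f \<cdot> t = g \<cdot> t \<Longrightarrow> \<exists>u. u \<in> hom C T E \<and> e \<cdot> u = t"
    by (rule equaliser_obtain) blast
  have lift': "\<exists>u. u \<in> hom C T E \<and> e \<cdot> u = pairing C a b"
    if "a \<in> hom C T B" "b \<in> hom C T ?L" "F a b = G a b" for T a b
  proof -
    have "f \<cdot> pairing C a b = g \<cdot> pairing C a b" using that nat[of "pairing C a b"] X B by simp
    then show ?thesis using lift[of "pairing C a b" T] that by simp
  qed
  obtain b0 where b0: "b0 \<in> hom C B E" "e \<cdot> b0 = pairing C (Id C B) (nil X B)"
    using lift'[of "Id C B" B "nil X B"] base[of B "Id C B"] X B by auto
  let ?Q = "prod_ob C E X"
  let ?a = "?p \<cdot> e \<cdot> proj1 C E X" and ?c = "?q \<cdot> e \<cdot> proj1 C E X"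
  have ac: "?a \<in> hom C ?Q B" "?c \<in> hom C ?Q ?L" using E X B by auto
  have "F ?a ?c = G ?a ?c"
    using Comp_eq_Comp[OF E(3), of "proj1 C E X"] nat[of "e \<cdot> proj1 C E X"] fg E X B by simp
  then have "F ?a (snoc X ?c (proj2 C E X)) = G ?a (snoc X ?c (proj2 C E X))"
    using step[of ?Q ?a ?c "proj2 C E X"] ac X E by simp
  then obtain g0 where g0: "g0 \<in> hom C ?Q E" "e \<cdot> g0 = pairing C ?a (snoc X ?c (proj2 C E X))"
    using lift'[of ?a ?Q "snoc X ?c (proj2 C E X)"] ac X E by auto
  define u where "u = lrec X b0 g0 ?p ?q"
  note rec = lrec_simps[OF X b0(1) g0(1)]
  have u: "u \<in> hom C ?P E" using rec(1) pq unfolding u_def by blast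
  have ut: "u \<cdot> pairing C y m = lrec X b0 g0 y m" if "y \<in> hom C T' B" "m \<in> hom C T' ?L" for y m T'
    unfolding u_def using rec(2)[OF pq(1,2), of "pairing C y m"] that X B by simp
  let ?b = "pairing C (Id C B) (nil X B)"
  let ?g = "pairing C (?p \<cdot> proj1 C ?P X) (snoc X (?q \<cdot> proj1 C ?P X) (proj2 C ?P X))"
  have eb0: "e \<cdot> (b0 \<cdot> t) = pairing C t (nil X (Dom C t))" if "t \<in> Ar C" "Cod C t = B" for t
    using arg_cong[OF b0(2), of "\<lambda>h. h \<cdot> t"] b0(1) E that X B by simp
  have eg0: "e \<cdot> (g0 \<cdot> t) = pairing C (?a \<cdot> t) (snoc X (?c \<cdot> t) (proj2 C E X \<cdot> t))"
    if "t \<in> Ar C" "Cod C t = ?Q" for t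
    using arg_cong[OF g0(2), of "\<lambda>h. h \<cdot> t"] g0(1) E that X B by simp
  \<comment> \<open>Both \<open>e \<cdot> u\<close> and the identity solve the recursion that copies
    the parameter and rebuilds the list letter by letter. By uniqueness they agree, so
    \<open>u\<close> is a section of the equaliser \<open>e\<close> and
    \<open>f = g\<close>.\<close>
  have "is_lfold X ?b ?g (e \<cdot> u)"
    unfolding is_lfold_def
  proof (intro conjI allI impI)
    show "e \<cdot> u \<in> hom C (prod_ob C (Dom C ?b) ?L) (Cod C ?b)" using E u X B by simp
    fix T x assume T: "T \<in> Ob C" "x \<in> hom C T (Dom C ?b)"
    then have x: "x \<in> hom C T B" using X B by simp
    show "(e \<cdot> u) \<cdot> pairing C x (nil X T) = ?b \<cdot> x"
      using ut[OF x, of "nil X T"] rec(3)[OF x] eb0[of x] x T X B E u b0 by simp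
  next
    fix T x l s assume T: "T \<in> Ob C" "x \<in> hom C T (Dom C ?b)" "l \<in> hom C T ?L" "s \<in> hom C T X"
    then have x: "x \<in> hom C T B" using X B by simp
    have r: "lrec X b0 g0 x l \<in> hom C T E" using rec(1)[OF x] T by blast
    show "(e \<cdot> u) \<cdot> pairing C x (snoc X l s) = ?g \<cdot> pairing C ((e \<cdot> u) \<cdot> pairing C x l) s"
      using ut[OF x, of "snoc X l s"] ut[OF x T(3)] rec(4)[OF x T(3,4)] r
        eg0[of "pairing C (lrec X b0 g0 x l) s"] x T X B E u g0(1) by simp
  qed
  moreover have "is_lfold X ?b ?g (Id C ?P)"
    unfolding is_lfold_def using X B by simp
  moreover have "\<exists>!v. is_lfold X ?b ?g v" by (rule ex1_lfold[of X _ B ?P]) (use X B in auto)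
  ultimately have eu: "e \<cdot> u = Id C ?P" by blast
  have "f = f \<cdot> (e \<cdot> u)" using eu fg by simp
  also have "\<dots> = g \<cdot> (e \<cdot> u)" using Comp_eq_Comp[OF E(3), of u] E u fg by simp
  also have "\<dots> = g" using eu fg by simp
  finally have "f \<cdot> pairing C x l = g \<cdot> pairing C x l" by simp
  then show ?thesis using nat[of "pairing C x l"] x l by simp
qed

text \<open>The trick that yields the predecessor function: a recursion step sees only the previous
  value, so the list read so far is carried along as second component. Starting from two empty lists
  makes \<open>butlast\<close> total, with the empty list sent to itself.\<close>

definition butlast_pair :: "'o \<Rightarrow> 'm \<Rightarrow> 'm" where
  "butlast_pair X l = (let L = lists X; Y = prod_ob C L L; v = proj2 C L L \<cdot> proj1 C Y X in
     lrec X (pairing C (nil X (terminal_ob C)) (nil X (terminal_ob C)))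
       (pairing C v (snoc X v (proj2 C Y X))) (bang C (Dom C l)) l)"

definition butlast :: "'o \<Rightarrow> 'm \<Rightarrow> 'm" where
  "butlast X l = proj1 C (lists X) (lists X) \<cdot> butlast_pair X l"

lemma butlast_pair_simps:
  assumes "X \<in> Ob C"
  shows "l \<in> hom C T (lists X) \<Longrightarrow> butlast_pair X l \<in> hom C T (prod_ob C (lists X) (lists X))"
    "l \<in> hom C T (lists X) \<Longrightarrow> t \<in> Ar C \<Longrightarrow> Cod C t = T \<Longrightarrow> butlast_pair X l \<cdot> t = butlast_pair X (l \<cdot> t)"
    "T \<in> Ob C \<Longrightarrow> butlast_pair X (nil X T) = pairing C (nil X T) (nil X T)"
    "l \<in> hom C T (lists X) \<Longrightarrow> s \<in> hom C T X \<Longrightarrow> butlast_pair X (snoc X l s) =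
      pairing C (proj2 C (lists X) (lists X) \<cdot> butlast_pair X l)
        (snoc X (proj2 C (lists X) (lists X) \<cdot> butlast_pair X l) s)"
proof -
  let ?L = "lists X"
  let ?Y = "prod_ob C ?L ?L"
  let ?b = "pairing C (nil X (terminal_ob C)) (nil X (terminal_ob C))"
  let ?v = "proj2 C ?L ?L \<cdot> proj1 C ?Y X"
  let ?g = "pairing C ?v (snoc X ?v (proj2 C ?Y X))"
  have b: "?b \<in> hom C (terminal_ob C) ?Y" and g: "?g \<in> hom C (prod_ob C ?Y X) ?Y" using assms by simp_all
  note rec = lrec_simps[OF assms b g bang_in_hom]
  show *: "l \<in> hom C T ?L \<Longrightarrow> butlast_pair X l \<in> hom C T ?Y" for l T
    using rec(1)[of T l] unfolding butlast_pair_def Let_def by auto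
  show "l \<in> hom C T ?L \<Longrightarrow> t \<in> Ar C \<Longrightarrow> Cod C t = T \<Longrightarrow> butlast_pair X l \<cdot> t = butlast_pair X (l \<cdot> t)"
    using rec(2)[of T l t] unfolding butlast_pair_def Let_def by auto
  show "T \<in> Ob C \<Longrightarrow> butlast_pair X (nil X T) = pairing C (nil X T) (nil X T)"
    using rec(3)[of T] assms unfolding butlast_pair_def Let_def by auto
  show "l \<in> hom C T ?L \<Longrightarrow> s \<in> hom C T X \<Longrightarrow> butlast_pair X (snoc X l s) =
      pairing C (proj2 C ?L ?L \<cdot> butlast_pair X l) (snoc X (proj2 C ?L ?L \<cdot> butlast_pair X l) s)"
    using rec(4)[of T l s] *[of l T] assms unfolding butlast_pair_def Let_def by auto
qed

lemma butlast_simps [simp]: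
  assumes "l \<in> Ar C" "Cod C l = lists X" "X \<in> Ob C"
  shows "butlast X l \<in> Ar C" "Dom C (butlast X l) = Dom C l" "Cod C (butlast X l) = lists X"
    "\<And>t. t \<in> Ar C \<Longrightarrow> Cod C t = Dom C l \<Longrightarrow> butlast X l \<cdot> t = butlast X (l \<cdot> t)"
  using butlast_pair_simps(1,2)[OF assms(3), of l "Dom C l"] assms by (simp_all add: butlast_def)

lemma butlast_nil [simp]:
  assumes "X \<in> Ob C" "T \<in> Ob C"
  shows "butlast X (nil X T) = nil X T"
  using butlast_pair_simps(3)[OF assms(1), of T] assms by (simp add: butlast_def)

lemma butlast_snoc [simp]:
  assumes "l \<in> Ar C" "s \<in> Ar C" "Dom C l = Dom C s" "Cod C l = lists X" "Cod C s = X"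
  shows "butlast X (snoc X l s) = l"
proof -
  have X: "X \<in> Ob C" using assms by auto
  note b = butlast_pair_simps[OF X]
  \<comment> \<open>The second component reproduces the list. There is no parameter, so the
    induction takes the terminal object in its place.\<close>
  have "proj2 C (lists X) (lists X) \<cdot> butlast_pair X l = l"
    by (rule list_induct[where F = "\<lambda>x l. proj2 C (lists X) (lists X) \<cdot> butlast_pair X l"
          and G = "\<lambda>x l. l" and x = "bang C (Dom C l)" and B = "terminal_ob C" and Y = "lists X"])
      (use b assms X in \<open>simp_all add: natural_op_def\<close>)
  then show ?thesis using b(1)[of l "Dom C l"] b(4)[of l "Dom C l" s] X assms by (simp add: butlast_def)
qed

definition last_or :: "'o \<Rightarrow> 'm \<Rightarrow> 'm \<Rightarrow> 'm" where
  "last_or X x l = lrec X (Id C X) (proj2 C X X) x l"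

lemma last_or_simps [simp]:
  assumes "x \<in> Ar C" "l \<in> Ar C" "Dom C x = Dom C l" "Cod C x = X" "Cod C l = lists X"
  shows "last_or X x l \<in> Ar C" "Dom C (last_or X x l) = Dom C l" "Cod C (last_or X x l) = X"
    "\<And>t. t \<in> Ar C \<Longrightarrow> Cod C t = Dom C l \<Longrightarrow> last_or X x l \<cdot> t = last_or X (x \<cdot> t) (l \<cdot> t)"
proof -
  have X: "X \<in> Ob C" using assms by auto
  note rec = lrec_simps[OF X, of "Id C X" X X "proj2 C X X" x "Dom C l"]
  show "last_or X x l \<in> Ar C" "Dom C (last_or X x l) = Dom C l" "Cod C (last_or X x l) = X"
    "\<And>t. t \<in> Ar C \<Longrightarrow> Cod C t = Dom C l \<Longrightarrow> last_or X x l \<cdot> t = last_or X (x \<cdot> t) (l \<cdot> t)"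
    using rec(1,2)[of l] X assms by (simp_all add: last_or_def)
qed

lemma last_or_nil [simp]:
  assumes "x \<in> Ar C" "Cod C x = X" "Dom C x = T"
  shows "last_or X x (nil X T) = x"
  using lrec_simps(3)[of X "Id C X" X X "proj2 C X X" x T] assms by (auto simp: last_or_def)

lemma last_or_snoc [simp]:
  assumes "x \<in> Ar C" "l \<in> Ar C" "s \<in> Ar C" "Dom C x = Dom C s" "Dom C l = Dom C s"
    "Cod C x = X" "Cod C l = lists X" "Cod C s = X"
  shows "last_or X x (snoc X l s) = s"
proof -
  have X: "X \<in> Ob C" using assms by auto
  show ?thesis
    using lrec_simps(1,4)[OF X, of "Id C X" X X "proj2 C X X" x "Dom C s" l] X assms
    by (simp add: last_or_def)
qed

definition append :: "'o \<Rightarrow> 'm \<Rightarrow> 'm \<Rightarrow> 'm" where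
  "append X k l = lrec X (Id C (lists X)) (snoc X (proj1 C (lists X) X) (proj2 C (lists X) X)) k l"

lemma append_simps [simp]:
  assumes "k \<in> Ar C" "l \<in> Ar C" "Dom C k = Dom C l" "Cod C k = lists X" "Cod C l = lists X" "X \<in> Ob C"
  shows "append X k l \<in> Ar C" "Dom C (append X k l) = Dom C l" "Cod C (append X k l) = lists X"
    "\<And>t. t \<in> Ar C \<Longrightarrow> Cod C t = Dom C l \<Longrightarrow> append X k l \<cdot> t = append X (k \<cdot> t) (l \<cdot> t)"
  using lrec_simps(1,2)[of X "Id C (lists X)" "lists X" "lists X"
      "snoc X (proj1 C (lists X) X) (proj2 C (lists X) X)" k "Dom C l" l] assms
  by (simp_all add: append_def)

lemma append_nil [simp]:
  assumes "k \<in> Ar C" "Cod C k = lists X" "Dom C k = T" "X \<in> Ob C"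
  shows "append X k (nil X T) = k"
  using lrec_simps(3)[of X "Id C (lists X)" "lists X" "lists X"
      "snoc X (proj1 C (lists X) X) (proj2 C (lists X) X)" k T] assms
  by (simp add: append_def)

lemma append_snoc [simp]:
  assumes "k \<in> Ar C" "l \<in> Ar C" "s \<in> Ar C" "Dom C k = Dom C s" "Dom C l = Dom C s"
    "Cod C k = lists X" "Cod C l = lists X" "Cod C s = X"
  shows "append X k (snoc X l s) = snoc X (append X k l) s"
proof -
  have X: "X \<in> Ob C" using assms by auto
  show ?thesis
    using lrec_simps(1,4)[OF X, of "Id C (lists X)" "lists X" "lists X"
        "snoc X (proj1 C (lists X) X) (proj2 C (lists X) X)" k "Dom C s" l] X assms
    by (simp add: append_def)
qed

text \<open>Drops as many letters from the end of \<open>k\<close> as \<open>l\<close> has.\<close>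

definition drop_end :: "'o \<Rightarrow> 'm \<Rightarrow> 'm \<Rightarrow> 'm" where
  "drop_end X k l = lrec X (Id C (lists X)) (butlast X (proj1 C (lists X) X)) k l"

lemma drop_end_simps [simp]:
  assumes "k \<in> Ar C" "l \<in> Ar C" "Dom C k = Dom C l" "Cod C k = lists X" "Cod C l = lists X" "X \<in> Ob C"
  shows "drop_end X k l \<in> Ar C" "Dom C (drop_end X k l) = Dom C l" "Cod C (drop_end X k l) = lists X"
    "\<And>t. t \<in> Ar C \<Longrightarrow> Cod C t = Dom C l \<Longrightarrow> drop_end X k l \<cdot> t = drop_end X (k \<cdot> t) (l \<cdot> t)"
  using lrec_simps(1,2)[of X "Id C (lists X)" "lists X" "lists X"
      "butlast X (proj1 C (lists X) X)" k "Dom C l" l] assms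
  by (simp_all add: drop_end_def)

lemma drop_end_nil [simp]:
  assumes "k \<in> Ar C" "Cod C k = lists X" "Dom C k = T" "X \<in> Ob C"
  shows "drop_end X k (nil X T) = k"
  using lrec_simps(3)[of X "Id C (lists X)" "lists X" "lists X"
      "butlast X (proj1 C (lists X) X)" k T] assms
  by (simp add: drop_end_def)

lemma drop_end_snoc [simp]:
  assumes "k \<in> Ar C" "l \<in> Ar C" "s \<in> Ar C" "Dom C k = Dom C s" "Dom C l = Dom C s"
    "Cod C k = lists X" "Cod C l = lists X" "Cod C s = X"
  shows "drop_end X k (snoc X l s) = butlast X (drop_end X k l)"
proof -
  have X: "X \<in> Ob C" using assms by auto
  show ?thesis
    using lrec_simps(1,4)[OF X, of "Id C (lists X)" "lists X" "lists X"
        "butlast X (proj1 C (lists X) X)" k "Dom C s" l] X assms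
    by (simp add: drop_end_def)
qed

text \<open>\<open>drop_end\<close> iterates \<open>butlast\<close>, and an iterate commutes with
  the map iterated. In \<open>drop_end_self\<close> this brings the extra \<open>butlast\<close>
  next to the \<open>snoc\<close> that it cancels.\<close>

lemma drop_end_butlast:
  assumes "k \<in> hom C T (lists X)" "l \<in> hom C T (lists X)" "X \<in> Ob C"
  shows "drop_end X (butlast X k) l = butlast X (drop_end X k l)"
  by (rule list_induct[where B = "lists X" and Y = "lists X"
        and F = "\<lambda>k l. drop_end X (butlast X k) l" and G = "\<lambda>k l. butlast X (drop_end X k l)"])
    (use assms in \<open>simp_all add: natural_op_def\<close>)

text \<open>A list used as the counter for its own shortening is used up exactly. This is how the
  iteration in \<open>transport_along_path\<close> comes to an empty path.\<close>

lemma drop_end_self: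
  assumes "l \<in> hom C T (lists X)" "X \<in> Ob C"
  shows "drop_end X l l = nil X T"
proof -
  have "T \<in> Ob C" using assms by auto
  have "drop_end X l l = nil X (Dom C l)"
    by (rule list_induct[where B = "terminal_ob C" and Y = "lists X" and x = "bang C T"
          and F = "\<lambda>x l. drop_end X l l" and G = "\<lambda>x l. nil X (Dom C l)"])
      (use assms \<open>T \<in> Ob C\<close> in \<open>auto simp: natural_op_def drop_end_butlast[symmetric]\<close>)
  then show ?thesis using assms by simp
qed

definition lmap :: "'o \<Rightarrow> 'o \<Rightarrow> 'm \<Rightarrow> 'm \<Rightarrow> 'm" where
  "lmap X Y f l = lrec X (nil Y (terminal_ob C)) (snoc Y (proj1 C (lists Y) X) (f \<cdot> proj2 C (lists Y) X))
     (bang C (Dom C l)) l"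

lemma lmap_simps [simp]:
  assumes "f \<in> Ar C" "Dom C f = X" "Cod C f = Y" "l \<in> Ar C" "Cod C l = lists X"
  shows "lmap X Y f l \<in> Ar C" "Dom C (lmap X Y f l) = Dom C l" "Cod C (lmap X Y f l) = lists Y"
    "\<And>t. t \<in> Ar C \<Longrightarrow> Cod C t = Dom C l \<Longrightarrow> lmap X Y f l \<cdot> t = lmap X Y f (l \<cdot> t)"
proof -
  have "X \<in> Ob C" "Y \<in> Ob C" using assms by auto
  then show "lmap X Y f l \<in> Ar C" "Dom C (lmap X Y f l) = Dom C l" "Cod C (lmap X Y f l) = lists Y"
    "\<And>t. t \<in> Ar C \<Longrightarrow> Cod C t = Dom C l \<Longrightarrow> lmap X Y f l \<cdot> t = lmap X Y f (l \<cdot> t)"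
    using lrec_simps(1,2)[of X "nil Y (terminal_ob C)" "terminal_ob C" "lists Y"
        "snoc Y (proj1 C (lists Y) X) (f \<cdot> proj2 C (lists Y) X)" "bang C (Dom C l)" "Dom C l" l] assms
    by (simp_all add: lmap_def)
qed

lemma lmap_nil [simp]:
  assumes "f \<in> Ar C" "Dom C f = X" "Cod C f = Y" "T \<in> Ob C"
  shows "lmap X Y f (nil X T) = nil Y T"
proof -
  have "X \<in> Ob C" "Y \<in> Ob C" using assms by auto
  then show ?thesis
    using lrec_simps(3)[of X "nil Y (terminal_ob C)" "terminal_ob C" "lists Y"
        "snoc Y (proj1 C (lists Y) X) (f \<cdot> proj2 C (lists Y) X)" "bang C T" T] assms
    by (simp add: lmap_def)
qed

lemma lmap_snoc [simp]:
  assumes "f \<in> Ar C" "Dom C f = X" "Cod C f = Y" "l \<in> Ar C" "s \<in> Ar C" "Dom C l = Dom C s"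
    "Cod C l = lists X" "Cod C s = X"
  shows "lmap X Y f (snoc X l s) = snoc Y (lmap X Y f l) (f \<cdot> s)"
proof -
  have "X \<in> Ob C" "Y \<in> Ob C" using assms by auto
  then show ?thesis
    using lrec_simps(1,4)[of X "nil Y (terminal_ob C)" "terminal_ob C" "lists Y"
        "snoc Y (proj1 C (lists Y) X) (f \<cdot> proj2 C (lists Y) X)" "bang C (Dom C s)" "Dom C s" l] assms
    by (simp add: lmap_def)
qed

lemma lmap_butlast:
  assumes "f \<in> hom C X Y" "l \<in> hom C T (lists X)"
  shows "lmap X Y f (butlast X l) = butlast Y (lmap X Y f l)"
proof -
  have Ob: "T \<in> Ob C" "X \<in> Ob C" "Y \<in> Ob C" using assms by auto
  show ?thesis
    by (rule list_induct[where B = "terminal_ob C" and Y = "lists Y" and x = "bang C T"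
          and F = "\<lambda>x l. lmap X Y f (butlast X l)" and G = "\<lambda>x l. butlast Y (lmap X Y f l)"])
      (use assms Ob in \<open>simp_all add: natural_op_def\<close>)
qed

lemma lmap_append:
  assumes "f \<in> hom C X Y" "k \<in> hom C T (lists X)" "l \<in> hom C T (lists X)"
  shows "lmap X Y f (append X k l) = append Y (lmap X Y f k) (lmap X Y f l)"
proof -
  have Ob: "T \<in> Ob C" "X \<in> Ob C" "Y \<in> Ob C" using assms by auto
  show ?thesis
    by (rule list_induct[where B = "lists X" and Y = "lists Y"
          and F = "\<lambda>k l. lmap X Y f (append X k l)"
          and G = "\<lambda>k l. append Y (lmap X Y f k) (lmap X Y f l)"])
      (use assms Ob in \<open>simp_all add: natural_op_def\<close>)
qed

lemma last_or_lmap: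
  assumes "f \<in> hom C X Y" "x \<in> hom C T X" "l \<in> hom C T (lists X)"
  shows "last_or Y (f \<cdot> x) (lmap X Y f l) = f \<cdot> last_or X x l"
proof -
  have Ob: "T \<in> Ob C" "X \<in> Ob C" "Y \<in> Ob C" using assms by auto
  show ?thesis
    by (rule list_induct[where B = X and Y = Y
          and F = "\<lambda>x l. last_or Y (f \<cdot> x) (lmap X Y f l)" and G = "\<lambda>x l. f \<cdot> last_or X x l"])
      (use assms Ob in \<open>simp_all add: natural_op_def\<close>)
qed

end

section \<open>Paths in a reflexive symmetric graph\<close>

locale graph = list_category C for C :: "('o, 'm) cat" (structure) +
  fixes X S :: 'o and src tgt loop flip :: 'm
  assumes src_hom: "src \<in> hom C S X" and tgt_hom: "tgt \<in> hom C S X"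
    and loop_hom: "loop \<in> hom C X S" and flip_hom: "flip \<in> hom C S S"
    and src_loop: "src \<cdot> loop = Id C X" and tgt_loop: "tgt \<cdot> loop = Id C X"
    and src_flip: "src \<cdot> flip = tgt" and tgt_flip: "tgt \<cdot> flip = src"
begin

lemma graph_Ob [simp]: "X \<in> Ob C" "S \<in> Ob C"
  using src_hom by auto

lemma graph_simps [simp]:
  "src \<in> Ar C" "Dom C src = S" "Cod C src = X" "tgt \<in> Ar C" "Dom C tgt = S" "Cod C tgt = X"
  "loop \<in> Ar C" "Dom C loop = X" "Cod C loop = S" "flip \<in> Ar C" "Dom C flip = S" "Cod C flip = S"
  using src_hom tgt_hom loop_hom flip_hom by auto

lemma graph_Comp_simps [simp]:
  assumes "t \<in> Ar C"
  shows "Cod C t = X \<Longrightarrow> src \<cdot> loop \<cdot> t = t" "Cod C t = X \<Longrightarrow> tgt \<cdot> loop \<cdot> t = t"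
    "Cod C t = S \<Longrightarrow> src \<cdot> flip \<cdot> t = tgt \<cdot> t" "Cod C t = S \<Longrightarrow> tgt \<cdot> flip \<cdot> t = src \<cdot> t"
  using assms Comp_assoc_simp[of t loop src] Comp_assoc_simp[of t loop tgt]
    Comp_assoc_simp[of t flip src] Comp_assoc_simp[of t flip tgt]
  by (simp_all add: src_loop tgt_loop src_flip tgt_flip)

text \<open>A path is a vertex \<open>x\<close> together with a list \<open>w\<close> of edges; if \<open>w\<close> is empty, its last edge is taken
  to be the loop at \<open>x\<close>.\<close>

definition last_edge :: "'m \<Rightarrow> 'm \<Rightarrow> 'm" where
  "last_edge x w = last_or S (loop \<cdot> x) w"

definition endpoint :: "'m \<Rightarrow> 'm \<Rightarrow> 'm" where
  "endpoint x w = tgt \<cdot> last_edge x w"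

text \<open>\<open>stations x w\<close> lists the endpoints of the proper initial segments of \<open>w\<close>.\<close>

definition stations_rec :: "'m \<Rightarrow> 'm \<Rightarrow> 'm" where
  "stations_rec x w = lrec S (pairing C loop (nil X X))
     (let Y = prod_ob C S (lists X) in pairing C (proj2 C Y S)
       (snoc X (proj2 C S (lists X) \<cdot> proj1 C Y S) (tgt \<cdot> proj1 C S (lists X) \<cdot> proj1 C Y S))) x w"

definition stations :: "'m \<Rightarrow> 'm \<Rightarrow> 'm" where
  "stations x w = proj2 C S (lists X) \<cdot> stations_rec x w"

text \<open>Compared entry by entry: every edge starts where the edges before it end, and the first
  one starts at \<open>x\<close>. Comparing whole lists avoids any quantification over
  positions.\<close>

definition is_path :: "'m \<Rightarrow> 'm \<Rightarrow> bool" where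
  "is_path x w \<longleftrightarrow> stations x w = lmap S X src w"

lemma last_edge_simps [simp]:
  assumes "x \<in> Ar C" "w \<in> Ar C" "Dom C x = Dom C w" "Cod C x = X" "Cod C w = lists S"
  shows "last_edge x w \<in> Ar C" "Dom C (last_edge x w) = Dom C w" "Cod C (last_edge x w) = S"
    "\<And>t. t \<in> Ar C \<Longrightarrow> Cod C t = Dom C w \<Longrightarrow> last_edge x w \<cdot> t = last_edge (x \<cdot> t) (w \<cdot> t)"
  using assms by (simp_all add: last_edge_def)

lemma endpoint_simps [simp]:
  assumes "x \<in> Ar C" "w \<in> Ar C" "Dom C x = Dom C w" "Cod C x = X" "Cod C w = lists S"
  shows "endpoint x w \<in> Ar C" "Dom C (endpoint x w) = Dom C w" "Cod C (endpoint x w) = X"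
    "\<And>t. t \<in> Ar C \<Longrightarrow> Cod C t = Dom C w \<Longrightarrow> endpoint x w \<cdot> t = endpoint (x \<cdot> t) (w \<cdot> t)"
  using assms by (simp_all add: endpoint_def)

lemma last_edge_nil [simp]:
  assumes "x \<in> Ar C" "Cod C x = X" "Dom C x = T"
  shows "last_edge x (nil S T) = loop \<cdot> x" "endpoint x (nil S T) = x"
  using assms by (simp_all add: last_edge_def endpoint_def)

lemma last_edge_snoc [simp]:
  assumes "x \<in> Ar C" "w \<in> Ar C" "s \<in> Ar C" "Dom C x = Dom C s" "Dom C w = Dom C s"
    "Cod C x = X" "Cod C w = lists S" "Cod C s = S"
  shows "last_edge x (snoc S w s) = s" "endpoint x (snoc S w s) = tgt \<cdot> s"
  using assms by (simp_all add: last_edge_def endpoint_def)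

lemma stations_rec_simps:
  assumes "x \<in> hom C T X"
  shows "w \<in> hom C T (lists S) \<Longrightarrow> stations_rec x w \<in> hom C T (prod_ob C S (lists X))"
    "w \<in> hom C T (lists S) \<Longrightarrow> t \<in> Ar C \<Longrightarrow> Cod C t = T \<Longrightarrow>
      stations_rec x w \<cdot> t = stations_rec (x \<cdot> t) (w \<cdot> t)"
    "stations_rec x (nil S T) = pairing C (loop \<cdot> x) (nil X T)"
    "w \<in> hom C T (lists S) \<Longrightarrow> s \<in> hom C T S \<Longrightarrow> stations_rec x (snoc S w s) =
      pairing C s (snoc X (stations x w) (tgt \<cdot> proj1 C S (lists X) \<cdot> stations_rec x w))"
proof -
  let ?Y = "prod_ob C S (lists X)"
  let ?b = "pairing C loop (nil X X)"
  let ?g = "pairing C (proj2 C ?Y S)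
    (snoc X (proj2 C S (lists X) \<cdot> proj1 C ?Y S) (tgt \<cdot> proj1 C S (lists X) \<cdot> proj1 C ?Y S))"
  have b: "?b \<in> hom C X ?Y" and g: "?g \<in> hom C (prod_ob C ?Y S) ?Y" by simp_all
  note rec = lrec_simps[OF graph_Ob(2) b g assms]
  show *: "w \<in> hom C T (lists S) \<Longrightarrow> stations_rec x w \<in> hom C T (prod_ob C S (lists X))"
    using rec(1) unfolding stations_rec_def Let_def by blast
  show "w \<in> hom C T (lists S) \<Longrightarrow> t \<in> Ar C \<Longrightarrow> Cod C t = T \<Longrightarrow>
      stations_rec x w \<cdot> t = stations_rec (x \<cdot> t) (w \<cdot> t)"
    using rec(2) unfolding stations_rec_def Let_def by blast
  show "stations_rec x (nil S T) = pairing C (loop \<cdot> x) (nil X T)"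
    using rec(3) assms unfolding stations_rec_def Let_def by simp
  show "w \<in> hom C T (lists S) \<Longrightarrow> s \<in> hom C T S \<Longrightarrow> stations_rec x (snoc S w s) =
      pairing C s (snoc X (stations x w) (tgt \<cdot> proj1 C S (lists X) \<cdot> stations_rec x w))"
    using rec(4)[of w s] * assms unfolding stations_def stations_rec_def Let_def by simp
qed

text \<open>The recursion for the stations keeps the last edge in its state, because appending an
  edge adds the endpoint reached before that edge to the stations.\<close>

lemma proj1_stations_rec:
  assumes "x \<in> hom C T X" "w \<in> hom C T (lists S)"
  shows "proj1 C S (lists X) \<cdot> stations_rec x w = last_edge x w"
  by (rule list_induct[where B = X and Y = S
        and F = "\<lambda>x w. proj1 C S (lists X) \<cdot> stations_rec x w" and G = last_edge])
    (use assms stations_rec_simps in \<open>simp_all add: natural_op_def stations_def\<close>)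

lemma stations_simps [simp]:
  assumes "x \<in> Ar C" "w \<in> Ar C" "Dom C x = Dom C w" "Cod C x = X" "Cod C w = lists S"
  shows "stations x w \<in> Ar C" "Dom C (stations x w) = Dom C w" "Cod C (stations x w) = lists X"
    "\<And>t. t \<in> Ar C \<Longrightarrow> Cod C t = Dom C w \<Longrightarrow> stations x w \<cdot> t = stations (x \<cdot> t) (w \<cdot> t)"
  using assms stations_rec_simps(1,2)[of x "Dom C w" w] by (simp_all add: stations_def)

lemma stations_nil [simp]:
  assumes "x \<in> Ar C" "Cod C x = X" "Dom C x = T"
  shows "stations x (nil S T) = nil X T"
  using assms stations_rec_simps(3)[of x T] by (auto simp add: stations_def)

lemma stations_snoc [simp]:
  assumes "x \<in> Ar C" "w \<in> Ar C" "s \<in> Ar C" "Dom C x = Dom C s" "Dom C w = Dom C s"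
    "Cod C x = X" "Cod C w = lists S" "Cod C s = S"
  shows "stations x (snoc S w s) = snoc X (stations x w) (endpoint x w)"
  using assms stations_rec_simps(4)[of x "Dom C s" w s] proj1_stations_rec[of x "Dom C s" w]
  by (simp add: stations_def[of x "snoc S w s"] endpoint_def)

lemma stations_butlast:
  assumes "x \<in> hom C T X" "w \<in> hom C T (lists S)"
  shows "stations x (butlast S w) = butlast X (stations x w)"
  by (rule list_induct[where B = X and Y = "lists X"
        and F = "\<lambda>x w. stations x (butlast S w)" and G = "\<lambda>x w. butlast X (stations x w)"])
    (use assms in \<open>simp_all add: natural_op_def\<close>)

text \<open>The last station is where the last edge has to start. The default \<open>x\<close> gives
  the right value for the empty list as well.\<close>

lemma last_or_stations:
  assumes "x \<in> hom C T X" "w \<in> hom C T (lists S)"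
  shows "last_or X x (stations x w) = endpoint x (butlast S w)"
  by (rule list_induct[where B = X and Y = X
        and F = "\<lambda>x w. last_or X x (stations x w)" and G = "\<lambda>x w. endpoint x (butlast S w)"])
    (use assms in \<open>simp_all add: natural_op_def\<close>)

lemma endpoint_append:
  assumes "x \<in> hom C T X" "w \<in> hom C T (lists S)" "w' \<in> hom C T (lists S)"
  shows "endpoint x (append S w w') = endpoint (endpoint x w) w'"
proof -
  \<comment> \<open>Induction on \<open>w'\<close> admits a single parameter, so \<open>x\<close>
    and \<open>w\<close> are packed into one element of a product.\<close>
  let ?p = "proj1 C X (lists S)" and ?q = "proj2 C X (lists S)"
  let ?F = "\<lambda>y w'. endpoint (?p \<cdot> y) (append S (?q \<cdot> y) w')"
    and ?G = "\<lambda>y w'. endpoint (endpoint (?p \<cdot> y) (?q \<cdot> y)) w'"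
  have "?F (pairing C x w) w' = ?G (pairing C x w) w'"
    by (rule list_induct[where B = "prod_ob C X (lists S)" and Y = X and F = ?F and G = ?G])
      (use assms in \<open>simp_all add: natural_op_def\<close>)
  then show ?thesis using assms by simp
qed

lemma stations_append:
  assumes "x \<in> hom C T X" "w \<in> hom C T (lists S)" "w' \<in> hom C T (lists S)"
  shows "stations x (append S w w') = append X (stations x w) (stations (endpoint x w) w')"
proof -
  let ?p = "proj1 C X (lists S)" and ?q = "proj2 C X (lists S)"
  let ?F = "\<lambda>y w'. stations (?p \<cdot> y) (append S (?q \<cdot> y) w')"
    and ?G = "\<lambda>y w'. append X (stations (?p \<cdot> y) (?q \<cdot> y)) (stations (endpoint (?p \<cdot> y) (?q \<cdot> y)) w')"
  have "?F (pairing C x w) w' = ?G (pairing C x w) w'"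
    by (rule list_induct[where B = "prod_ob C X (lists S)" and Y = "lists X" and F = ?F and G = ?G])
      (use assms in \<open>simp_all add: natural_op_def endpoint_append\<close>)
  then show ?thesis using assms by simp
qed

text \<open>\<open>butlast\<close> and \<open>last_or X x\<close> are applied to the two lists whose
  equality makes \<open>w\<close> a path. For empty \<open>w\<close> the last edge is the loop, and
  the second equation reads \<open>x = x\<close>.\<close>

lemma is_path_butlast:
  assumes "x \<in> hom C T X" "w \<in> hom C T (lists S)" "is_path x w"
  shows "is_path x (butlast S w)" "src \<cdot> last_edge x w = endpoint x (butlast S w)"
proof -
  show "is_path x (butlast S w)"
    using assms stations_butlast[OF assms(1,2)] lmap_butlast[OF src_hom assms(2)]
    unfolding is_path_def by simp
  show "src \<cdot> last_edge x w = endpoint x (butlast S w)"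
    using assms last_or_stations[OF assms(1,2)] last_or_lmap[OF src_hom, of "loop \<cdot> x" T w]
    unfolding is_path_def by (simp add: last_edge_def)
qed

section \<open>Elements joined by a path\<close>

definition linked :: "'m \<Rightarrow> 'm \<Rightarrow> bool" where
  "linked x y \<longleftrightarrow> (\<exists>w \<in> hom C (Dom C x) (lists S). is_path x w \<and> endpoint x w = y)"

lemma linked_refl:
  assumes "x \<in> hom C T X" shows "linked x x"
proof -
  have "T \<in> Ob C" using assms by auto
  then show ?thesis
    unfolding linked_def is_path_def using assms by (intro bexI[of _ "nil S T"]) auto
qed

lemma linked_trans:
  assumes "x \<in> hom C T X" "linked x y" "linked y z"
  shows "linked x z"
proof -
  obtain w where w: "w \<in> hom C T (lists S)" "is_path x w" "endpoint x w = y"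
    using assms unfolding linked_def by auto
  then have y: "Dom C y = T" using assms(1) by auto
  obtain w' where w': "w' \<in> hom C T (lists S)" "is_path y w'" "endpoint y w' = z"
    using assms(3) y unfolding linked_def by auto
  show ?thesis
    unfolding linked_def
  proof (intro bexI conjI)
    show "append S w w' \<in> hom C (Dom C x) (lists S)" using w w' assms by simp
    show "is_path x (append S w w')" "endpoint x (append S w w') = z"
      using w w' assms stations_append[of x T w w'] endpoint_append[of x T w w'] lmap_append[OF src_hom, of w T w']
      unfolding is_path_def by simp_all
  qed
qed

lemma linked_Comp:
  assumes "x \<in> hom C T X" "linked x y" "t \<in> hom C T' T"
  shows "linked (x \<cdot> t) (y \<cdot> t)"
proof -
  obtain w where w: "w \<in> hom C T (lists S)" "is_path x w" "endpoint x w = y"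
    using assms unfolding linked_def by auto
  show ?thesis
    unfolding linked_def
  proof (intro bexI[of _ "w \<cdot> t"] conjI)
    show "is_path (x \<cdot> t) (w \<cdot> t)"
    proof -
      have "stations x w \<cdot> t = lmap S X src w \<cdot> t"
        using w(2) unfolding is_path_def by (rule arg_cong)
      then show ?thesis
        unfolding is_path_def using w(1) assms by simp
    qed
    show "endpoint (x \<cdot> t) (w \<cdot> t) = y \<cdot> t"
      using w(1) assms(1,3) by (simp flip: w(3))
  qed (use w assms in simp)
qed

lemma linked_edge:
  assumes "s \<in> hom C T S"
  shows "linked (src \<cdot> s) (tgt \<cdot> s)"
proof -
  have "T \<in> Ob C" using assms by auto
  then show ?thesis
    unfolding linked_def is_path_def using assms by (intro bexI[of _ "snoc S (nil S T) s"]) auto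
qed

lemma linked_edge_flip:
  assumes "s \<in> hom C T S"
  shows "linked (tgt \<cdot> s) (src \<cdot> s)"
  using linked_edge[of "flip \<cdot> s" T] assms by simp

end

section \<open>Regular epimorphisms and images\<close>

locale exact_cat = finlim_category C for C :: "('o, 'm) cat" (structure) +
  assumes exact: "exact_category C"
begin

lemma regular_epi_D:
  assumes "is_regular_epi C e"
  shows "e \<in> Ar C" "Dom C e \<in> Ob C" "Cod C e \<in> Ob C"
  using assms is_coequaliser_D unfolding is_regular_epi_def by (blast intro: Ob_simps)+

lemma regular_epi_epi:
  assumes e: "is_regular_epi C e" and g: "g \<in> hom C (Cod C e) W" "g' \<in> hom C (Cod C e) W"
    and eq: "g \<cdot> e = g' \<cdot> e"
  shows "g = g'"
proof -
  obtain u v where q: "is_coequaliser C u v e" using e by (auto simp: is_regular_epi_def)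
  note D = is_coequaliser_D[OF q]
  have "(g \<cdot> e) \<cdot> u = (g \<cdot> e) \<cdot> v" using D g by simp
  moreover have "g \<cdot> e \<in> hom C (Cod C u) W" using D g by simp
  ultimately have "\<exists>!k. k \<in> hom C (Cod C e) W \<and> k \<cdot> e = g \<cdot> e"
    using is_coequaliser_factor[OF q] by blast
  then show ?thesis using g eq by metis
qed

text \<open>The pair of which \<open>e\<close> is the coequaliser is one of the pairs
  \<open>a, b\<close>. Later arguments can thus work with the identifications made by
  \<open>e\<close> and ignore that pair.\<close>

lemma regular_epi_factor:
  assumes e: "is_regular_epi C e" and h: "h \<in> hom C (Dom C e) W"
    and eq: "\<And>T a b. a \<in> hom C T (Dom C e) \<Longrightarrow> b \<in> hom C T (Dom C e) \<Longrightarrow> e \<cdot> a = e \<cdot> b \<Longrightarrow> h \<cdot> a = h \<cdot> b"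
  shows "\<exists>!k. k \<in> hom C (Cod C e) W \<and> k \<cdot> e = h"
proof -
  obtain u v where q: "is_coequaliser C u v e" using e by (auto simp: is_regular_epi_def)
  note D = is_coequaliser_D[OF q]
  have "h \<cdot> u = h \<cdot> v" using eq[of u "Dom C u" v] D by simp
  moreover have "h \<in> hom C (Cod C u) W" using D h by simp
  ultimately show ?thesis using is_coequaliser_factor[OF q] by blast
qed

text \<open>A regular epimorphism is locally surjective: the cover is its pullback along
  \<open>f\<close>, again a regular epimorphism by regularity.\<close>

lemma regular_epi_cover:
  assumes e: "is_regular_epi C e" and f: "f \<in> hom C T (Cod C e)"
  obtains T' t g where "is_regular_epi C t" "t \<in> hom C T' T" "g \<in> hom C T' (Dom C e)" "e \<cdot> g = f \<cdot> t"
proof -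
  obtain P p q where P: "is_pullback C f e P p q"
    using pullback_obtain[of f e] f regular_epi_D[OF e] by auto
  then have "is_regular_epi C p"
    using exact e unfolding exact_category_def regular_category_def by blast
  then show thesis using that[of p P q] is_pullback_D[OF P] f by simp
qed

text \<open>The image is the quotient of \<open>P\<close> by the kernel pair of \<open>f\<close>.
  Two elements of it with the same value under \<open>m\<close> lift locally to elements of
  \<open>P\<close> that \<open>f\<close> identifies; these form an element of the kernel pair, so
  \<open>c\<close> identifies them too.\<close>

lemma image_obtain:
  assumes f: "f \<in> hom C P Y"
  obtains I c m where "is_regular_epi C c" "c \<in> hom C P I" "m \<in> hom C I Y" "m \<cdot> c = f"
    "\<And>T a b. a \<in> hom C T I \<Longrightarrow> b \<in> hom C T I \<Longrightarrow> m \<cdot> a = m \<cdot> b \<Longrightarrow> a = b"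
proof -
  obtain K r s where K: "is_pullback C f f K r s"
    using pullback_obtain[of f f] f by auto
  note D = is_pullback_D[OF K]
  have "is_kernel_pair C f r s" using K D by (simp add: is_kernel_pair_def)
  then obtain c where c: "is_coequaliser C r s c"
    using exact unfolding exact_category_def regular_category_def by blast
  note Dc = is_coequaliser_D[OF c]
  have "f \<in> hom C (Cod C r) Y" using D f by simp
  then obtain m where m: "m \<in> hom C (Cod C c) Y" "m \<cdot> c = f"
    using is_coequaliser_factor[OF c] D by blast
  have reg: "is_regular_epi C c" using c by (auto simp: is_regular_epi_def)
  have ch: "c \<in> hom C P (Cod C c)" using Dc D f by simp
  have mc: "m \<cdot> (c \<cdot> t) = f \<cdot> t" if "t \<in> Ar C" "Cod C t = P" for t
    using Comp_assoc_simp[of t c m] m ch that by simp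
  show thesis
  proof (rule that[OF reg ch m])
    fix T a b assume a: "a \<in> hom C T (Cod C c)" and b: "b \<in> hom C T (Cod C c)" and eq: "m \<cdot> a = m \<cdot> b"
    \<comment> \<open>The covers for \<open>a\<close> and for \<open>b\<close> are stacked and later
      cancelled one at a time, so that no composite of regular epimorphisms has to be recognised as
      one.\<close>
    obtain T1 t1 g1 where 1: "is_regular_epi C t1" "t1 \<in> hom C T1 T" "g1 \<in> hom C T1 P" "c \<cdot> g1 = a \<cdot> t1"
      using regular_epi_cover[OF reg a] ch by auto
    have "b \<cdot> t1 \<in> hom C T1 (Cod C c)" using b 1 by simp
    then obtain T2 t2 g2 where 2: "is_regular_epi C t2" "t2 \<in> hom C T2 T1" "g2 \<in> hom C T2 P"
        "c \<cdot> g2 = (b \<cdot> t1) \<cdot> t2"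
      using regular_epi_cover[OF reg, of "b \<cdot> t1" T1] ch by auto
    have ag: "c \<cdot> (g1 \<cdot> t2) = a \<cdot> (t1 \<cdot> t2)"
      by (rule Comp_eq_Comp[OF 1(4)]) (use 1 2 a ch in auto)
    have "f \<cdot> (g1 \<cdot> t2) = m \<cdot> (a \<cdot> (t1 \<cdot> t2))" using ag mc[of "g1 \<cdot> t2"] 1 2 by simp
    also have "\<dots> = m \<cdot> (b \<cdot> (t1 \<cdot> t2))"
      by (rule Comp_eq_Comp[OF eq]) (use 1 2 a b m in auto)
    also have "\<dots> = f \<cdot> g2" using mc[of g2] 1 2 b by simp
    finally obtain u where u: "u \<in> hom C T2 K" "r \<cdot> u = g1 \<cdot> t2" "s \<cdot> u = g2"
      using is_pullback_lift[OF K, of "g1 \<cdot> t2" T2 g2] 1 2 f by auto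
    have "c \<cdot> (r \<cdot> u) = c \<cdot> (s \<cdot> u)"
      by (rule Comp_eq_Comp) (use Dc u D in auto)
    then have "(a \<cdot> t1) \<cdot> t2 = (b \<cdot> t1) \<cdot> t2" using u ag 1 2 a b by simp
    then have "a \<cdot> t1 = b \<cdot> t1"
      using regular_epi_epi[OF 2(1), of "a \<cdot> t1" "Cod C c" "b \<cdot> t1"] 1 2 a b by simp
    then show "a = b"
      using regular_epi_epi[OF 1(1), of a "Cod C c" b] 1 a b by simp
  qed
qed

end

section \<open>The quotient of a graph by its paths\<close>

locale pretopos_graph = graph C + exact_cat C for C :: "('o, 'm) cat" (structure)
begin

text \<open>The last clause is the Kripke-Joyal reading of "elements of the same class are joined by
  a path": the existential quantifier turns into a cover \<open>t\<close>.\<close>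

definition is_path_quotient :: "'m \<Rightarrow> bool" where
  "is_path_quotient q \<longleftrightarrow> is_regular_epi C q \<and> Dom C q = X \<and> q \<cdot> src = q \<cdot> tgt \<and>
     (\<forall>T x y. x \<in> hom C T X \<longrightarrow> y \<in> hom C T X \<longrightarrow> q \<cdot> x = q \<cdot> y \<longrightarrow>
        (\<exists>T' t. is_regular_epi C t \<and> t \<in> hom C T' T \<and> linked (x \<cdot> t) (y \<cdot> t)))"

text \<open>Linking in both directions is symmetric by construction, which avoids reversing paths.\<close>

lemma link_image_obtain:
  obtains I m where "m \<in> hom C I (prod_ob C X X)"
    "\<And>T a b. a \<in> hom C T I \<Longrightarrow> b \<in> hom C T I \<Longrightarrow> m \<cdot> a = m \<cdot> b \<Longrightarrow> a = b"
    "\<And>T x y. x \<in> hom C T X \<Longrightarrow> y \<in> hom C T X \<Longrightarrow> linked x y \<Longrightarrow> linked y x \<Longrightarrow>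
       \<exists>a \<in> hom C T I. m \<cdot> a = pairing C x y"
    "\<And>T x y a. x \<in> hom C T X \<Longrightarrow> y \<in> hom C T X \<Longrightarrow> a \<in> hom C T I \<Longrightarrow> m \<cdot> a = pairing C x y \<Longrightarrow>
       \<exists>T' t. is_regular_epi C t \<and> t \<in> hom C T' T \<and> linked (x \<cdot> t) (y \<cdot> t) \<and> linked (y \<cdot> t) (x \<cdot> t)"
proof -
  let ?L = "lists S"
  let ?A = "prod_ob C X (prod_ob C ?L ?L)"
  let ?x = "proj1 C X (prod_ob C ?L ?L)"
  let ?w = "proj1 C ?L ?L \<cdot> proj2 C X (prod_ob C ?L ?L)"
  let ?w' = "proj2 C ?L ?L \<cdot> proj2 C X (prod_ob C ?L ?L)"
  \<comment> \<open>Equality of \<open>F\<close> and \<open>G\<close> packs three conditions into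
    one: \<open>w\<close> is a path from \<open>x\<close>, \<open>w'\<close> is a path from the end
    of \<open>w\<close>, and \<open>w'\<close> leads back to \<open>x\<close>.\<close>
  define F where "F = pairing C (stations ?x ?w)
    (pairing C (stations (endpoint ?x ?w) ?w') (endpoint (endpoint ?x ?w) ?w'))"
  define G where "G = pairing C (lmap S X src ?w) (pairing C (lmap S X src ?w') ?x)"
  let ?B = "prod_ob C (lists X) (prod_ob C (lists X) X)"
  have FG: "F \<in> hom C ?A ?B" "G \<in> hom C ?A ?B" by (simp_all add: F_def G_def)
  have FG_iff: "F \<cdot> pairing C x (pairing C w w') = G \<cdot> pairing C x (pairing C w w') \<longleftrightarrow>
      is_path x w \<and> is_path (endpoint x w) w' \<and> endpoint (endpoint x w) w' = x"
    if "x \<in> hom C T X" "w \<in> hom C T ?L" "w' \<in> hom C T ?L" for T x w w'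
    using that unfolding F_def G_def is_path_def
    by (simp add: pairing_eq_iff[of _ T "lists X" _ "prod_ob C (lists X) X"] pairing_eq_iff[of _ T "lists X" _ X])
  obtain E e where e: "e \<in> hom C E ?A" "F \<cdot> e = G \<cdot> e"
    and lift: "\<And>T t. t \<in> hom C T ?A \<Longrightarrow> F \<cdot> t = G \<cdot> t \<Longrightarrow> \<exists>u. u \<in> hom C T E \<and> e \<cdot> u = t"
    using FG by (rule equaliser_obtain) blast
  \<comment> \<open>Of a round trip only the start and the turning point are recorded.\<close>
  define f where "f = pairing C ?x (endpoint ?x ?w) \<cdot> e"
  have f: "f \<in> hom C E (prod_ob C X X)" using e by (simp add: f_def)
  obtain I c m where c: "is_regular_epi C c" "c \<in> hom C E I" and m: "m \<in> hom C I (prod_ob C X X)"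
    and mc: "m \<cdot> c = f"
    and mono: "\<And>T a b. a \<in> hom C T I \<Longrightarrow> b \<in> hom C T I \<Longrightarrow> m \<cdot> a = m \<cdot> b \<Longrightarrow> a = b"
    using image_obtain[OF f] by blast
  have mct: "m \<cdot> c \<cdot> t = f \<cdot> t" if "t \<in> Ar C" "Cod C t = E" for t
    using Comp_assoc_simp[of t c m] mc m c that by simp
  have intro: "\<exists>a \<in> hom C T I. m \<cdot> a = pairing C x y"
    if x: "x \<in> hom C T X" and y: "y \<in> hom C T X" and l: "linked x y" "linked y x" for T x y
  proof -
    obtain w w' where w: "w \<in> hom C T ?L" "is_path x w" "endpoint x w = y"
        "w' \<in> hom C T ?L" "is_path y w'" "endpoint y w' = x"
      using l x y unfolding linked_def by auto
    let ?p = "pairing C x (pairing C w w')"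
    obtain u where u: "u \<in> hom C T E" "e \<cdot> u = ?p"
      using lift[of ?p T] FG_iff[of x T w w'] x w by auto
    have "m \<cdot> (c \<cdot> u) = pairing C x y"
      using mct[of u] u e w x by (simp add: f_def)
    then show ?thesis using u c by (intro bexI[of _ "c \<cdot> u"]) auto
  qed
  have elim: "\<exists>T' t. is_regular_epi C t \<and> t \<in> hom C T' T \<and> linked (x \<cdot> t) (y \<cdot> t) \<and> linked (y \<cdot> t) (x \<cdot> t)"
    if x: "x \<in> hom C T X" and y: "y \<in> hom C T X" and a: "a \<in> hom C T I" and eq: "m \<cdot> a = pairing C x y"
    for T x y a
  proof -
    \<comment> \<open>An element of the image comes from actual paths only after passing to a
      cover.\<close>
    obtain T' t g where t: "is_regular_epi C t" "t \<in> hom C T' T" "g \<in> hom C T' E" "c \<cdot> g = a \<cdot> t"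
      using regular_epi_cover[OF c(1), of a T] a c by auto
    let ?a = "?x \<cdot> e \<cdot> g" and ?b = "?w \<cdot> e \<cdot> g" and ?b' = "?w' \<cdot> e \<cdot> g"
    have abc: "?a \<in> hom C T' X" "?b \<in> hom C T' ?L" "?b' \<in> hom C T' ?L" using e t by simp_all
    have dec: "pairing C ?a (pairing C ?b ?b') = e \<cdot> g" using e t by simp
    have "F \<cdot> (e \<cdot> g) = G \<cdot> (e \<cdot> g)"
      by (rule Comp_eq_Comp[OF e(2)]) (use e t FG in auto)
    then have path: "is_path ?a ?b" "is_path (endpoint ?a ?b) ?b'" "endpoint (endpoint ?a ?b) ?b' = ?a"
      using FG_iff[OF abc] unfolding dec by auto
    have "pairing C (x \<cdot> t) (y \<cdot> t) = m \<cdot> (a \<cdot> t)"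
      using arg_cong[OF eq, of "\<lambda>h. h \<cdot> t"] x y a t m by simp
    also have "\<dots> = pairing C ?a (endpoint ?a ?b)"
      using mct[of g] t e unfolding f_def by simp
    finally have "x \<cdot> t = ?a \<and> y \<cdot> t = endpoint ?a ?b"
      by (subst (asm) pairing_eq_iff[of _ T' X _ X]) (use x y t abc in auto)
    then have "linked (x \<cdot> t) (y \<cdot> t)" "linked (y \<cdot> t) (x \<cdot> t)"
      using path abc unfolding linked_def by auto
    then show ?thesis using t by blast
  qed
  show thesis by (rule that[OF m mono intro elim])
qed

text \<open>Regular epimorphisms are orthogonal to monomorphisms: as \<open>m\<close> identifies
  nothing, \<open>a\<close> respects the identifications made by \<open>t\<close> and descends along
  it. Membership in the relation may therefore be tested on a cover.\<close>

lemma link_image_descent: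
  assumes m: "m \<in> hom C I (prod_ob C X X)"
    and mono: "\<And>T a b. a \<in> hom C T I \<Longrightarrow> b \<in> hom C T I \<Longrightarrow> m \<cdot> a = m \<cdot> b \<Longrightarrow> a = b"
    and t: "is_regular_epi C t" "t \<in> hom C T' T"
    and z: "z \<in> hom C T (prod_ob C X X)" and a: "a \<in> hom C T' I" "m \<cdot> a = z \<cdot> t"
  shows "\<exists>b \<in> hom C T I. m \<cdot> b = z"
proof -
  have "\<exists>!k. k \<in> hom C (Cod C t) I \<and> k \<cdot> t = a"
  proof (rule regular_epi_factor[OF t(1)])
    show "a \<in> hom C (Dom C t) I" using a t by simp
    fix U u v assume uv: "u \<in> hom C U (Dom C t)" "v \<in> hom C U (Dom C t)" "t \<cdot> u = t \<cdot> v"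
    have "m \<cdot> (a \<cdot> u) = z \<cdot> (t \<cdot> u)" by (rule Comp_eq_Comp[OF a(2)]) (use a m t z uv in auto)
    moreover have "m \<cdot> (a \<cdot> v) = z \<cdot> (t \<cdot> v)" by (rule Comp_eq_Comp[OF a(2)]) (use a m t z uv in auto)
    ultimately have "m \<cdot> (a \<cdot> u) = m \<cdot> (a \<cdot> v)" using uv by simp
    then show "a \<cdot> u = a \<cdot> v" using mono[of "a \<cdot> u" U "a \<cdot> v"] uv a t by simp
  qed
  then obtain k where k: "k \<in> hom C T I" "k \<cdot> t = a" using t by auto
  have "(m \<cdot> k) \<cdot> t = z \<cdot> t" using k m t a by simp
  then have "m \<cdot> k = z"
    using regular_epi_epi[OF t(1), of "m \<cdot> k" "prod_ob C X X" z] k m t z by simp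
  then show ?thesis using k by blast
qed

lemma path_quotient_exists: "\<exists>q. is_path_quotient q"
proof -
  obtain I m where m: "m \<in> hom C I (prod_ob C X X)"
    and mono: "\<And>T a b. a \<in> hom C T I \<Longrightarrow> b \<in> hom C T I \<Longrightarrow> m \<cdot> a = m \<cdot> b \<Longrightarrow> a = b"
    and intro: "\<And>T x y. x \<in> hom C T X \<Longrightarrow> y \<in> hom C T X \<Longrightarrow> linked x y \<Longrightarrow> linked y x \<Longrightarrow>
       \<exists>a \<in> hom C T I. m \<cdot> a = pairing C x y"
    and elim: "\<And>T x y a. x \<in> hom C T X \<Longrightarrow> y \<in> hom C T X \<Longrightarrow> a \<in> hom C T I \<Longrightarrow> m \<cdot> a = pairing C x y \<Longrightarrow>
       \<exists>T' t. is_regular_epi C t \<and> t \<in> hom C T' T \<and> linked (x \<cdot> t) (y \<cdot> t) \<and> linked (y \<cdot> t) (x \<cdot> t)"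
    by (rule link_image_obtain) blast
  define r where "r = proj1 C X X \<cdot> m"
  define s where "s = proj2 C X X \<cdot> m"
  have rs: "r \<in> hom C I X" "s \<in> hom C I X" using m by (simp_all add: r_def s_def)
  have dec: "m \<cdot> a = pairing C (r \<cdot> a) (s \<cdot> a)" if "a \<in> hom C T I" for T a
    using that m by (simp add: r_def s_def)
  \<comment> \<open>\<open>R T\<close> is the relation on elements at stage \<open>T\<close> that
    the pair \<open>r, s\<close> represents.\<close>
  define R where "R T = (\<lambda>t. (r \<cdot> t, s \<cdot> t)) ` hom C T I" for T
  have R_iff: "(x, y) \<in> R T \<longleftrightarrow> (\<exists>a \<in> hom C T I. m \<cdot> a = pairing C x y)"
    if "x \<in> hom C T X" "y \<in> hom C T X" for x y T
  proof -
    have "(x, y) = (r \<cdot> a, s \<cdot> a) \<longleftrightarrow> m \<cdot> a = pairing C x y" if a: "a \<in> hom C T I" for a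
      using dec[OF a] pairing_eq_iff[of "r \<cdot> a" T X "s \<cdot> a" X x y] \<open>x \<in> _\<close> \<open>y \<in> _\<close> a rs by auto
    then show ?thesis unfolding R_def by auto
  qed
  have R_hom: "R T \<subseteq> hom C T X \<times> hom C T X" for T
    unfolding R_def using rs by auto
  have R_refl: "(x, x) \<in> R T" if "x \<in> hom C T X" for x T
    using that R_iff[OF that that] intro[OF that that] linked_refl[OF that] by blast
  have R_local: "\<exists>T' t. is_regular_epi C t \<and> t \<in> hom C T' T \<and> linked (x \<cdot> t) (y \<cdot> t) \<and> linked (y \<cdot> t) (x \<cdot> t)"
    if "(x, y) \<in> R T" for x y T
    using that R_hom[of T] R_iff[of x T y] elim[of x T y] by blast
  have R_desc: "(x, y) \<in> R T"
    if t: "is_regular_epi C t" "t \<in> hom C T' T" and xy: "x \<in> hom C T X" "y \<in> hom C T X"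
      and R: "(x \<cdot> t, y \<cdot> t) \<in> R T'" for x y T T' t
  proof -
    obtain a where "a \<in> hom C T' I" "m \<cdot> a = pairing C (x \<cdot> t) (y \<cdot> t)"
      using R xy t R_iff[of "x \<cdot> t" T' "y \<cdot> t"] by auto
    then have "\<exists>b \<in> hom C T I. m \<cdot> b = pairing C x y"
      using link_image_descent[OF m mono t, where z = "pairing C x y" and a = a] xy t by simp
    then show ?thesis using R_iff xy by blast
  qed
  have R_intro: "(x, y) \<in> R T"
    if "is_regular_epi C t" "t \<in> hom C T' T" "x \<in> hom C T X" "y \<in> hom C T X"
      "linked (x \<cdot> t) (y \<cdot> t)" "linked (y \<cdot> t) (x \<cdot> t)" for x y T T' t
    using R_desc[OF that(1-4)] R_iff[of "x \<cdot> t" T' "y \<cdot> t"] intro[of "x \<cdot> t" T' "y \<cdot> t"] that by simp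
  have R_sym: "(y, x) \<in> R T" if "(x, y) \<in> R T" for x y T
    using R_local[OF that] R_intro R_hom that by blast
  have R_trans: "(x, z) \<in> R T" if xy: "(x, y) \<in> R T" and yz: "(y, z) \<in> R T" for x y z T
  proof -
    have xyz: "x \<in> hom C T X" "y \<in> hom C T X" "z \<in> hom C T X" using R_hom xy yz by blast+
    obtain T1 t1 where 1: "is_regular_epi C t1" "t1 \<in> hom C T1 T" "linked (x \<cdot> t1) (y \<cdot> t1)" "linked (y \<cdot> t1) (x \<cdot> t1)"
      using R_local[OF xy] by blast
    have xyz1: "x \<cdot> t1 \<in> hom C T1 X" "y \<cdot> t1 \<in> hom C T1 X" "z \<cdot> t1 \<in> hom C T1 X" using xyz 1 by auto
    obtain a where a: "a \<in> hom C T I" "m \<cdot> a = pairing C y z" using R_iff xyz yz by blast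
    \<comment> \<open>The cover for \<open>y\<close> and \<open>z\<close> is taken over the one for
      \<open>x\<close> and \<open>y\<close>, so that at stage \<open>T2\<close> both pairs are
      linked and the paths compose. The result descends along \<open>t2\<close> and then along
      \<open>t1\<close>.\<close>
    have "m \<cdot> (a \<cdot> t1) = pairing C (y \<cdot> t1) (z \<cdot> t1)"
      using Comp_eq[OF a(2), of t1] a(1) xyz 1 m by simp
    moreover have "a \<cdot> t1 \<in> hom C T1 I" using a 1 by auto
    ultimately obtain T2 t2 where 2: "is_regular_epi C t2" "t2 \<in> hom C T2 T1"
        "linked ((y \<cdot> t1) \<cdot> t2) ((z \<cdot> t1) \<cdot> t2)" "linked ((z \<cdot> t1) \<cdot> t2) ((y \<cdot> t1) \<cdot> t2)"
      using elim[OF xyz1(2,3)] by blast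
    have h2: "(x \<cdot> t1) \<cdot> t2 \<in> hom C T2 X" "(z \<cdot> t1) \<cdot> t2 \<in> hom C T2 X" using xyz1 2 by auto
    have "linked ((x \<cdot> t1) \<cdot> t2) ((z \<cdot> t1) \<cdot> t2)" "linked ((z \<cdot> t1) \<cdot> t2) ((x \<cdot> t1) \<cdot> t2)"
      using linked_trans[OF h2(1) linked_Comp[OF xyz1(1) 1(3) 2(2)] 2(3)]
        linked_trans[OF h2(2) 2(4) linked_Comp[OF xyz1(2) 1(4) 2(2)]] by blast+
    then have "(x \<cdot> t1, z \<cdot> t1) \<in> R T1" using R_intro[OF 2(1,2) xyz1(1,3)] by blast
    then show ?thesis using R_desc[OF 1(1,2) xyz(1,3)] by blast
  qed
  have "is_equivalence_relation C X r s"
    unfolding is_equivalence_relation_def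
  proof (intro conjI ballI)
    fix T assume "T \<in> Ob C"
    show "inj_on (\<lambda>t. (r \<cdot> t, s \<cdot> t)) (hom C T (Dom C r))"
      using rs dec mono[of _ T] by (auto simp: inj_on_def)
    have "equiv (hom C T X) (R T)"
      using R_refl R_sym R_trans R_hom
      unfolding equiv_def refl_on_def sym_on_def trans_on_def by blast
    then show "equiv (hom C T X) ((\<lambda>t. (r \<cdot> t, s \<cdot> t)) ` hom C T (Dom C r))"
      using rs by (simp add: R_def)
  qed (use rs in auto)
  then obtain f where f: "is_kernel_pair C f r s" using exact unfolding exact_category_def by blast
  then obtain q where q: "is_coequaliser C r s q"
    using exact unfolding exact_category_def regular_category_def by blast
  have pb: "is_pullback C f f I r s" using f rs by (simp add: is_kernel_pair_def)
  note Df = is_pullback_D[OF pb] and Dq = is_coequaliser_D[OF q]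
  have qh: "q \<in> Ar C" "Dom C q = X" using Dq rs by simp_all
  \<comment> \<open>Exactness yields some \<open>f\<close> with kernel pair \<open>r, s\<close>,
    whereas \<open>q\<close> is the quotient of that pair. Since \<open>f\<close> factors through
    \<open>q\<close>, elements identified by \<open>q\<close> are identified by \<open>f\<close> and
    hence lie in the relation.\<close>
  have "f \<in> hom C (Cod C r) (Cod C f)" using Df rs by simp
  then obtain k where k: "k \<in> hom C (Cod C q) (Cod C f)" "k \<cdot> q = f"
    using is_coequaliser_factor[OF q] Df by blast
  have "is_path_quotient q"
    unfolding is_path_quotient_def
  proof (intro conjI allI impI)
    show "is_regular_epi C q" using q by (auto simp: is_regular_epi_def)
    show "Dom C q = X" by (fact qh)
    \<comment> \<open>The generic edge, the identity of \<open>S\<close>, links \<open>src\<close>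
      to \<open>tgt\<close> and, through \<open>flip\<close>, back again.\<close>
    obtain a where a: "a \<in> hom C S I" "m \<cdot> a = pairing C src tgt"
      using intro[OF src_hom tgt_hom] linked_edge[of "Id C S" S] linked_edge_flip[of "Id C S" S] by auto
    have ra: "src = r \<cdot> a" "tgt = s \<cdot> a"
      using dec[OF a(1)] a rs pairing_eq_iff[of src S X tgt X "r \<cdot> a" "s \<cdot> a"] by auto
    show "q \<cdot> src = q \<cdot> tgt"
      unfolding ra by (rule Comp_eq_Comp) (use Dq rs a qh in auto)
    fix T x y assume x: "x \<in> hom C T X" and y: "y \<in> hom C T X" and eq: "q \<cdot> x = q \<cdot> y"
    have "f \<cdot> x = f \<cdot> y"
      using Comp_eq[OF k(2), of x] Comp_eq[OF k(2), of y] eq k(1) qh x y by simp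
    then obtain u where u: "u \<in> hom C T I" "r \<cdot> u = x" "s \<cdot> u = y"
      using is_pullback_lift[OF pb, of x T y] x y Df rs by auto
    then have "(x, y) \<in> R T" by (auto simp: R_def)
    then show "\<exists>T' t. is_regular_epi C t \<and> t \<in> hom C T' T \<and> linked (x \<cdot> t) (y \<cdot> t)"
      using R_local by blast
  qed
  then show ?thesis ..
qed

lemma is_path_quotient_simps:
  assumes "is_path_quotient q"
  shows "is_regular_epi C q" "q \<in> Ar C" "Dom C q = X" "q \<cdot> src = q \<cdot> tgt"
  using assms regular_epi_D unfolding is_path_quotient_def by blast+

text \<open>The letters of \<open>w\<close> are removed one by one from the end, which moves \<open>c\<close> back along the path
  within the fibre over \<open>z \<cdot> c\<close>.\<close>

lemma transport_along_path:
  assumes q: "is_path_quotient q" and pb: "is_pullback C f q X' z v" and h: "h \<in> hom C X' W"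
    and step: "\<And>T s c c'. s \<in> hom C T S \<Longrightarrow> c \<in> hom C T X' \<Longrightarrow> c' \<in> hom C T X' \<Longrightarrow>
      v \<cdot> c = src \<cdot> s \<Longrightarrow> v \<cdot> c' = tgt \<cdot> s \<Longrightarrow> z \<cdot> c = z \<cdot> c' \<Longrightarrow> h \<cdot> c = h \<cdot> c'"
    and x: "x \<in> hom C T X" and w: "w \<in> hom C T (lists S)" "is_path x w"
    and c: "c \<in> hom C T X'" "v \<cdot> c = endpoint x w"
    and c0: "c0 \<in> hom C T X'" "v \<cdot> c0 = x" "z \<cdot> c0 = z \<cdot> c"
  shows "h \<cdot> c0 = h \<cdot> c"
proof -
  let ?L = "lists S"
  let ?A = "prod_ob C X (prod_ob C ?L X')"
  note qs = is_path_quotient_simps[OF q]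
  have pbs [simp]: "X' \<in> Ob C" "z \<in> Ar C" "Dom C z = X'" "Cod C z = Dom C f" "v \<in> Ar C" "Dom C v = X'"
      "Cod C v = X" "f \<in> Ar C" "q \<in> Ar C" "Dom C q = X" "Cod C q = Cod C f" "Dom C f \<in> Ob C"
    and sq: "f \<cdot> z = q \<cdot> v"
    using is_pullback_D[OF pb] qs by auto
  have hs [simp]: "h \<in> Ar C" "Dom C h = X'" "Cod C h = W" using h by auto
  let ?x = "proj1 C X (prod_ob C ?L X')"
  let ?w = "proj1 C ?L X' \<cdot> proj2 C X (prod_ob C ?L X')"
  let ?c = "proj2 C ?L X' \<cdot> proj2 C X (prod_ob C ?L X')"
  define F where "F = pairing C (stations ?x ?w) (endpoint ?x ?w)"
  define G where "G = pairing C (lmap S X src ?w) (v \<cdot> ?c)"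
  have FG: "F \<in> hom C ?A (prod_ob C (lists X) X)" "G \<in> hom C ?A (prod_ob C (lists X) X)"
    by (simp_all add: F_def G_def)
  have FG_iff: "F \<cdot> pairing C x (pairing C w c) = G \<cdot> pairing C x (pairing C w c) \<longleftrightarrow>
      is_path x w \<and> endpoint x w = v \<cdot> c"
    if "x \<in> hom C T X" "w \<in> hom C T ?L" "c \<in> hom C T X'" for T x w c
    using that unfolding F_def G_def is_path_def by (simp add: pairing_eq_iff[of _ T "lists X" _ X])
  \<comment> \<open>\<open>E\<close> is the object of states: a start, a path from it, and a point
    of \<open>X'\<close> over the end of the path. The generic state has the components
    \<open>xE\<close>, \<open>wE\<close> and \<open>cE\<close>.\<close>
  obtain E e where E: "E \<in> Ob C" "e \<in> hom C E ?A" and e_eq: "F \<cdot> e = G \<cdot> e"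
    and lift: "\<And>T t. t \<in> hom C T ?A \<Longrightarrow> F \<cdot> t = G \<cdot> t \<Longrightarrow> \<exists>u. u \<in> hom C T E \<and> e \<cdot> u = t"
    using FG by (rule equaliser_obtain) blast
  have e [simp]: "E \<in> Ob C" "e \<in> Ar C" "Dom C e = E" "Cod C e = ?A" using E by auto
  define xE where "xE = ?x \<cdot> e"
  define wE where "wE = ?w \<cdot> e"
  define cE where "cE = ?c \<cdot> e"
  have Es [simp]: "xE \<in> Ar C" "Dom C xE = E" "Cod C xE = X" "wE \<in> Ar C" "Dom C wE = E" "Cod C wE = ?L"
    "cE \<in> Ar C" "Dom C cE = E" "Cod C cE = X'"
    by (simp_all add: xE_def wE_def cE_def)
  have dec: "pairing C xE (pairing C wE cE) = e"
    by (simp add: xE_def wE_def cE_def)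
  have pathE: "is_path xE wE" "endpoint xE wE = v \<cdot> cE"
    using e_eq FG_iff[of xE E wE cE] unfolding dec by auto
  have init: "is_path xE (butlast S wE)" "src \<cdot> last_edge xE wE = endpoint xE (butlast S wE)"
    using is_path_butlast[of xE E wE] pathE by simp_all
  \<comment> \<open>\<open>q\<close> does not distinguish the two ends of the last edge, so there is
    a point \<open>cE'\<close> over the source of that edge with the same image under
    \<open>z\<close>.\<close>
  have "f \<cdot> (z \<cdot> cE) = q \<cdot> (v \<cdot> cE)" by (rule Comp_eq_Comp[OF sq]) simp_all
  also have "\<dots> = q \<cdot> (tgt \<cdot> last_edge xE wE)" using pathE by (simp add: endpoint_def)
  also have "\<dots> = q \<cdot> (src \<cdot> last_edge xE wE)"
    by (rule Comp_eq_Comp[OF qs(4)[symmetric]]) simp_all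
  finally have "f \<cdot> (z \<cdot> cE) = q \<cdot> endpoint xE (butlast S wE)" using init by simp
  then obtain cE' where cE': "cE' \<in> hom C E X'" "z \<cdot> cE' = z \<cdot> cE" "v \<cdot> cE' = endpoint xE (butlast S wE)"
    using is_pullback_lift[OF pb, of "z \<cdot> cE" E "endpoint xE (butlast S wE)"] by auto
  have hcE': "h \<cdot> cE' = h \<cdot> cE"
    by (rule step[of "last_edge xE wE" E])
      (use cE' init pathE in \<open>simp_all add: endpoint_def\<close>)
  have "F \<cdot> pairing C xE (pairing C (butlast S wE) cE') = G \<cdot> pairing C xE (pairing C (butlast S wE) cE')"
    using FG_iff[of xE E "butlast S wE" cE'] cE' init by simp
  \<comment> \<open>The move as an endomorphism of \<open>E\<close>: it shortens the path and keeps
    the start as well as the values of \<open>z\<close> and \<open>h\<close> at the point.\<close>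
  then obtain d where d: "d \<in> hom C E E" "e \<cdot> d = pairing C xE (pairing C (butlast S wE) cE')"
    using lift[of "pairing C xE (pairing C (butlast S wE) cE')" E] cE' by auto
  have ds [simp]: "d \<in> Ar C" "Dom C d = E" "Cod C d = E" using d by auto
  have ed: "xE \<cdot> d = xE" "wE \<cdot> d = butlast S wE" "cE \<cdot> d = cE'"
    using d(2) cE'(1) by (simp_all add: xE_def wE_def cE_def)
  have edt [simp]: "xE \<cdot> d \<cdot> t = xE \<cdot> t" "wE \<cdot> d \<cdot> t = butlast S (wE \<cdot> t)" "z \<cdot> cE \<cdot> d \<cdot> t = z \<cdot> cE \<cdot> t"
      "h \<cdot> cE \<cdot> d \<cdot> t = h \<cdot> cE \<cdot> t"
    if t: "t \<in> Ar C" "Cod C t = E" for t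
  proof -
    show "xE \<cdot> d \<cdot> t = xE \<cdot> t" "wE \<cdot> d \<cdot> t = butlast S (wE \<cdot> t)"
      using Comp_eq[OF ed(1), of t] Comp_eq[OF ed(2), of t] t by simp_all
    have "cE \<cdot> d \<cdot> t = cE' \<cdot> t" using Comp_eq[OF ed(3), of t] t by simp
    then show "z \<cdot> cE \<cdot> d \<cdot> t = z \<cdot> cE \<cdot> t" "h \<cdot> cE \<cdot> d \<cdot> t = h \<cdot> cE \<cdot> t"
      using Comp_eq_Comp[OF cE'(2), of t] Comp_eq_Comp[OF hcE', of t] cE'(1) t by simp_all
  qed
  \<comment> \<open>\<open>D p l\<close> applies \<open>d\<close> to the state \<open>p\<close> once
    for each letter of \<open>l\<close>, whatever the letters are.\<close>
  define D where "D = lrec S (Id C E) (d \<cdot> proj1 C E S)"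
  have g: "d \<cdot> proj1 C E S \<in> hom C (prod_ob C E S) E" by simp
  have i: "Id C E \<in> hom C E E" by simp
  note rec = lrec_simps[OF graph_Ob(2) i g, folded D_def]
  have D_simps [simp]: "D p l \<in> Ar C" "Dom C (D p l) = Dom C l" "Cod C (D p l) = E"
      "\<And>t. t \<in> Ar C \<Longrightarrow> Cod C t = Dom C l \<Longrightarrow> D p l \<cdot> t = D (p \<cdot> t) (l \<cdot> t)"
    if "p \<in> Ar C" "l \<in> Ar C" "Dom C p = Dom C l" "Cod C p = E" "Cod C l = ?L" for p l
    using rec(1,2)[of p "Dom C l" l] that by simp_all
  have D_nil [simp]: "D p (nil S T) = p" if "p \<in> Ar C" "Dom C p = T" "Cod C p = E" for p T
    using rec(3)[of p T] that by simp
  have D_snoc [simp]: "D p (snoc S l s) = d \<cdot> D p l"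
    if "p \<in> Ar C" "l \<in> Ar C" "s \<in> Ar C" "Dom C p = Dom C s" "Dom C l = Dom C s" "Cod C p = E"
      "Cod C l = ?L" "Cod C s = S" for p l s
    using rec(4)[of p "Dom C s" l s] that by simp
  have invariant: "xE \<cdot> D p l = xE \<cdot> p" "wE \<cdot> D p l = drop_end S (wE \<cdot> p) l"
      "z \<cdot> cE \<cdot> D p l = z \<cdot> cE \<cdot> p" "h \<cdot> cE \<cdot> D p l = h \<cdot> cE \<cdot> p"
    if pl: "p \<in> hom C T E" "l \<in> hom C T ?L" for p l T
  proof -
    show "xE \<cdot> D p l = xE \<cdot> p"
      by (rule list_induct[where B = E and Y = X and F = "\<lambda>p l. xE \<cdot> D p l" and G = "\<lambda>p l. xE \<cdot> p"])
        (use pl in \<open>simp_all add: natural_op_def\<close>)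
    show "wE \<cdot> D p l = drop_end S (wE \<cdot> p) l"
      by (rule list_induct[where B = E and Y = ?L and F = "\<lambda>p l. wE \<cdot> D p l"
            and G = "\<lambda>p l. drop_end S (wE \<cdot> p) l"])
        (use pl in \<open>simp_all add: natural_op_def\<close>)
    show "z \<cdot> cE \<cdot> D p l = z \<cdot> cE \<cdot> p"
      by (rule list_induct[where B = E and Y = "Dom C f" and F = "\<lambda>p l. z \<cdot> cE \<cdot> D p l"
            and G = "\<lambda>p l. z \<cdot> cE \<cdot> p"])
        (use pl in \<open>simp_all add: natural_op_def\<close>)
    show "h \<cdot> cE \<cdot> D p l = h \<cdot> cE \<cdot> p"
      by (rule list_induct[where B = E and Y = W and F = "\<lambda>p l. h \<cdot> cE \<cdot> D p l"
            and G = "\<lambda>p l. h \<cdot> cE \<cdot> p"])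
        (use pl in \<open>simp_all add: natural_op_def\<close>)
  qed
  obtain p where p: "p \<in> hom C T E" "e \<cdot> p = pairing C x (pairing C w c)"
    using lift[of "pairing C x (pairing C w c)" T] FG_iff[of x T w c] x w c by auto
  have ps: "xE \<cdot> p = x" "wE \<cdot> p = w" "cE \<cdot> p = c"
    using p x w c by (simp_all add: xE_def wE_def cE_def)
  \<comment> \<open>The path of the state \<open>p\<close> is also the counter, so by
    \<open>drop_end_self\<close> no edge remains.\<close>
  let ?p = "D p w"
  have p': "?p \<in> hom C T E" using p w by simp
  have inv: "xE \<cdot> ?p = x" "wE \<cdot> ?p = nil S T" "z \<cdot> cE \<cdot> ?p = z \<cdot> c" "h \<cdot> cE \<cdot> ?p = h \<cdot> c"
    using invariant[OF p(1) w(1)] ps drop_end_self[of w T S] w by simp_all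
  \<comment> \<open>With an empty path the point lies over the start \<open>x\<close>; its image
    under \<open>z\<close> is still that of \<open>c\<close>, which leaves only
    \<open>c0\<close>.\<close>
  have "v \<cdot> cE \<cdot> ?p = endpoint xE wE \<cdot> ?p"
    using Comp_eq[OF pathE(2)[symmetric], of ?p] p' by simp
  also have "\<dots> = x" using p' inv x by simp
  finally have "cE \<cdot> ?p = c0"
    using is_pullback_unique[OF pb, of "cE \<cdot> ?p" T c0] p' c0 inv by simp
  then show ?thesis using inv by simp
qed

text \<open>The hypothesis \<open>step\<close> says that \<open>h\<close> coequalises the pulled
  back graph, without forming its object of edges: \<open>c\<close> and \<open>c'\<close> lie in one
  fibre of \<open>z\<close>, over the ends of an edge.\<close>

lemma pullback_quotient_factor:
  assumes q: "is_path_quotient q" and pb: "is_pullback C f q X' z v" and h: "h \<in> hom C X' W"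
    and step: "\<And>T s c c'. s \<in> hom C T S \<Longrightarrow> c \<in> hom C T X' \<Longrightarrow> c' \<in> hom C T X' \<Longrightarrow>
      v \<cdot> c = src \<cdot> s \<Longrightarrow> v \<cdot> c' = tgt \<cdot> s \<Longrightarrow> z \<cdot> c = z \<cdot> c' \<Longrightarrow> h \<cdot> c = h \<cdot> c'"
  shows "\<exists>!k. k \<in> hom C (Dom C f) W \<and> k \<cdot> z = h"
proof -
  note qs = is_path_quotient_simps[OF q]
  note D = is_pullback_D[OF pb]
  have z: "is_regular_epi C z"
    using exact pb qs(1) unfolding exact_category_def regular_category_def by blast
  have "\<exists>!k. k \<in> hom C (Cod C z) W \<and> k \<cdot> z = h"
  proof (rule regular_epi_factor[OF z])
    show "h \<in> hom C (Dom C z) W" using h D by simp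
    fix T a b assume ab: "a \<in> hom C T (Dom C z)" "b \<in> hom C T (Dom C z)" "z \<cdot> a = z \<cdot> b"
    have "q \<cdot> (v \<cdot> a) = f \<cdot> (z \<cdot> a)" by (rule Comp_eq_Comp[OF D(11)[symmetric]]) (use ab D in auto)
    also have "\<dots> = q \<cdot> (v \<cdot> b)" unfolding ab(3) by (rule Comp_eq_Comp[OF D(11)]) (use ab D in auto)
    finally have "q \<cdot> (v \<cdot> a) = q \<cdot> (v \<cdot> b)" .
    moreover have "v \<cdot> a \<in> hom C T X" "v \<cdot> b \<in> hom C T X" using ab D qs by auto
    ultimately obtain T' t where t: "is_regular_epi C t" "t \<in> hom C T' T" "linked ((v \<cdot> a) \<cdot> t) ((v \<cdot> b) \<cdot> t)"
      using q unfolding is_path_quotient_def by blast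
    have ts: "t \<in> Ar C" "Dom C t = T'" "Cod C t = T" using t(2) by auto
    have abs: "a \<in> Ar C" "Dom C a = T" "Cod C a = X'" "b \<in> Ar C" "Dom C b = T" "Cod C b = X'"
      using ab(1,2) D by auto
    obtain w where w: "w \<in> hom C T' (lists S)" "is_path (v \<cdot> a \<cdot> t) w" "endpoint (v \<cdot> a \<cdot> t) w = v \<cdot> b \<cdot> t"
      using t(3) ts abs D unfolding linked_def by auto
    \<comment> \<open>The path from \<open>v \<cdot> a\<close> to \<open>v \<cdot> b\<close> exists
      on the cover \<open>t\<close> only; the equation obtained there is cancelled along
      \<open>t\<close> afterwards.\<close>
    have "h \<cdot> (a \<cdot> t) = h \<cdot> (b \<cdot> t)"
    proof (rule transport_along_path[OF q pb h step, where x = "v \<cdot> a \<cdot> t" and w = w])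
      show "z \<cdot> (a \<cdot> t) = z \<cdot> (b \<cdot> t)"
        by (rule Comp_eq_Comp[OF ab(3)]) (use ts abs D in auto)
    qed (use w ts abs D qs in \<open>simp_all\<close>)
    then have "(h \<cdot> a) \<cdot> t = (h \<cdot> b) \<cdot> t" using ts abs h by simp
    then show "h \<cdot> a = h \<cdot> b"
      using regular_epi_epi[OF t(1), of "h \<cdot> a" W "h \<cdot> b"] ts abs h by simp
  qed
  then show ?thesis using D by simp
qed

text \<open>The case of the identity: pulling back along it returns \<open>q\<close>.\<close>

lemma path_quotient_factor:
  assumes q: "is_path_quotient q" and h: "h \<in> hom C X W" "h \<cdot> src = h \<cdot> tgt"
  shows "\<exists>!k. k \<in> hom C (Cod C q) W \<and> k \<cdot> q = h"
proof -
  note qs = is_path_quotient_simps[OF q]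
  have pb: "is_pullback C (Id C (Cod C q)) q X q (Id C X)"
    unfolding is_pullback_def
  proof (intro conjI ballI impI)
    fix T s t assume "t \<in> hom C T (Dom C q)" "Id C (Cod C q) \<cdot> s = q \<cdot> t"
      "s \<in> hom C T (Dom C (Id C (Cod C q)))"
    then have "t \<in> hom C T X" "q \<cdot> t = s" using qs by simp_all
    then show "\<exists>!u. u \<in> hom C T X \<and> q \<cdot> u = s \<and> Id C X \<cdot> u = t"
      by (intro ex1I[of _ t]) auto
  qed (use qs in simp_all)
  have "\<exists>!k. k \<in> hom C (Dom C (Id C (Cod C q))) W \<and> k \<cdot> q = h"
  proof (rule pullback_quotient_factor[OF q pb h(1)])
    fix T s c c' assume *: "s \<in> hom C T S" "c \<in> hom C T X" "c' \<in> hom C T X"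
      "Id C X \<cdot> c = src \<cdot> s" "Id C X \<cdot> c' = tgt \<cdot> s"
    have "h \<cdot> src \<cdot> s = h \<cdot> tgt \<cdot> s" by (rule Comp_eq_Comp[OF h(2)]) (use * h in auto)
    then show "h \<cdot> c = h \<cdot> c'" using * by simp
  qed
  then show ?thesis using qs by simp
qed

text \<open>The constructed quotient \<open>q0\<close> coequalises the graph and so factors through
  \<open>q\<close>. Elements identified by \<open>q\<close> are then identified by
  \<open>q0\<close>, whose paths serve for \<open>q\<close> as well.\<close>

lemma coequaliser_is_path_quotient:
  assumes q: "is_coequaliser C src tgt q"
  shows "is_path_quotient q"
proof -
  obtain q0 where q0: "is_path_quotient q0" using path_quotient_exists ..
  note q0s = is_path_quotient_simps[OF q0] and qs = is_coequaliser_D[OF q]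
  have "q0 \<in> hom C (Cod C src) (Cod C q0)" using q0s by simp
  then obtain k where k: "k \<in> hom C (Cod C q) (Cod C q0)" "k \<cdot> q = q0"
    using is_coequaliser_factor[OF q] q0s(4) by blast
  have q0q: "q0 \<cdot> x = q0 \<cdot> y" if "x \<in> hom C T X" "y \<in> hom C T X" "q \<cdot> x = q \<cdot> y" for x y T
    using Comp_eq[OF k(2), of x] Comp_eq[OF k(2), of y] that k(1) qs by simp
  have q': "is_regular_epi C q" "Dom C q = X" "q \<cdot> src = q \<cdot> tgt"
    using q qs(6,7) unfolding is_regular_epi_def by auto
  show ?thesis
    unfolding is_path_quotient_def
  proof (intro conjI allI impI)
    fix T x y assume x: "x \<in> hom C T X" and y: "y \<in> hom C T X" and "q \<cdot> x = q \<cdot> y"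
    then have "q0 \<cdot> x = q0 \<cdot> y" by (rule q0q)
    then show "\<exists>T' t. is_regular_epi C t \<and> t \<in> hom C T' T \<and> linked (x \<cdot> t) (y \<cdot> t)"
      using q0 x y unfolding is_path_quotient_def by blast
  qed (fact q')+
qed

end

section \<open>Sums\<close>

locale list_pretopos = list_category C + exact_cat C for C :: "('o, 'm) cat" (structure) +
  assumes extensive: "extensive_category C"
begin

lemma is_coproduct_coprod_ob:
  assumes "A \<in> Ob C" "B \<in> Ob C"
  shows "is_coproduct C A B (coprod_ob C A B) (inj1 C A B) (inj2 C A B)"
proof -
  define K where "K = (\<lambda>i::nat. if i = 0 then A else B)"
  have fin: "has_finite_coproducts C" using extensive by (simp add: extensive_category_def)
  have K: "\<forall>i<2. K i \<in> Ob C" using assms by (simp add: K_def)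
  define is_sum where "is_sum S \<iota> \<longleftrightarrow> (\<forall>i<2. \<iota> i \<in> hom C (K i) S) \<and>
    (\<forall>T\<in>Ob C. \<forall>f. (\<forall>i<2. f i \<in> hom C (K i) T) \<longrightarrow>
      (\<exists>!u. u \<in> hom C S T \<and> (\<forall>i<2. u \<cdot> \<iota> i = f i)))" for S \<iota>
  have "\<exists>S\<in>Ob C. \<exists>\<iota>. is_sum S \<iota>"
    unfolding is_sum_def
    by (rule fin[unfolded has_finite_coproducts_def, THEN spec, THEN spec, THEN mp, OF K])
  then obtain S \<iota> where S: "S \<in> Ob C" and sum: "is_sum S \<iota>" by blast
  note \<iota> = sum[unfolded is_sum_def, THEN conjunct1]
    and univ = sum[unfolded is_sum_def, THEN conjunct2, THEN bspec, THEN spec, THEN mp]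
  have all2: "(\<forall>i<2. P i) \<longleftrightarrow> P 0 \<and> P 1" for P :: "nat \<Rightarrow> bool"
    by (auto simp: less_2_cases_iff)
  have "is_coproduct C A B S (\<iota> 0) (\<iota> 1)"
    unfolding is_coproduct_def
  proof (intro conjI ballI)
    show "S \<in> Ob C" "\<iota> 0 \<in> hom C A S" "\<iota> 1 \<in> hom C B S" using S \<iota> unfolding all2 by (simp_all add: K_def)
    fix T f g assume "T \<in> Ob C" "f \<in> hom C A T" "g \<in> hom C B T"
    then show "\<exists>!u. u \<in> hom C S T \<and> u \<cdot> \<iota> 0 = f \<and> u \<cdot> \<iota> 1 = g"
      using univ[of T "\<lambda>i :: nat. if i = 0 then f else g"] unfolding all2 by (simp add: K_def)
  qed
  then have "case chosen_coproduct C A B of (S, i, j) \<Rightarrow> is_coproduct C A B S i j"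
    unfolding chosen_coproduct_def by - (rule someI_ex, auto)
  then show ?thesis by (simp add: coprod_ob_def inj1_def inj2_def split: prod.splits)
qed

lemma coprod_simps [simp]:
  assumes "A \<in> Ob C" "B \<in> Ob C"
  shows "coprod_ob C A B \<in> Ob C"
    "inj1 C A B \<in> Ar C" "Dom C (inj1 C A B) = A" "Cod C (inj1 C A B) = coprod_ob C A B"
    "inj2 C A B \<in> Ar C" "Dom C (inj2 C A B) = B" "Cod C (inj2 C A B) = coprod_ob C A B"
  using is_coproduct_coprod_ob[OF assms] by (auto simp: is_coproduct_def)

lemma ex1_copairing:
  assumes "f \<in> hom C A T" "g \<in> hom C B T"
  shows "\<exists>!u. u \<in> hom C (coprod_ob C A B) T \<and> u \<cdot> inj1 C A B = f \<and> u \<cdot> inj2 C A B = g"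
proof -
  have "A \<in> Ob C" "B \<in> Ob C" "T \<in> Ob C" using assms by auto
  then show ?thesis using is_coproduct_coprod_ob[of A B] assms unfolding is_coproduct_def by blast
qed

lemma coproduct_eqI:
  assumes "A \<in> Ob C" "B \<in> Ob C" "g \<in> hom C (coprod_ob C A B) T" "g' \<in> hom C (coprod_ob C A B) T"
    "g \<cdot> inj1 C A B = g' \<cdot> inj1 C A B" "g \<cdot> inj2 C A B = g' \<cdot> inj2 C A B"
  shows "g = g'"
proof -
  have "g \<cdot> inj1 C A B \<in> hom C A T" "g \<cdot> inj2 C A B \<in> hom C B T" using assms by simp_all
  from ex1_copairing[OF this] show ?thesis using assms by metis
qed

definition copairing :: "'m \<Rightarrow> 'm \<Rightarrow> 'm" where
  "copairing f g = (THE u. u \<in> hom C (coprod_ob C (Dom C f) (Dom C g)) (Cod C f) \<and>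
     u \<cdot> inj1 C (Dom C f) (Dom C g) = f \<and> u \<cdot> inj2 C (Dom C f) (Dom C g) = g)"

lemma copairing_props:
  assumes "f \<in> hom C A T" "g \<in> hom C B T"
  shows "copairing f g \<in> hom C (coprod_ob C A B) T \<and> copairing f g \<cdot> inj1 C A B = f \<and> copairing f g \<cdot> inj2 C A B = g"
proof -
  have "Dom C f = A" "Dom C g = B" "Cod C f = T" using assms by auto
  then show ?thesis unfolding copairing_def using theI'[OF ex1_copairing[OF assms]] by simp
qed

lemma copairing_simps [simp]:
  assumes "f \<in> Ar C" "g \<in> Ar C" "Cod C f = Cod C g"
  shows "copairing f g \<in> Ar C" "Dom C (copairing f g) = coprod_ob C (Dom C f) (Dom C g)"
    "Cod C (copairing f g) = Cod C g"
    "Dom C f = A \<Longrightarrow> Dom C g = B \<Longrightarrow> copairing f g \<cdot> inj1 C A B = f"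
    "Dom C f = A \<Longrightarrow> Dom C g = B \<Longrightarrow> copairing f g \<cdot> inj2 C A B = g"
  using copairing_props[of f "Dom C f" "Cod C g" g "Dom C g"] assms by auto

lemma copairing_inj_Comp [simp]:
  assumes "f \<in> Ar C" "g \<in> Ar C" "Cod C f = Cod C g" "Dom C f = A" "Dom C g = B" "t \<in> Ar C"
  shows "Cod C t = A \<Longrightarrow> copairing f g \<cdot> inj1 C A B \<cdot> t = f \<cdot> t"
    "Cod C t = B \<Longrightarrow> copairing f g \<cdot> inj2 C A B \<cdot> t = g \<cdot> t"
proof -
  have "A \<in> Ob C" "B \<in> Ob C" using assms by auto
  then show "Cod C t = A \<Longrightarrow> copairing f g \<cdot> inj1 C A B \<cdot> t = f \<cdot> t"
    "Cod C t = B \<Longrightarrow> copairing f g \<cdot> inj2 C A B \<cdot> t = g \<cdot> t"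
    using assms by (simp_all add: Comp_eq)
qed

text \<open>The counit of the equivalence makes \<open>s\<close> isomorphic over the sum to some
  \<open>f + g\<close>, so \<open>T\<close> is itself the sum of the domains of \<open>f\<close> and
  \<open>g\<close>. This is case distinction on an element of a sum: equations at stage
  \<open>T\<close> are checked on the two parts.\<close>

lemma coproduct_decompose:
  assumes A: "A \<in> Ob C" and B: "B \<in> Ob C" and s: "s \<in> hom C T (coprod_ob C A B)"
  obtains T1 T2 t1 t2 a b where "t1 \<in> hom C T1 T" "t2 \<in> hom C T2 T" "a \<in> hom C T1 A" "b \<in> hom C T2 B"
    "s \<cdot> t1 = inj1 C A B \<cdot> a" "s \<cdot> t2 = inj2 C A B \<cdot> b"
    "\<And>W g g'. g \<in> hom C T W \<Longrightarrow> g' \<in> hom C T W \<Longrightarrow> g \<cdot> t1 = g' \<cdot> t1 \<Longrightarrow> g \<cdot> t2 = g' \<cdot> t2 \<Longrightarrow> g = g'"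
proof -
  let ?P = "prod_cat (slice C A) (slice C B)" and ?S = "slice C (coprod_ob C A B)"
  let ?F = "coprod_functor C"
  have "is_equivalence ?P ?S ?F" using extensive A B by (simp add: extensive_category_def)
  then obtain G \<epsilon> where G: "is_functor ?S ?P G" and \<epsilon>: "is_natural_iso ?S ?S (comp_functor ?F G) id_functor \<epsilon>"
    unfolding is_equivalence_def by blast
  have sO: "s \<in> Ob ?S" using s by (simp add: slice_def)
  obtain f g where fg: "FOb G s = (f, g)" by (cases "FOb G s")
  have "(f, g) \<in> Ob ?P" using G sO unfolding is_functor_def fg[symmetric] by blast
  then have f: "f \<in> Ar C" "Cod C f = A" and g: "g \<in> Ar C" "Cod C g = B"
    by (auto simp: prod_cat_def slice_def)
  let ?A = "Dom C f" and ?B = "Dom C g"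
  let ?c = "coprod_ar C f g"
  have "inj1 C A B \<cdot> f \<in> hom C ?A (coprod_ob C A B)" "inj2 C A B \<cdot> g \<in> hom C ?B (coprod_ob C A B)"
    using f g A B by simp_all
  from theI'[OF ex1_copairing[OF this]]
  have c: "?c \<in> hom C (coprod_ob C ?A ?B) (coprod_ob C A B)"
    "?c \<cdot> inj1 C ?A ?B = inj1 C A B \<cdot> f" "?c \<cdot> inj2 C ?A ?B = inj2 C A B \<cdot> g"
    unfolding coprod_ar_def using f g by simp_all
  have Ff: "FOb (comp_functor ?F G) s = ?c" by (simp add: comp_functor_def coprod_functor_def fg)
  have "\<epsilon> s \<in> hom ?S ?c s" "is_iso ?S (\<epsilon> s)"
    using \<epsilon> sO unfolding is_natural_iso_def Ff[symmetric] by (auto simp: id_functor_def)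
  moreover then obtain h where h: "\<epsilon> s = (?c, h, s)" by (auto simp: slice_def)
  ultimately obtain h' where iso: "h \<in> hom C (Dom C ?c) T" "s \<cdot> h = ?c" "h' \<in> hom C T (Dom C ?c)" "h \<cdot> h' = Id C T"
    using s unfolding is_iso_def slice_def by auto
  \<comment> \<open>The two injections, carried to \<open>T\<close> by the isomorphism
    \<open>h\<close>.\<close>
  let ?t1 = "h \<cdot> inj1 C ?A ?B" and ?t2 = "h \<cdot> inj2 C ?A ?B"
  show thesis
  proof (rule that[of ?t1 ?A ?t2 ?B f g])
    show "?t1 \<in> hom C ?A T" "?t2 \<in> hom C ?B T" using iso(1) c(1) f g by simp_all
    show "f \<in> hom C ?A A" "g \<in> hom C ?B B" using f g by simp_all
    show "s \<cdot> ?t1 = inj1 C A B \<cdot> f" "s \<cdot> ?t2 = inj2 C A B \<cdot> g"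
      using Comp_eq[OF iso(2), of "inj1 C ?A ?B"] Comp_eq[OF iso(2), of "inj2 C ?A ?B"] iso(1) c f g s by simp_all
    fix W k k' assume k: "k \<in> hom C T W" "k' \<in> hom C T W" and eq: "k \<cdot> ?t1 = k' \<cdot> ?t1" "k \<cdot> ?t2 = k' \<cdot> ?t2"
    have "k \<cdot> h = k' \<cdot> h"
      by (rule coproduct_eqI[of ?A ?B _ W]) (use eq k iso(1) c(1) f g in simp_all)
    then have "k \<cdot> h \<cdot> h' = k' \<cdot> h \<cdot> h'"
      by (rule Comp_eq_Comp) (use k iso(1,3) c(1) in simp_all)
    then show "k = k'" using iso(4) k by simp
  qed
qed

section \<open>Coequalisers\<close>

text \<open>The three summands are an edge from \<open>u \<cdot> a\<close> to
  \<open>v \<cdot> a\<close> for each \<open>a\<close>, its reverse, and a loop at each vertex.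
  \<open>flip\<close> exchanges the two copies of \<open>A\<close> and fixes the loops.\<close>

lemma generated_graph:
  assumes u: "u \<in> hom C A X" and v: "v \<in> hom C A X"
  shows "pretopos_graph X (coprod_ob C A (coprod_ob C A X)) (copairing u (copairing v (Id C X)))
    (copairing v (copairing u (Id C X))) (inj2 C A (coprod_ob C A X) \<cdot> inj2 C A X)
    (copairing (inj2 C A (coprod_ob C A X) \<cdot> inj1 C A X)
      (copairing (inj1 C A (coprod_ob C A X)) (inj2 C A (coprod_ob C A X) \<cdot> inj2 C A X))) C"
proof -
  have Ob: "A \<in> Ob C" "X \<in> Ob C" using u by auto
  let ?B = "coprod_ob C A X"
  let ?flip = "copairing (inj2 C A ?B \<cdot> inj1 C A X) (copairing (inj1 C A ?B) (inj2 C A ?B \<cdot> inj2 C A X))"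
  \<comment> \<open>Source and target arise from each other by exchanging \<open>u\<close> and
    \<open>v\<close>, so this one equation gives both laws of \<open>flip\<close>.\<close>
  have flip: "copairing f (copairing g (Id C X)) \<cdot> ?flip = copairing g (copairing f (Id C X))"
    if fg: "f \<in> hom C A X" "g \<in> hom C A X" for f g
  proof (rule coproduct_eqI[of A ?B _ X])
    let ?l = "copairing f (copairing g (Id C X)) \<cdot> ?flip" and ?r = "copairing g (copairing f (Id C X))"
    show "?l \<cdot> inj2 C A ?B = ?r \<cdot> inj2 C A ?B"
      by (rule coproduct_eqI[of A X _ X]) (use fg Ob in simp_all)
  qed (use fg Ob in simp_all)
  show ?thesis
    by unfold_locales (use u v Ob flip in simp_all)
qed

text \<open>A reversed edge imposes the same equation as the edge, and a loop imposes none.\<close>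

lemma generated_graph_coequalised_iff:
  assumes u: "u \<in> hom C A X" and v: "v \<in> hom C A X" and h: "h \<in> hom C X W"
  shows "h \<cdot> copairing u (copairing v (Id C X)) = h \<cdot> copairing v (copairing u (Id C X)) \<longleftrightarrow> h \<cdot> u = h \<cdot> v"
    (is "h \<cdot> ?src = h \<cdot> ?tgt \<longleftrightarrow> _")
proof
  have Ob: "A \<in> Ob C" "X \<in> Ob C" using u by auto
  let ?B = "coprod_ob C A X"
  assume eq: "h \<cdot> ?src = h \<cdot> ?tgt"
  have "h \<cdot> ?src \<cdot> inj1 C A ?B = h \<cdot> ?tgt \<cdot> inj1 C A ?B"
    by (rule Comp_eq_Comp[OF eq]) (use u v h Ob in simp_all)
  then show "h \<cdot> u = h \<cdot> v" using u v Ob by simp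
next
  have Ob: "A \<in> Ob C" "X \<in> Ob C" using u by auto
  let ?B = "coprod_ob C A X"
  assume eq: "h \<cdot> u = h \<cdot> v"
  show "h \<cdot> ?src = h \<cdot> ?tgt"
  proof (rule coproduct_eqI[of A ?B _ W])
    show "(h \<cdot> ?src) \<cdot> inj2 C A ?B = (h \<cdot> ?tgt) \<cdot> inj2 C A ?B"
      by (rule coproduct_eqI[of A X _ W]) (use u v h Ob eq in simp_all)
  qed (use u v h Ob eq in simp_all)
qed

lemma is_coequaliser_generated_graph_iff:
  assumes u: "u \<in> hom C A X" and v: "v \<in> hom C A X"
  shows "is_coequaliser C (copairing u (copairing v (Id C X))) (copairing v (copairing u (Id C X))) q \<longleftrightarrow>
    is_coequaliser C u v q"
proof -
  have Ob: "A \<in> Ob C" "X \<in> Ob C" using u by auto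
  have "h \<cdot> copairing u (copairing v (Id C X)) = h \<cdot> copairing v (copairing u (Id C X)) \<longleftrightarrow> h \<cdot> u = h \<cdot> v"
    if "h \<in> Ar C" "Dom C h = X" for h
    using generated_graph_coequalised_iff[OF u v, of h "Cod C h"] that by simp
  moreover have "copairing u (copairing v (Id C X)) \<in> Ar C" "copairing v (copairing u (Id C X)) \<in> Ar C"
    "Dom C (copairing u (copairing v (Id C X))) = Dom C (copairing v (copairing u (Id C X)))"
    "Cod C (copairing u (copairing v (Id C X))) = X" "Cod C (copairing v (copairing u (Id C X))) = X"
    using u v Ob by simp_all
  moreover have "u \<in> Ar C" "v \<in> Ar C" "Dom C u = A" "Dom C v = A" "Cod C u = X" "Cod C v = X"
    using u v by simp_all
  ultimately show ?thesis
    unfolding is_coequaliser_def by (metis (no_types, opaque_lifting))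
qed

lemma coequaliser_exists:
  assumes u: "u \<in> hom C A X" and v: "v \<in> hom C A X"
  shows "\<exists>q. is_coequaliser C u v q"
proof -
  interpret G: pretopos_graph X "coprod_ob C A (coprod_ob C A X)" "copairing u (copairing v (Id C X))"
    "copairing v (copairing u (Id C X))" "inj2 C A (coprod_ob C A X) \<cdot> inj2 C A X"
    "copairing (inj2 C A (coprod_ob C A X) \<cdot> inj1 C A X)
      (copairing (inj1 C A (coprod_ob C A X)) (inj2 C A (coprod_ob C A X) \<cdot> inj2 C A X))" C
    by (rule generated_graph[OF u v])
  obtain q where q: "G.is_path_quotient q" using G.path_quotient_exists ..
  note qs = G.is_path_quotient_simps[OF q]
  have uv: "u \<in> Ar C" "v \<in> Ar C" "Dom C u = A" "Dom C v = A" "Cod C u = X" "Cod C v = X"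
    using u v by simp_all
  have "is_coequaliser C u v q"
    unfolding is_coequaliser_def
  proof (intro conjI ballI impI)
    show "q \<cdot> u = q \<cdot> v"
      using generated_graph_coequalised_iff[OF u v, of q "Cod C q"] qs by simp
    fix h assume h: "h \<in> Ar C" "Dom C h = Cod C u \<and> h \<cdot> u = h \<cdot> v"
    then have hh: "h \<in> hom C X (Cod C h)" using uv by simp
    show "\<exists>!k. k \<in> hom C (Cod C q) (Cod C h) \<and> k \<cdot> q = h"
      by (rule G.path_quotient_factor[OF q hh])
        (use generated_graph_coequalised_iff[OF u v hh] h in blast)
  qed (use qs uv in simp_all)
  then show ?thesis ..
qed

text \<open>Transfers \<open>pullback_quotient_factor\<close> from the generated graph to the pair
  itself: \<open>step\<close> is assumed for the original edges and has to be extended to reverses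
  and loops.\<close>

lemma coequaliser_pullback_factor:
  assumes q: "is_coequaliser C u v q" and pb: "is_pullback C f q X' z p" and h: "h \<in> hom C X' W"
    and step: "\<And>T a c c'. a \<in> hom C T (Dom C u) \<Longrightarrow> c \<in> hom C T X' \<Longrightarrow> c' \<in> hom C T X' \<Longrightarrow>
      p \<cdot> c = u \<cdot> a \<Longrightarrow> p \<cdot> c' = v \<cdot> a \<Longrightarrow> z \<cdot> c = z \<cdot> c' \<Longrightarrow> h \<cdot> c = h \<cdot> c'"
  shows "\<exists>!k. k \<in> hom C (Dom C f) W \<and> k \<cdot> z = h"
proof -
  define A where "A = Dom C u"
  define X where "X = Cod C u"
  note qs = is_coequaliser_D[OF q]
  have u: "u \<in> hom C A X" and v: "v \<in> hom C A X" using qs by (simp_all add: A_def X_def)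
  have Ob: "A \<in> Ob C" "X \<in> Ob C" using u by auto
  let ?B = "coprod_ob C A X"
  let ?S = "coprod_ob C A ?B"
  let ?src = "copairing u (copairing v (Id C X))" and ?tgt = "copairing v (copairing u (Id C X))"
  interpret G: pretopos_graph X ?S ?src ?tgt "inj2 C A ?B \<cdot> inj2 C A X"
    "copairing (inj2 C A ?B \<cdot> inj1 C A X) (copairing (inj1 C A ?B) (inj2 C A ?B \<cdot> inj2 C A X))" C
    by (rule generated_graph[OF u v])
  have qG: "G.is_path_quotient q"
    using q by (intro G.coequaliser_is_path_quotient) (simp only: is_coequaliser_generated_graph_iff[OF u v])
  have zp: "z \<in> Ar C" "Dom C z = X'" "p \<in> Ar C" "Dom C p = X'" "Cod C p = X"
    using is_pullback_D[OF pb] qs by (simp_all add: X_def)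
  have uvs: "u \<in> Ar C" "Dom C u = A" "Cod C u = X" "v \<in> Ar C" "Dom C v = A" "Cod C v = X"
    using u v by simp_all
  show ?thesis
  proof (rule G.pullback_quotient_factor[OF qG pb h])
    fix T s c c' assume s: "s \<in> hom C T ?S" and c: "c \<in> hom C T X'" "c' \<in> hom C T X'"
      and pc: "p \<cdot> c = ?src \<cdot> s" "p \<cdot> c' = ?tgt \<cdot> s" and zc: "z \<cdot> c = z \<cdot> c'"
    have cs: "c \<in> Ar C" "Dom C c = T" "Cod C c = X'" "c' \<in> Ar C" "Dom C c' = T" "Cod C c' = X'"
      "s \<in> Ar C" "Dom C s = T" "Cod C s = ?S"
      using c s by simp_all
    have local: "p \<cdot> (c \<cdot> t) = ?src \<cdot> (s \<cdot> t)" "p \<cdot> (c' \<cdot> t) = ?tgt \<cdot> (s \<cdot> t)" "z \<cdot> (c \<cdot> t) = z \<cdot> (c' \<cdot> t)"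
      if "t \<in> Ar C" "Cod C t = T" for t
      using Comp_eq_Comp[OF pc(1), of t] Comp_eq_Comp[OF pc(2), of t] Comp_eq_Comp[OF zc, of t] that cs zp
      by simp_all
    \<comment> \<open>The stage is split according to the kind of edge that \<open>s\<close> is: an
      original one on \<open>T1\<close>, a reverse on \<open>T3\<close>, a loop on
      \<open>T4\<close>.\<close>
    obtain T1 T2 t1 t2 a b where t: "t1 \<in> hom C T1 T" "t2 \<in> hom C T2 T" "a \<in> hom C T1 A" "b \<in> hom C T2 ?B"
      "s \<cdot> t1 = inj1 C A ?B \<cdot> a" "s \<cdot> t2 = inj2 C A ?B \<cdot> b"
      and joint: "\<And>W g g'. g \<in> hom C T W \<Longrightarrow> g' \<in> hom C T W \<Longrightarrow> g \<cdot> t1 = g' \<cdot> t1 \<Longrightarrow> g \<cdot> t2 = g' \<cdot> t2 \<Longrightarrow> g = g'"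
      using coproduct_decompose[of A ?B s T] s Ob by (metis coprod_simps(1))
    obtain T3 T4 t3 t4 a' x where t': "t3 \<in> hom C T3 T2" "t4 \<in> hom C T4 T2" "a' \<in> hom C T3 A" "x \<in> hom C T4 X"
      "b \<cdot> t3 = inj1 C A X \<cdot> a'" "b \<cdot> t4 = inj2 C A X \<cdot> x"
      and joint': "\<And>W g g'. g \<in> hom C T2 W \<Longrightarrow> g' \<in> hom C T2 W \<Longrightarrow> g \<cdot> t3 = g' \<cdot> t3 \<Longrightarrow> g \<cdot> t4 = g' \<cdot> t4 \<Longrightarrow> g = g'"
      using coproduct_decompose[of A X b T2] t(4) Ob by metis
    have ts: "t1 \<in> Ar C" "Dom C t1 = T1" "Cod C t1 = T" "t2 \<in> Ar C" "Dom C t2 = T2" "Cod C t2 = T"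
      "t3 \<in> Ar C" "Dom C t3 = T3" "Cod C t3 = T2" "t4 \<in> Ar C" "Dom C t4 = T4" "Cod C t4 = T2"
      "a \<in> Ar C" "Dom C a = T1" "Cod C a = A" "b \<in> Ar C" "Dom C b = T2" "Cod C b = ?B"
      "a' \<in> Ar C" "Dom C a' = T3" "Cod C a' = A" "x \<in> Ar C" "Dom C x = T4" "Cod C x = X"
      using t(1-4) t'(1-4) by simp_all
    have s3: "s \<cdot> t2 \<cdot> t3 = inj2 C A ?B \<cdot> inj1 C A X \<cdot> a'" and s4: "s \<cdot> t2 \<cdot> t4 = inj2 C A ?B \<cdot> inj2 C A X \<cdot> x"
      using Comp_eq_Comp[OF t(6), of t3] Comp_eq_Comp[OF t(6), of t4] t'(5,6) ts cs Ob by simp_all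
    have "h \<cdot> (c \<cdot> t1) = h \<cdot> (c' \<cdot> t1)"
      by (rule step[of a T1]) (use local[of t1] t(5) ts cs uvs Ob in simp_all)
    \<comment> \<open>On reversed edges \<open>step\<close> applies with \<open>c\<close> and
      \<open>c'\<close> exchanged.\<close>
    moreover have "h \<cdot> (c' \<cdot> t2 \<cdot> t3) = h \<cdot> (c \<cdot> t2 \<cdot> t3)"
      by (rule step[of a' T3]) (use local[of "t2 \<cdot> t3"] s3 ts cs uvs Ob in simp_all)
    \<comment> \<open>Over a loop the two points have the same image under both projections of the
      pullback, so they coincide.\<close>
    moreover have "c \<cdot> t2 \<cdot> t4 = c' \<cdot> t2 \<cdot> t4"
      by (rule is_pullback_unique[OF pb, of _ T4]) (use local[of "t2 \<cdot> t4"] s4 ts cs uvs Ob in simp_all)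
    ultimately have "(h \<cdot> c) \<cdot> t1 = (h \<cdot> c') \<cdot> t1" "((h \<cdot> c) \<cdot> t2) \<cdot> t3 = ((h \<cdot> c') \<cdot> t2) \<cdot> t3"
      "((h \<cdot> c) \<cdot> t2) \<cdot> t4 = ((h \<cdot> c') \<cdot> t2) \<cdot> t4"
      using ts cs h by simp_all
    moreover from this(2,3) have "(h \<cdot> c) \<cdot> t2 = (h \<cdot> c') \<cdot> t2"
      by (rule joint'[of _ W, rotated 2]) (use ts cs h in simp_all)
    ultimately show "h \<cdot> c = h \<cdot> c'"
      using joint[of "h \<cdot> c" W "h \<cdot> c'"] cs h by simp
  qed
qed

end

section \<open>Slices\<close>

context finlim_category
begin

text \<open>The forgetful functor of a slice reflects coequalisers: a factorisation \<open>k\<close>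
  found in \<open>C\<close> lies over \<open>Y\<close>, because \<open>g \<cdot> k\<close> and
  \<open>c\<close> both factor \<open>b\<close> through \<open>q\<close>.\<close>

lemma slice_coequaliserI:
  assumes abc: "a \<in> Ar C" "Cod C a = Y" "b \<in> Ar C" "Cod C b = Y" "c \<in> Ar C" "Cod C c = Y"
    and u: "u \<in> hom C (Dom C a) (Dom C b)" "b \<cdot> u = a" and v: "v \<in> hom C (Dom C a) (Dom C b)" "b \<cdot> v = a"
    and q: "q \<in> hom C (Dom C b) (Dom C c)" "c \<cdot> q = b" "q \<cdot> u = q \<cdot> v"
    and factor: "\<And>W h. h \<in> hom C (Dom C b) W \<Longrightarrow> h \<cdot> u = h \<cdot> v \<Longrightarrow> \<exists>!k. k \<in> hom C (Dom C c) W \<and> k \<cdot> q = h"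
  shows "is_coequaliser (slice C Y) (a, u, b) (a, v, b) (b, q, c)"
  unfolding is_coequaliser_def
proof (intro conjI ballI impI)
  fix H assume H: "H \<in> Ar (slice C Y)" "Dom (slice C Y) H = Cod (slice C Y) (a, u, b) \<and>
    H \<cdot>\<^bsub>slice C Y\<^esub> (a, u, b) = H \<cdot>\<^bsub>slice C Y\<^esub> (a, v, b)"
  obtain b' h g where Hd: "H = (b', h, g)" by (cases H)
  have b': "b' = b" using H(2) unfolding Hd by (simp add: slice_def)
  have hu: "h \<cdot> u = h \<cdot> v" using H(2) unfolding Hd by (simp add: slice_def)
  have g: "g \<in> Ar C" "Cod C g = Y" and h: "h \<in> hom C (Dom C b) (Dom C g)" "g \<cdot> h = b"
    using H(1) unfolding Hd b' by (simp_all add: slice_def)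
  obtain k where k: "k \<in> hom C (Dom C c) (Dom C g)" "k \<cdot> q = h"
    and k_unique: "\<And>k'. k' \<in> hom C (Dom C c) (Dom C g) \<Longrightarrow> k' \<cdot> q = h \<Longrightarrow> k' = k"
    using factor[OF h(1) hu] by blast
  have "b \<in> hom C (Dom C b) Y" "b \<cdot> u = b \<cdot> v" using abc u v by simp_all
  then have "\<exists>!k. k \<in> hom C (Dom C c) Y \<and> k \<cdot> q = b" by (rule factor)
  moreover have "(g \<cdot> k) \<cdot> q = b" using k h q g abc by simp
  moreover have "g \<cdot> k \<in> hom C (Dom C c) Y" "c \<in> hom C (Dom C c) Y" using k g abc by simp_all
  ultimately have gk: "g \<cdot> k = c" using q(2) by blast
  show "\<exists>!K. K \<in> hom (slice C Y) (Cod (slice C Y) (b, q, c)) (Cod (slice C Y) H) \<and>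
      K \<cdot>\<^bsub>slice C Y\<^esub> (b, q, c) = H"
    unfolding Hd b'
  proof (rule ex1I[of _ "(c, k, g)"])
    show "(c, k, g) \<in> hom (slice C Y) (Cod (slice C Y) (b, q, c)) (Cod (slice C Y) (b, h, g)) \<and>
        (c, k, g) \<cdot>\<^bsub>slice C Y\<^esub> (b, q, c) = (b, h, g)"
      using abc g gk k by (simp add: slice_def)
    fix K assume K: "K \<in> hom (slice C Y) (Cod (slice C Y) (b, q, c)) (Cod (slice C Y) (b, h, g)) \<and>
        K \<cdot>\<^bsub>slice C Y\<^esub> (b, q, c) = (b, h, g)"
    obtain c' k' g' where Kd: "K = (c', k', g')" by (cases K)
    have "c' = c" "g' = g" "k' \<in> hom C (Dom C c') (Dom C g')" "k' \<cdot> q = h"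
      using K unfolding Kd by (simp_all add: slice_def)
    then show "K = (c, k, g)" using k_unique Kd by simp
  qed
qed (use abc u v q in \<open>simp_all add: slice_def\<close>)

text \<open>The forgetful functor also preserves coequalisers, having a right adjoint that sends
  \<open>W\<close> to the projection from the product of \<open>W\<close> and \<open>Y\<close> onto
  \<open>Y\<close>.\<close>

lemma slice_coequaliser_obtain:
  assumes "is_coequaliser (slice C Y) U V Q"
  obtains a u v b q c where "U = (a, u, b)" "V = (a, v, b)" "Q = (b, q, c)"
    "a \<in> Ar C" "Cod C a = Y" "b \<in> Ar C" "Cod C b = Y" "c \<in> Ar C" "Cod C c = Y"
    "u \<in> hom C (Dom C a) (Dom C b)" "b \<cdot> u = a" "v \<in> hom C (Dom C a) (Dom C b)" "b \<cdot> v = a"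
    "q \<in> hom C (Dom C b) (Dom C c)" "c \<cdot> q = b" "is_coequaliser C u v q"
proof -
  obtain a u b where U: "U = (a, u, b)" by (cases U)
  obtain a' v b' where V: "V = (a', v, b')" by (cases V)
  obtain b'' q c where Q: "Q = (b'', q, c)" by (cases Q)
  note co = assms[unfolded is_coequaliser_def U V Q]
  have ars: "(a, u, b) \<in> Ar (slice C Y)" "(a', v, b') \<in> Ar (slice C Y)" "(b'', q, c) \<in> Ar (slice C Y)"
    and "Dom (slice C Y) (a, u, b) = Dom (slice C Y) (a', v, b')"
      "Cod (slice C Y) (a, u, b) = Cod (slice C Y) (a', v, b')"
      "Dom (slice C Y) (b'', q, c) = Cod (slice C Y) (a, u, b)"
      "(b'', q, c) \<cdot>\<^bsub>slice C Y\<^esub> (a, u, b) = (b'', q, c) \<cdot>\<^bsub>slice C Y\<^esub> (a', v, b')"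
    using co by blast+
  then have eq: "a' = a" "b' = b" "b'' = b" "q \<cdot> u = q \<cdot> v"
    by (simp_all add: slice_def)
  from this ars[unfolded eq] have eqs: "a' = a" "b' = b" "b'' = b" and qu: "q \<cdot> u = q \<cdot> v"
    and abc: "a \<in> Ar C" "Cod C a = Y" "b \<in> Ar C" "Cod C b = Y" "c \<in> Ar C" "Cod C c = Y"
    and u: "u \<in> hom C (Dom C a) (Dom C b)" "b \<cdot> u = a" and v: "v \<in> hom C (Dom C a) (Dom C b)" "b \<cdot> v = a"
    and q: "q \<in> hom C (Dom C b) (Dom C c)" "c \<cdot> q = b"
    by (simp_all add: slice_def)
  have univ: "\<exists>!K. K \<in> hom (slice C Y) c g \<and> K \<cdot>\<^bsub>slice C Y\<^esub> (b, q, c) = (b, h, g)"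
    if g: "g \<in> Ar C" "Cod C g = Y" and h: "h \<in> hom C (Dom C b) (Dom C g)" "g \<cdot> h = b" "h \<cdot> u = h \<cdot> v" for g h
  proof -
    have "(b, h, g) \<in> Ar (slice C Y)" "Dom (slice C Y) (b, h, g) = Cod (slice C Y) (a, u, b)"
      "(b, h, g) \<cdot>\<^bsub>slice C Y\<^esub> (a, u, b) = (b, h, g) \<cdot>\<^bsub>slice C Y\<^esub> (a, v, b)"
      "Cod (slice C Y) (b, q, c) = c" "Cod (slice C Y) (b, h, g) = g"
      using g h abc by (simp_all add: slice_def)
    then show ?thesis using co unfolding eqs by metis
  qed
  have slice_hom: "K \<in> hom (slice C Y) c g \<longleftrightarrow> (\<exists>k. K = (c, k, g) \<and> k \<in> hom C (Dom C c) (Dom C g) \<and> g \<cdot> k = c)"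
    if "g \<in> Ar C" "Cod C g = Y" for K g
    using that abc by (cases K) (auto simp: slice_def)
  have slice_comp: "(c, k, g) \<cdot>\<^bsub>slice C Y\<^esub> (b, q, c) = (b, k \<cdot> q, g)" for k g
    by (simp add: slice_def)
  have triangle: "\<exists>k. k \<in> hom C (Dom C c) (Dom C g) \<and> g \<cdot> k = c \<and> k \<cdot> q = h \<and>
      (\<forall>k'. k' \<in> hom C (Dom C c) (Dom C g) \<and> g \<cdot> k' = c \<and> k' \<cdot> q = h \<longrightarrow> k' = k)"
    if g: "g \<in> Ar C" "Cod C g = Y" and h: "h \<in> hom C (Dom C b) (Dom C g)" "g \<cdot> h = b" "h \<cdot> u = h \<cdot> v" for g h
    using univ[OF g h]
  proof (rule ex1E)
    fix K assume K: "K \<in> hom (slice C Y) c g \<and> K \<cdot>\<^bsub>slice C Y\<^esub> (b, q, c) = (b, h, g)"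
      and unique: "\<forall>K'. K' \<in> hom (slice C Y) c g \<and> K' \<cdot>\<^bsub>slice C Y\<^esub> (b, q, c) = (b, h, g) \<longrightarrow> K' = K"
    obtain k where k: "K = (c, k, g)" "k \<in> hom C (Dom C c) (Dom C g)" "g \<cdot> k = c"
      using K slice_hom[OF g] by blast
    have "k \<cdot> q = h" using K unfolding k(1) slice_comp by simp
    moreover have "k' = k" if k': "k' \<in> hom C (Dom C c) (Dom C g)" "g \<cdot> k' = c" "k' \<cdot> q = h" for k'
    proof -
      have "(c, k', g) \<in> hom (slice C Y) c g" using k' slice_hom[OF g] by blast
      then have "(c, k', g) = K" using unique slice_comp k'(3) by blast
      then show ?thesis using k(1) by simp
    qed
    ultimately show ?thesis using k by blast
  qed
  have factor: "\<exists>!k. k \<in> hom C (Dom C c) W \<and> k \<cdot> q = h" if h: "h \<in> hom C (Dom C b) W" "h \<cdot> u = h \<cdot> v" for W h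
  proof -
    have Ob: "W \<in> Ob C" "Y \<in> Ob C" using h abc by auto
    \<comment> \<open>The value of the right adjoint at \<open>W\<close>; the transpose of
      \<open>h\<close> is \<open>pairing C h b\<close>.\<close>
    let ?g = "proj2 C W Y"
    have g: "?g \<in> Ar C" "Cod C ?g = Y" "Dom C ?g = prod_ob C W Y" using Ob by simp_all
    have "pairing C h b \<in> hom C (Dom C b) (Dom C ?g)" "?g \<cdot> pairing C h b = b"
        "pairing C h b \<cdot> u = pairing C h b \<cdot> v"
      using h abc u v Ob by simp_all
    from triangle[OF g(1,2) this] obtain k where
      k: "k \<in> hom C (Dom C c) (prod_ob C W Y)" "?g \<cdot> k = c" "k \<cdot> q = pairing C h b"
      and unique: "\<And>k'. k' \<in> hom C (Dom C c) (prod_ob C W Y) \<Longrightarrow> ?g \<cdot> k' = c \<Longrightarrow>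
        k' \<cdot> q = pairing C h b \<Longrightarrow> k' = k"
      unfolding g(3) by blast
    show ?thesis
    proof (rule ex1I[of _ "proj1 C W Y \<cdot> k"])
      show "proj1 C W Y \<cdot> k \<in> hom C (Dom C c) W \<and> (proj1 C W Y \<cdot> k) \<cdot> q = h"
        using k q h abc Ob by simp
      fix k' assume k': "k' \<in> hom C (Dom C c) W \<and> k' \<cdot> q = h"
      have "pairing C k' c \<in> hom C (Dom C c) (prod_ob C W Y)" "?g \<cdot> pairing C k' c = c"
        "pairing C k' c \<cdot> q = pairing C h b"
        using k' abc q Ob by simp_all
      then have "pairing C k' c = k" by (rule unique)
      moreover have "proj1 C W Y \<cdot> pairing C k' c = k'" using k' abc Ob by simp
      ultimately show "k' = proj1 C W Y \<cdot> k" by simp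
    qed
  qed
  have "is_coequaliser C u v q"
    unfolding is_coequaliser_def
  proof (intro conjI ballI impI)
    fix h assume h: "h \<in> Ar C" "Dom C h = Cod C u \<and> h \<cdot> u = h \<cdot> v"
    have "\<exists>!k. k \<in> hom C (Dom C c) (Cod C h) \<and> k \<cdot> q = h"
      by (rule factor) (use h u in simp_all)
    then show "\<exists>!k. k \<in> hom C (Cod C q) (Cod C h) \<and> k \<cdot> q = h" using q by simp
  qed (use u v q qu in simp_all)
  then show thesis using that U V Q eqs abc u v q by blast
qed

section \<open>Pullback functors between slices\<close>

lemma is_pullback_pb:
  assumes "f \<in> Ar C" "g \<in> Ar C" "Cod C f = Cod C g"
  shows "is_pullback C f g (pb_ob C f g) (pb_proj1 C f g) (pb_proj2 C f g)"
proof -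
  have "case chosen_pullback C f g of (P, p, q) \<Rightarrow> is_pullback C f g P p q"
    unfolding chosen_pullback_def
    by (rule someI_ex) (use pullback_exists[OF has_finite_limits assms] in auto)
  then show ?thesis by (simp add: pb_ob_def pb_proj1_def pb_proj2_def split: prod.splits)
qed

lemma pb_simps:
  assumes "f \<in> Ar C" "g \<in> Ar C" "Cod C f = Cod C g"
  shows "pb_ob C f g \<in> Ob C" "pb_proj1 C f g \<in> Ar C" "Dom C (pb_proj1 C f g) = pb_ob C f g"
    "Cod C (pb_proj1 C f g) = Dom C f" "pb_proj2 C f g \<in> Ar C" "Dom C (pb_proj2 C f g) = pb_ob C f g"
    "Cod C (pb_proj2 C f g) = Dom C g" "f \<cdot> pb_proj1 C f g = g \<cdot> pb_proj2 C f g"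
  using is_pullback_D[OF is_pullback_pb[OF assms]] by simp_all

lemma pullback_functor_obtain:
  assumes f: "f \<in> Ar C" "Cod C f = Y" and g: "g \<in> Ar C" "Cod C g = Y" and g': "g' \<in> Ar C" "Cod C g' = Y"
    and h: "h \<in> hom C (Dom C g) (Dom C g')" "g' \<cdot> h = g"
  obtains k where "FAr (pullback_functor C f) (g, h, g') = (pb_proj1 C f g, k, pb_proj1 C f g')"
    "k \<in> hom C (pb_ob C f g) (pb_ob C f g')" "pb_proj1 C f g' \<cdot> k = pb_proj1 C f g"
    "pb_proj2 C f g' \<cdot> k = h \<cdot> pb_proj2 C f g"
proof -
  have fg: "Cod C f = Cod C g" and fg': "Cod C f = Cod C g'" using f g g' by simp_all
  note p = pb_simps[OF f(1) g(1) fg]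
  have "g' \<cdot> h \<cdot> pb_proj2 C f g = g \<cdot> pb_proj2 C f g" by (rule Comp_eq[OF h(2)]) (use g' h p in simp_all)
  then have "f \<cdot> pb_proj1 C f g = g' \<cdot> (h \<cdot> pb_proj2 C f g)" using p(8) by simp
  moreover have "pb_proj1 C f g \<in> hom C (pb_ob C f g) (Dom C f)"
    "h \<cdot> pb_proj2 C f g \<in> hom C (pb_ob C f g) (Dom C g')" using p h by simp_all
  ultimately have "\<exists>!k. k \<in> hom C (pb_ob C f g) (pb_ob C f g') \<and> pb_proj1 C f g' \<cdot> k = pb_proj1 C f g \<and>
      pb_proj2 C f g' \<cdot> k = h \<cdot> pb_proj2 C f g"
    using is_pullback_pb[OF f(1) g'(1) fg'] p(1) unfolding is_pullback_def by blast
  from theI'[OF this] show thesis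
    by (intro that[of "THE k. k \<in> hom C (pb_ob C f g) (pb_ob C f g') \<and>
        pb_proj1 C f g' \<cdot> k = pb_proj1 C f g \<and> pb_proj2 C f g' \<cdot> k = h \<cdot> pb_proj2 C f g"])
      (auto simp: pullback_functor_def)
qed

text \<open>The pasting law for the squares of \<open>f\<close> with \<open>b\<close> and with
  \<open>c\<close>. It displays the image of \<open>q\<close> under the pullback functor as a
  pullback of \<open>q\<close> itself, the form required by
  \<open>coequaliser_pullback_factor\<close>.\<close>

lemma pullback_pasting:
  assumes f: "f \<in> Ar C" "Cod C f = Y" and b: "b \<in> Ar C" "Cod C b = Y" and c: "c \<in> Ar C" "Cod C c = Y"
    and q: "q \<in> hom C (Dom C b) (Dom C c)" "c \<cdot> q = b"
    and k: "k \<in> hom C (pb_ob C f b) (pb_ob C f c)" "pb_proj1 C f c \<cdot> k = pb_proj1 C f b"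
      "pb_proj2 C f c \<cdot> k = q \<cdot> pb_proj2 C f b"
  shows "is_pullback C (pb_proj2 C f c) q (pb_ob C f b) k (pb_proj2 C f b)"
proof -
  have fb: "Cod C f = Cod C b" and fc: "Cod C f = Cod C c" using f b c by simp_all
  note pb = pb_simps[OF f(1) b(1) fb] and pc = pb_simps[OF f(1) c(1) fc]
  note Pb = is_pullback_pb[OF f(1) b(1) fb] and Pc = is_pullback_pb[OF f(1) c(1) fc]
  show ?thesis
    unfolding is_pullback_def
  proof (intro conjI ballI impI)
    fix T s t assume "s \<in> hom C T (Dom C (pb_proj2 C f c))" "t \<in> hom C T (Dom C q)"
      and eq: "pb_proj2 C f c \<cdot> s = q \<cdot> t"
    then have s: "s \<in> hom C T (pb_ob C f c)" and t: "t \<in> hom C T (Dom C b)" using pc q by simp_all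
    have "f \<cdot> pb_proj1 C f c \<cdot> s = c \<cdot> pb_proj2 C f c \<cdot> s"
      by (rule Comp_eq_Comp[OF pc(8)]) (use f c pc s in simp_all)
    also have "\<dots> = b \<cdot> t" unfolding eq by (rule Comp_eq[OF q(2)]) (use q c t in simp_all)
    finally have "f \<cdot> (pb_proj1 C f c \<cdot> s) = b \<cdot> t" .
    moreover have "pb_proj1 C f c \<cdot> s \<in> hom C T (Dom C f)" using pc s by simp
    ultimately obtain u where u: "u \<in> hom C T (pb_ob C f b)" "pb_proj1 C f b \<cdot> u = pb_proj1 C f c \<cdot> s"
        "pb_proj2 C f b \<cdot> u = t"
      using is_pullback_lift[OF Pb _ t] by blast
    have k1: "pb_proj1 C f c \<cdot> (k \<cdot> w) = pb_proj1 C f b \<cdot> w" and k2: "pb_proj2 C f c \<cdot> (k \<cdot> w) = q \<cdot> (pb_proj2 C f b \<cdot> w)"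
      if "w \<in> hom C T (pb_ob C f b)" for w
      using Comp_eq[OF k(2), of w] Comp_eq_Comp[OF k(3), of w] that k(1) pb pc q(1) by simp_all
    show "\<exists>!u. u \<in> hom C T (pb_ob C f b) \<and> k \<cdot> u = s \<and> pb_proj2 C f b \<cdot> u = t"
    proof (rule ex1I[of _ u])
      have "k \<cdot> u = s"
        by (rule is_pullback_unique[OF Pc, of _ T]) (use k1[OF u(1)] k2[OF u(1)] u k(1) s eq in simp_all)
      then show "u \<in> hom C T (pb_ob C f b) \<and> k \<cdot> u = s \<and> pb_proj2 C f b \<cdot> u = t" using u by simp
      fix w assume w: "w \<in> hom C T (pb_ob C f b) \<and> k \<cdot> w = s \<and> pb_proj2 C f b \<cdot> w = t"
      then have "w \<in> hom C T (pb_ob C f b)" ..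
      from this u(1) show "w = u"
      proof (rule is_pullback_unique[OF Pb])
        show "pb_proj1 C f b \<cdot> w = pb_proj1 C f b \<cdot> u" using k1[of w] w u(2) by simp
        show "pb_proj2 C f b \<cdot> w = pb_proj2 C f b \<cdot> u" using w u(3) by simp
      qed
    qed
  qed (use pb pc q k in simp_all)
qed

end

context list_pretopos
begin

lemma pullback_functor_preserves_coequalisers:
  assumes f: "f \<in> hom C X Y"
  shows "preserves_coequalisers (slice C Y) (slice C X) (pullback_functor C f)"
  unfolding preserves_coequalisers_def
proof (intro allI impI)
  fix U V Q assume "is_coequaliser (slice C Y) U V Q"
  then obtain a u v b q c where UVQ: "U = (a, u, b)" "V = (a, v, b)" "Q = (b, q, c)"
    and a: "a \<in> Ar C" "Cod C a = Y" and b: "b \<in> Ar C" "Cod C b = Y" and c: "c \<in> Ar C" "Cod C c = Y"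
    and u: "u \<in> hom C (Dom C a) (Dom C b)" "b \<cdot> u = a" and v: "v \<in> hom C (Dom C a) (Dom C b)" "b \<cdot> v = a"
    and q: "q \<in> hom C (Dom C b) (Dom C c)" "c \<cdot> q = b" and coeq: "is_coequaliser C u v q"
    by (rule slice_coequaliser_obtain)
  have f': "f \<in> Ar C" "Cod C f = Y" "Dom C f = X" using f by simp_all
  have cods: "Cod C f = Cod C a" "Cod C f = Cod C b" "Cod C f = Cod C c" using f' a b c by simp_all
  note pa = pb_simps[OF f'(1) a(1) cods(1)] and pb = pb_simps[OF f'(1) b(1) cods(2)]
    and pc = pb_simps[OF f'(1) c(1) cods(3)]
  let ?F = "FAr (pullback_functor C f)"
  obtain u' where Fu: "?F (a, u, b) = (pb_proj1 C f a, u', pb_proj1 C f b)"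
    and u': "u' \<in> hom C (pb_ob C f a) (pb_ob C f b)" "pb_proj1 C f b \<cdot> u' = pb_proj1 C f a"
      "pb_proj2 C f b \<cdot> u' = u \<cdot> pb_proj2 C f a"
    by (rule pullback_functor_obtain[OF f'(1,2) a b u])
  obtain v' where Fv: "?F (a, v, b) = (pb_proj1 C f a, v', pb_proj1 C f b)"
    and v': "v' \<in> hom C (pb_ob C f a) (pb_ob C f b)" "pb_proj1 C f b \<cdot> v' = pb_proj1 C f a"
      "pb_proj2 C f b \<cdot> v' = v \<cdot> pb_proj2 C f a"
    by (rule pullback_functor_obtain[OF f'(1,2) a b v])
  obtain z where Fq: "?F (b, q, c) = (pb_proj1 C f b, z, pb_proj1 C f c)"
    and z: "z \<in> hom C (pb_ob C f b) (pb_ob C f c)" "pb_proj1 C f c \<cdot> z = pb_proj1 C f b"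
      "pb_proj2 C f c \<cdot> z = q \<cdot> pb_proj2 C f b"
    by (rule pullback_functor_obtain[OF f'(1,2) b c q])
  note square = pullback_pasting[OF f'(1,2) b c q z]
  have qu: "q \<cdot> u = q \<cdot> v" by (rule is_coequaliser_D(7)[OF coeq])
  have "is_coequaliser (slice C X) (pb_proj1 C f a, u', pb_proj1 C f b) (pb_proj1 C f a, v', pb_proj1 C f b)
      (pb_proj1 C f b, z, pb_proj1 C f c)"
  proof (rule slice_coequaliserI)
    show "z \<cdot> u' = z \<cdot> v'"
    proof (rule is_pullback_unique[OF is_pullback_pb[OF f'(1) c(1) cods(3)], of _ "pb_ob C f a"])
      show "pb_proj1 C f c \<cdot> (z \<cdot> u') = pb_proj1 C f c \<cdot> (z \<cdot> v')"
        using Comp_eq[OF z(2), of u'] Comp_eq[OF z(2), of v'] u' v' z(1) pc by simp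
      have "pb_proj2 C f c \<cdot> (z \<cdot> w) = q \<cdot> (pb_proj2 C f b \<cdot> w)" if "w \<in> hom C (pb_ob C f a) (pb_ob C f b)" for w
        by (rule Comp_eq_Comp[OF z(3)]) (use that z(1) pb pc q in simp_all)
      moreover have "q \<cdot> u \<cdot> pb_proj2 C f a = q \<cdot> v \<cdot> pb_proj2 C f a"
        by (rule Comp_eq_Comp[OF qu]) (use u v q pa in simp_all)
      ultimately show "pb_proj2 C f c \<cdot> (z \<cdot> u') = pb_proj2 C f c \<cdot> (z \<cdot> v')" using u' v' by simp
    qed (use z(1) u'(1) v'(1) in simp_all)
    fix W h assume "h \<in> hom C (Dom C (pb_proj1 C f b)) W" and eq: "h \<cdot> u' = h \<cdot> v'"
    then have h: "h \<in> hom C (pb_ob C f b) W" using pb by simp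
    have "\<exists>!k. k \<in> hom C (Dom C (pb_proj2 C f c)) W \<and> k \<cdot> z = h"
    proof (rule coequaliser_pullback_factor[OF coeq square h])
      fix T \<alpha> s s' assume "\<alpha> \<in> hom C T (Dom C u)" and s: "s \<in> hom C T (pb_ob C f b)" "s' \<in> hom C T (pb_ob C f b)"
        and ps: "pb_proj2 C f b \<cdot> s = u \<cdot> \<alpha>" "pb_proj2 C f b \<cdot> s' = v \<cdot> \<alpha>" and zs: "z \<cdot> s = z \<cdot> s'"
      then have \<alpha>: "\<alpha> \<in> hom C T (Dom C a)" using u by simp
      \<comment> \<open>\<open>z\<close> is an arrow over \<open>X\<close>, so points in one fibre
        of \<open>z\<close> have the same position in \<open>X\<close>.\<close>
      have p1: "pb_proj1 C f b \<cdot> s = pb_proj1 C f b \<cdot> s'"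
      proof -
        have "pb_proj1 C f b \<cdot> w = pb_proj1 C f c \<cdot> (z \<cdot> w)" if "w \<in> hom C T (pb_ob C f b)" for w
          using Comp_eq[OF z(2), of w] that z(1) pc by simp
        then show ?thesis using s zs by simp
      qed
      have "f \<cdot> (pb_proj1 C f b \<cdot> s) = b \<cdot> (pb_proj2 C f b \<cdot> s)"
        by (rule Comp_eq_Comp[OF pb(8)]) (use f' b pb s in simp_all)
      also have "\<dots> = a \<cdot> \<alpha>" unfolding ps by (rule Comp_eq[OF u(2)]) (use b u \<alpha> in simp_all)
      finally have "f \<cdot> (pb_proj1 C f b \<cdot> s) = a \<cdot> \<alpha>" .
      moreover have "pb_proj1 C f b \<cdot> s \<in> hom C T (Dom C f)" using pb s by simp
      \<comment> \<open>\<open>\<alpha>\<close> together with the common position in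
        \<open>X\<close> is an element of the pullback of \<open>a\<close>. Its images under
        \<open>u'\<close> and \<open>v'\<close> are \<open>s\<close> and \<open>s'\<close>, which
        reduces the claim to \<open>h \<cdot> u' = h \<cdot> v'\<close>.\<close>
      ultimately obtain w where w: "w \<in> hom C T (pb_ob C f a)" "pb_proj1 C f a \<cdot> w = pb_proj1 C f b \<cdot> s"
          "pb_proj2 C f a \<cdot> w = \<alpha>"
        using is_pullback_lift[OF is_pullback_pb[OF f'(1) a(1) cods(1)] _ \<alpha>] by blast
      have "u' \<cdot> w = s"
      proof (rule is_pullback_unique[OF is_pullback_pb[OF f'(1) b(1) cods(2)], of _ T])
        show "pb_proj1 C f b \<cdot> (u' \<cdot> w) = pb_proj1 C f b \<cdot> s"
          using Comp_eq[OF u'(2), of w] w u'(1) pb by simp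
        show "pb_proj2 C f b \<cdot> (u' \<cdot> w) = pb_proj2 C f b \<cdot> s"
          using Comp_eq_Comp[OF u'(3), of w] w u'(1) u(1) pa pb ps by simp
      qed (use w u'(1) s in simp_all)
      moreover have "v' \<cdot> w = s'"
      proof (rule is_pullback_unique[OF is_pullback_pb[OF f'(1) b(1) cods(2)], of _ T])
        show "pb_proj1 C f b \<cdot> (v' \<cdot> w) = pb_proj1 C f b \<cdot> s'"
          using Comp_eq[OF v'(2), of w] w v'(1) pb p1 by simp
        show "pb_proj2 C f b \<cdot> (v' \<cdot> w) = pb_proj2 C f b \<cdot> s'"
          using Comp_eq_Comp[OF v'(3), of w] w v'(1) v(1) pa pb ps by simp
      qed (use w v'(1) s in simp_all)
      moreover have "h \<cdot> u' \<cdot> w = h \<cdot> v' \<cdot> w"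
        by (rule Comp_eq_Comp[OF eq]) (use h u'(1) v'(1) w in simp_all)
      ultimately show "h \<cdot> s = h \<cdot> s'" by simp
    qed
    then show "\<exists>!k. k \<in> hom C (Dom C (pb_proj1 C f c)) W \<and> k \<cdot> z = h" using pc by simp
  qed (use pa pb pc u' v' z f' in simp_all)
  then show "is_coequaliser (slice C X) (?F U) (?F V) (?F Q)" unfolding UVQ Fu Fv Fq .
qed

end

theorem lemma7p10:
  fixes E :: "('o, 'm) cat"
  assumes "list_arithmetic_pretopos E"
  shows "has_pullback_stable_coequalisers E"
proof -
  have "category E"
    using assms by (simp add: list_arithmetic_pretopos_def exact_category_def regular_category_def)
  moreover have "has_finite_limits E" "has_parametrised_list_objects E" "exact_category E" "extensive_category E"
    using assms by (simp_all add: list_arithmetic_pretopos_def lextensive_category_def)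
  ultimately interpret list_pretopos E
    by (simp add: list_pretopos_def list_pretopos_axioms_def list_category_def list_category_axioms_def
        exact_cat_def exact_cat_axioms_def finlim_category_def finlim_category_axioms_def)
  have "has_pullbacks E"
    unfolding has_pullbacks_def using pullback_exists[OF has_finite_limits] by blast
  moreover have "has_coequalisers E"
    unfolding has_coequalisers_def using coequaliser_exists by simp
  ultimately show ?thesis
    unfolding has_pullback_stable_coequalisers_def using pullback_functor_preserves_coequalisers by blast
qed

end
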